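(* Let $p$ be a prime, let $\mathbb{F}$ be a field of characteristic $p$, and let $G$ be a finite $2$-generated $p$-group such that the subgroup $N = C_G(G'/\Phi(G'))$ is abelian and has index $p$ in $G$. Then $N$ is determined by $\mathbb{F}G$; that is, for every finite $p$-group $H$ such that $\mathbb{F}G \cong \mathbb{F}H$ as $\mathbb{F}$-algebras, the groups $C_H(H'/\Phi(H'))$ and $N$ are isomorphic.
   Context: For a finite $p$-group $X$, $X'$ denotes the commutator subgroup of $X$, $\Phi(X')$ denotes the Frattini subgroup of $X'$, and $C_X(X'/\Phi(X')) = \{g \in X : g^{-1}h^{-1}gh \in \Phi(X') \text{ for all } h \in X'\}$ is the centralizer in $X$ of the section $X'/\Phi(X')$ under the conjugation action. $\mathbb{F}X$ denotes the group algebra of $X$ over $\mathbb{F}$. *)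

theory Defs
  imports "HOL-Algebra.Algebra"
begin

definition finite_p_group :: "nat \<Rightarrow> ('g, 'm) monoid_scheme \<Rightarrow> bool" where
  "finite_p_group p G \<longleftrightarrow> group G \<and> finite (carrier G) \<and> (\<exists>n. order G = p ^ n)"

definition two_generated :: "('g, 'm) monoid_scheme \<Rightarrow> bool" where
  "two_generated G \<longleftrightarrow> (\<exists>a\<in>carrier G. \<exists>b\<in>carrier G. generate G {a, b} = carrier G)"

definition maximal_subgroup :: "'g set \<Rightarrow> ('g, 'm) monoid_scheme \<Rightarrow> bool" where
  "maximal_subgroup M G \<longleftrightarrow> subgroup M G \<and> M \<noteq> carrier G \<and>
     (\<forall>K. subgroup K G \<and> M \<subseteq> K \<longrightarrow> K = M \<or> K = carrier G)"

text \<open>Intersecting with the carrier makes the Frattini subgroup the whole group when there are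
  no maximal subgroups, in particular for the trivial group.\<close>

definition frattini :: "('g, 'm) monoid_scheme \<Rightarrow> 'g set" where
  "frattini G = carrier G \<inter> \<Inter> {M. maximal_subgroup M G}"

abbreviation commutator_subgroup :: "('g, 'm) monoid_scheme \<Rightarrow> 'g set" where
  "commutator_subgroup G \<equiv> derived G (carrier G)"

text \<open>The centralizer \<open>C\<^sub>G(G'/\<Phi>(G'))\<close>; here \<open>\<Phi>\<close> is taken of \<open>G'\<close> as a group in its own right.\<close>

definition section_centralizer :: "('g, 'm) monoid_scheme \<Rightarrow> 'g set" where
  "section_centralizer G =
     {g \<in> carrier G. \<forall>h \<in> commutator_subgroup G.
        inv\<^bsub>G\<^esub> g \<otimes>\<^bsub>G\<^esub> inv\<^bsub>G\<^esub> h \<otimes>\<^bsub>G\<^esub> g \<otimes>\<^bsub>G\<^esub> h \<in> frattini (G\<lparr>carrier := commutator_subgroup G\<rparr>)}"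

text \<open>Elements of the group algebra are the finitely supported coefficient functions on the group,
  extended by \<open>0\<close> outside the carrier so that they are determined by their values on it.
  Multiplication is convolution, the sum being restricted to the support of the left factor
  so that it is finite also for infinite groups.\<close>

definition group_algebra :: "('g, 'm) monoid_scheme \<Rightarrow> ('f::field, 'g \<Rightarrow> 'f) module" where
  "group_algebra G =
    \<lparr>carrier = {u. finite {x. u x \<noteq> 0} \<and> {x. u x \<noteq> 0} \<subseteq> carrier G},
     monoid.mult = (\<lambda>u v x. if x \<in> carrier G
                       then \<Sum>y | y \<in> carrier G \<and> u y \<noteq> 0. u y * v (inv\<^bsub>G\<^esub> y \<otimes>\<^bsub>G\<^esub> x) else 0),
     one = (\<lambda>x. if x = \<one>\<^bsub>G\<^esub> then 1 else 0),
     ring.zero = (\<lambda>x. 0),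
     add = (\<lambda>u v x. u x + v x),
     module.smult = (\<lambda>c u x. c * u x)\<rparr>"

text \<open>The scalars are all elements of the type \<open>'f\<close>; ring isomorphisms are unital.\<close>

definition algebra_isomorphic ::
  "('f::field, 'a, 'm) module_scheme \<Rightarrow> ('f, 'b, 'n) module_scheme \<Rightarrow> bool" where
  "algebra_isomorphic A B \<longleftrightarrow>
     (\<exists>\<phi> \<in> ring_iso A B. \<forall>c. \<forall>u \<in> carrier A. \<phi> (c \<odot>\<^bsub>A\<^esub> u) = c \<odot>\<^bsub>B\<^esub> \<phi> u)"

end

theory Submission
  imports Defs "HOL-Library.Function_Algebras" "HOL-Computational_Algebra.Polynomial"
begin

text \<open>Write \<open>D = G'\<close> and let \<open>K\<close> be the ideal of \<open>FG\<close> generated by all additive commutators, which is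
  spanned by the differences \<open>g - h\<close> with \<open>Dg = Dh\<close>. The elements \<open>r\<close> with \<open>[r, K] \<subseteq> K\<^sup>2\<close> form the
  subalgebra \<open>FN + K\<close>, so the ideal \<open>J\<close> generated by the augmentation ideal of \<open>FN\<close> is preserved by
  every algebra isomorphism. Hence \<open>N\<close> has the same index in both groups and all \<open>dim J\<^sup>n\<close> agree.
  If \<open>N\<close> is abelian with a basis \<open>S\<close>, the monomials in the elements \<open>s - 1\<close> show that
  \<open>dim J\<^sup>n - dim J\<^bsup>n+1\<^esup>\<close> is \<open>|G : N|\<close> times the coefficient of \<open>x\<^sup>n\<close> in the product of the polynomials
  \<open>1 + x + \<dots> + x\<^bsup>q-1\<^esup>\<close>, where \<open>q\<close> runs through the orders of the elements of \<open>S\<close>; this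
  product determines the orders and so the isomorphism type of \<open>N\<close>.

  It remains to see that \<open>N\<^sub>H = C\<^sub>H(H'/\<Phi>(H'))\<close> is abelian. The prime \<open>p\<close> is odd: if \<open>p = 2\<close> and
  \<open>x \<notin> N\<close>, then \<open>[n, x\<^sup>2] = 1\<close> for \<open>n \<in> N\<close>, so \<open>x\<close> inverts \<open>D\<close> and centralizes \<open>D/\<Phi>(D)\<close>. The spaces of
  additive commutators have the same dimension, so \<open>G\<close> and \<open>H\<close> have equally many commuting pairs.
  In \<open>G\<close> the conjugacy class of every \<open>x \<notin> N\<close> is \<open>xD\<close>, whereas the class of every \<open>x \<in> H\<close> outside \<open>N\<^sub>H\<close>
  is \<open>xH'\<close> or has at least \<open>p\<^sup>3\<close> elements. If \<open>N\<^sub>H\<close> were not abelian, \<open>H\<close> would therefore have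
  too few commuting pairs.\<close>

section \<open>Commutators and central sections in finite p-groups\<close>

text \<open>The isomorphism gives no access to single elements of \<open>H\<close>, so commutativity
  of its section centralizer has to be recovered from numbers. Commuting pairs are accessible
  because the additive commutators span the differences of conjugate group elements, so that their
  codimension is the number of conjugacy classes. The constant p^3 comes from ranks. The commutators
  \<open>[n, x]\<close> with n in N cover D modulo its Frattini subgroup W, and D/W has rank at
  least 2, since a normal section of order 1 or p is central and x does not centralize D/W. Rank at
  least 3 gives p^3 values at once. In rank 2 either W is trivial and the values fill D, or one more
  layer of order p below W is reached, which is where odd p enters. The covering requires generators
  x, y with y in N, also in H, which is not assumed to be 2-generated. What passes through the
  isomorphism is that the augmentation ideal modulo its square has dimension at most two; it is used
  in the dual form that any three homomorphisms into the additive group of F are linearly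
  dependent.\<close>

lemma card_image_eqI:
  assumes "\<And>x y. x \<in> A \<Longrightarrow> y \<in> A \<Longrightarrow> f x = f y \<longleftrightarrow> g x = g y"
  shows "card (f ` A) = card (g ` A)"
proof -
  define h where "h y = g (SOME x. x \<in> A \<and> f x = y)" for y
  have h: "h (f x) = g x" if "x \<in> A" for x
  proof -
    have "\<exists>x'. x' \<in> A \<and> f x' = f x" using that by blast
    then have "(SOME x'. x' \<in> A \<and> f x' = f x) \<in> A \<and> f (SOME x'. x' \<in> A \<and> f x' = f x) = f x"
      by (rule someI_ex)
    then show ?thesis unfolding h_def using assms that by blast
  qed
  have "bij_betw h (f ` A) (g ` A)"
    unfolding bij_betw_def inj_on_def using h assms by (auto simp: image_iff)
  then show ?thesis by (rule bij_betw_same_card)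
qed

text \<open>Orbit-stabilizer without an action: \<open>f\<close> plays the map onto an orbit and its
  fibres are assumed to be the right cosets of \<open>S\<close>. It serves for conjugates,
  commutators and cosets alike.\<close>

lemma (in group) orbit_card:
  assumes S: "subgroup S G"
    and f: "\<And>g h. g \<in> carrier G \<Longrightarrow> h \<in> carrier G \<Longrightarrow> f g = f h \<longleftrightarrow> g \<otimes> inv h \<in> S"
  shows "card (f ` carrier G) * card S = Coset.order G"
proof -
  have "card (f ` carrier G) = card ((\<lambda>g. S #> g) ` carrier G)"
  proof (rule card_image_eqI)
    fix g h assume "g \<in> carrier G" "h \<in> carrier G"
    then show "f g = f h \<longleftrightarrow> S #> g = S #> h"
      using f S subgroup.rcos_module[OF S is_group] repr_independence repr_independenceD
      by (metis subgroup.rcos_module_rev is_group rcos_self)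
  qed
  also have "(\<lambda>g. S #> g) ` carrier G = rcosets S" by (auto simp: RCOSETS_def)
  finally show ?thesis using lagrange[OF S] by simp
qed

lemma (in group) inv_comp_cancel [simp]:
  assumes "x \<in> carrier G" "y \<in> carrier G"
  shows "x \<otimes> (inv x \<otimes> y) = y" "inv x \<otimes> (x \<otimes> y) = y"
  using assms by (simp_all add: m_assoc [symmetric])

lemma (in group) commute_inv:
  assumes "a \<otimes> b = b \<otimes> a" "a \<in> carrier G" "b \<in> carrier G"
  shows "inv a \<otimes> b = b \<otimes> inv a"
proof -
  have "inv a \<otimes> b = inv a \<otimes> (b \<otimes> a) \<otimes> inv a" using assms(2,3) by (simp add: m_assoc)
  also have "\<dots> = b \<otimes> inv a" unfolding assms(1)[symmetric] using assms(2,3) by (simp add: m_assoc)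
  finally show ?thesis .
qed

lemma (in group) conj_eq_iff:
  assumes "a \<in> carrier G" "b \<in> carrier G" "c \<in> carrier G"
  shows "inv a \<otimes> b \<otimes> a = inv c \<otimes> b \<otimes> c \<longleftrightarrow> a \<otimes> inv c \<otimes> b = b \<otimes> (a \<otimes> inv c)"
proof
  assume "inv a \<otimes> b \<otimes> a = inv c \<otimes> b \<otimes> c"
  then have "a \<otimes> (inv a \<otimes> b \<otimes> a) \<otimes> inv c = a \<otimes> (inv c \<otimes> b \<otimes> c) \<otimes> inv c" by simp
  then show "a \<otimes> inv c \<otimes> b = b \<otimes> (a \<otimes> inv c)" using assms by (simp add: m_assoc)
next
  assume "a \<otimes> inv c \<otimes> b = b \<otimes> (a \<otimes> inv c)"
  then have "inv a \<otimes> (a \<otimes> inv c \<otimes> b) \<otimes> c = inv a \<otimes> (b \<otimes> (a \<otimes> inv c)) \<otimes> c" by simp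
  then show "inv a \<otimes> b \<otimes> a = inv c \<otimes> b \<otimes> c" using assms by (simp add: m_assoc)
qed

text \<open>The factors are ordered as in \<open>section_centralizer\<close>, so that
  \<open>section_centralizer_alt\<close> holds by unfolding. The library's
  \<open>derived_set\<close> inverts the last two factors instead, hence the inverses in
  \<open>gcomm_in_derived\<close>.\<close>

definition gcomm :: "('a, 'b) monoid_scheme \<Rightarrow> 'a \<Rightarrow> 'a \<Rightarrow> 'a" where
  "gcomm G a b = inv\<^bsub>G\<^esub> a \<otimes>\<^bsub>G\<^esub> inv\<^bsub>G\<^esub> b \<otimes>\<^bsub>G\<^esub> a \<otimes>\<^bsub>G\<^esub> b"

context group begin

lemma gcomm_closed [simp]:
  "a \<in> carrier G \<Longrightarrow> b \<in> carrier G \<Longrightarrow> gcomm G a b \<in> carrier G"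
  by (simp add: gcomm_def)

lemma gcomm_eq_one_iff:
  assumes "a \<in> carrier G" "b \<in> carrier G"
  shows "gcomm G a b = \<one> \<longleftrightarrow> a \<otimes> b = b \<otimes> a"
proof -
  have "gcomm G a b = inv (b \<otimes> a) \<otimes> (a \<otimes> b)" using assms
    by (simp add: gcomm_def inv_mult_group m_assoc)
  moreover have "inv (b \<otimes> a) \<otimes> (a \<otimes> b) = \<one> \<longleftrightarrow> a \<otimes> b = b \<otimes> a"
    using assms by (metis inv_closed inv_equality inv_inv m_closed l_inv inv_comp_cancel(1) r_one)
  ultimately show ?thesis by simp
qed

lemma gcomm_in_derived:
  assumes "a \<in> carrier G" "b \<in> carrier G"
  shows "gcomm G a b \<in> commutator_subgroup G"
proof -
  have "gcomm G a b = inv a \<otimes> inv b \<otimes> inv (inv a) \<otimes> inv (inv b)"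
    using assms by (simp add: gcomm_def)
  then have "gcomm G a b \<in> derived_set G (carrier G)" using assms
    by (smt (verit) UN_I inv_closed singletonI)
  then show ?thesis unfolding derived_def by (rule generate.incl)
qed

lemma inv_gcomm:
  assumes "a \<in> carrier G" "b \<in> carrier G"
  shows "inv (gcomm G a b) = gcomm G b a"
  using assms by (simp add: gcomm_def inv_mult_group m_assoc)

end

lemma (in group) normal_quotient_hom:
  assumes "A \<lhd> G"
  shows "group_hom G (G Mod A) (\<lambda>g. A #> g)"
    and "\<And>g. g \<in> carrier G \<Longrightarrow> A #> g = \<one>\<^bsub>G Mod A\<^esub> \<longleftrightarrow> g \<in> A"
    and "\<And>g h. g \<in> carrier G \<Longrightarrow> h \<in> carrier G \<Longrightarrow> A #> g = A #> h \<longleftrightarrow> g \<otimes> inv h \<in> A"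
proof -
  interpret A: normal A G by fact
  show "group_hom G (G Mod A) (\<lambda>g. A #> g)"
    using A.r_coset_hom_Mod A.factorgroup_is_group is_group
    by (simp add: group_hom_def group_hom_axioms_def)
  show 1: "A #> g = A #> h \<longleftrightarrow> g \<otimes> inv h \<in> A" if "g \<in> carrier G" "h \<in> carrier G" for g h
    using that A.rcos_module[OF is_group] repr_independence[OF _ _ A.is_subgroup] rcos_self A.is_subgroup
    by metis
  show "A #> g = \<one>\<^bsub>G Mod A\<^esub> \<longleftrightarrow> g \<in> A" if "g \<in> carrier G" for g
    using 1[of g \<one>] that A.subset by simp
qed

text \<open>Replaces the cosets by an abstract homomorphism with known kernel and fibres, so that
  congruences modulo \<open>A\<close> become equations between images.\<close>

lemma (in group) normal_quotientE:
  assumes "A \<lhd> G"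
  obtains Q :: "'a set monoid" and \<pi> where "group_hom G Q \<pi>" "\<pi> = (\<lambda>g. A #> g)"
    "\<And>g. g \<in> carrier G \<Longrightarrow> \<pi> g = \<one>\<^bsub>Q\<^esub> \<longleftrightarrow> g \<in> A"
    "\<And>g h. g \<in> carrier G \<Longrightarrow> h \<in> carrier G \<Longrightarrow> \<pi> g = \<pi> h \<longleftrightarrow> g \<otimes> inv h \<in> A"
  using normal_quotient_hom[OF assms] that[of "G Mod A" "\<lambda>g. A #> g"] by blast

lemma (in group_hom) hom_gcomm:
  assumes "a \<in> carrier G" "b \<in> carrier G"
  shows "h (gcomm G a b) = gcomm H (h a) (h b)"
  using assms by (simp add: gcomm_def)

lemma (in group) normal_card_image:
  assumes "A \<lhd> G" "subgroup B G" "A \<subseteq> B" "finite (carrier G)"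
  shows "card ((\<lambda>g. A #> g) ` B) * card A = card B"
proof -
  interpret B: group "G\<lparr>carrier := B\<rparr>" using assms(2) by (rule subgroup_imp_group)
  have "subgroup A G" using assms(1) by (rule normal_imp_subgroup)
  then have "subgroup A (G\<lparr>carrier := B\<rparr>)" using assms(2,3) by (rule subgroup_incl)
  from B.orbit_card[OF this, of "\<lambda>g. A #> g"] show ?thesis
    using normal_quotient_hom(3)[OF assms(1)] subgroup.subset[OF assms(2)] assms(2)
    by (auto simp: Coset.order_def subsetD m_inv_consistent)
qed

section \<open>Finite p-groups: orders of subgroups and central elements of quotients\<close>

locale finite_group = group G for G (structure) +
  assumes finite_carrier: "finite (carrier G)"

locale p_group = finite_group G for G (structure) + fixes p :: nat
  assumes prime_p: "Factorial_Ring.prime p"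
    and order_pow: "\<exists>n. Coset.order G = p ^ n"

lemma p_groupI: "Factorial_Ring.prime p \<Longrightarrow> finite_p_group p G \<Longrightarrow> p_group G p"
  by (simp add: finite_p_group_def p_group_def p_group_axioms_def finite_group_def finite_group_axioms_def)

context p_group begin

lemma dvd_orderD:
  assumes "k dvd Coset.order G" shows "\<exists>i. k = p ^ i"
  using assms order_pow divides_primepow_nat[OF prime_p] by auto

lemma subgroup_finite: "subgroup Y G \<Longrightarrow> finite Y"
  using finite_carrier finite_subset subgroup.subset by blast

lemma subgroup_card_pow:
  assumes "subgroup Y G" shows "\<exists>k. card Y = p ^ k"
  using dvd_orderD lagrange[OF assms] by (metis dvd_triv_right)

lemma subgroup_p_group:
  assumes "subgroup Y G" shows "p_group (G\<lparr>carrier := Y\<rparr>) p"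
  using assms subgroup_imp_group prime_p subgroup_finite subgroup_card_pow
  by (simp add: p_group_def p_group_axioms_def finite_group_def finite_group_axioms_def Coset.order_def)

lemma card_subgroup_psubset:
  assumes "subgroup Z G" "subgroup Y G" "Z \<subset> Y"
  shows "p * card Z dvd card Y"
proof -
  obtain i j where ij: "card Z = p ^ i" "card Y = p ^ j"
    using assms subgroup_card_pow by metis
  have "card Z < card Y" using assms subgroup_finite psubset_card_mono by blast
  then have "i < j" using ij prime_gt_1_nat[OF prime_p] by simp
  then have "Suc i \<le> j" by simp
  then show ?thesis unfolding ij by (metis le_imp_power_dvd power_Suc)
qed

lemma exponent: "\<exists>n. \<forall>x\<in>carrier G. x [^] (p ^ n) = \<one>"
  using order_pow pow_order_eq_1 by metis

text \<open>The nontrivial normal subgroup B/A of the p-group G/A meets the centre nontrivially.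
  Otherwise every conjugacy class of G/A in B/A other than the identity has size divisible by p;
  pulled back to G this makes p|A| a divisor of |B - A|. As p|A| also divides |B|, it would divide
  |A|.\<close>

lemma ex_central_modulo:
  assumes A: "A \<lhd> G" and B: "B \<lhd> G" and AB: "A \<subset> B"
  shows "\<exists>b\<in>B - A. \<forall>h\<in>carrier G. gcomm G b h \<in> A"
proof (rule ccontr)
  assume "\<not> ?thesis"
  then have nc: "\<exists>h\<in>carrier G. gcomm G b h \<notin> A" if "b \<in> B - A" for b using that by blast
  interpret A: normal A G by fact
  interpret B: normal B G by fact
  obtain Q :: "'a set monoid" and \<pi> where hom: "group_hom G Q \<pi>" and \<pi>: "\<pi> = (\<lambda>g. A #> g)"
    and ker: "\<And>g. g \<in> carrier G \<Longrightarrow> \<pi> g = \<one>\<^bsub>Q\<^esub> \<longleftrightarrow> g \<in> A"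
    and eqQ: "\<And>g h. g \<in> carrier G \<Longrightarrow> h \<in> carrier G \<Longrightarrow> \<pi> g = \<pi> h \<longleftrightarrow> g \<otimes> inv h \<in> A"
    using normal_quotientE[OF A] by blast
  interpret \<pi>: group_hom G Q \<pi> using hom .
  have finA: "finite A" and finB: "finite B" using subgroup_finite A.is_subgroup B.is_subgroup by auto
  \<comment> \<open>\<open>F b\<close> is the conjugacy class of the coset of \<open>b\<close> in
    the quotient, and \<open>r\<close> is conjugacy modulo \<open>A\<close>, pulled back to B -
    A.\<close>
  define F where "F b = (\<lambda>h. \<pi> (inv h \<otimes> b \<otimes> h)) ` carrier G" for b
  define r where "r = {(b, c). b \<in> B - A \<and> c \<in> B - A \<and> \<pi> c \<in> F b}"
  have F_mem: "\<pi> c \<in> F b \<longleftrightarrow> (\<exists>h\<in>carrier G. \<pi> c = inv\<^bsub>Q\<^esub> \<pi> h \<otimes>\<^bsub>Q\<^esub> \<pi> b \<otimes>\<^bsub>Q\<^esub> \<pi> h)"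
    if "b \<in> carrier G" for b c
    using that unfolding F_def by (auto simp: image_iff)
  have BG: "b \<in> B \<Longrightarrow> b \<in> carrier G" for b using B.subset by auto
  have eq: "equiv (B - A) r"
  proof (rule equivI)
    show "r \<subseteq> (B - A) \<times> (B - A)" unfolding r_def by auto
    show "refl_on (B - A) r"
    proof (rule refl_onI)
      fix b assume "b \<in> B - A"
      then show "(b, b) \<in> r" unfolding r_def using BG
        by (auto simp: F_mem intro!: bexI[of _ \<one>])
    qed
    show "sym r"
    proof (rule symI)
      fix b c assume bc: "(b, c) \<in> r"
      then have BC: "b \<in> carrier G" "c \<in> carrier G" unfolding r_def using BG by auto
      obtain h where h: "h \<in> carrier G" "\<pi> c = inv\<^bsub>Q\<^esub> \<pi> h \<otimes>\<^bsub>Q\<^esub> \<pi> b \<otimes>\<^bsub>Q\<^esub> \<pi> h"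
        using bc BC unfolding r_def by (auto simp: F_mem)
      have "\<pi> b = inv\<^bsub>Q\<^esub> \<pi> (inv h) \<otimes>\<^bsub>Q\<^esub> \<pi> c \<otimes>\<^bsub>Q\<^esub> \<pi> (inv h)"
        unfolding h(2) using h(1) BC by (simp add: \<pi>.H.m_assoc)
      then have "\<pi> b \<in> F c" unfolding F_mem[OF BC(2)] using h(1) by blast
      then show "(c, b) \<in> r" using bc unfolding r_def by auto
    qed
    show "trans r"
    proof (rule transI)
      fix b c d assume bc: "(b, c) \<in> r" and cd: "(c, d) \<in> r"
      then have BC: "b \<in> carrier G" "c \<in> carrier G" "d \<in> carrier G" unfolding r_def using BG by auto
      obtain h where h: "h \<in> carrier G" "\<pi> c = inv\<^bsub>Q\<^esub> \<pi> h \<otimes>\<^bsub>Q\<^esub> \<pi> b \<otimes>\<^bsub>Q\<^esub> \<pi> h"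
        using bc BC unfolding r_def by (auto simp: F_mem)
      obtain k where k: "k \<in> carrier G" "\<pi> d = inv\<^bsub>Q\<^esub> \<pi> k \<otimes>\<^bsub>Q\<^esub> \<pi> c \<otimes>\<^bsub>Q\<^esub> \<pi> k"
        using cd BC unfolding r_def by (auto simp: F_mem)
      have "\<pi> d = inv\<^bsub>Q\<^esub> \<pi> (h \<otimes> k) \<otimes>\<^bsub>Q\<^esub> \<pi> b \<otimes>\<^bsub>Q\<^esub> \<pi> (h \<otimes> k)"
        unfolding k(2) h(2) using h(1) k(1) BC
        by (simp add: \<pi>.H.m_assoc \<pi>.H.inv_mult_group)
      then have "\<pi> d \<in> F b" unfolding F_mem[OF BC(1)] using h(1) k(1) by blast
      then show "(b, d) \<in> r" using bc cd unfolding r_def by auto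
    qed
  qed
  have dvd_class: "p * card A dvd card Y" if Y: "Y \<in> (B - A) // r" for Y
  proof -
    obtain b where b: "b \<in> B - A" "Y = r `` {b}" using Y by (auto elim: quotientE)
    have bG: "b \<in> carrier G" using b BG by auto
    have sub: "F b \<subseteq> rcosets A" using bG unfolding F_def \<pi> by (auto intro: rcosetsI[OF A.subset])
    have Fin: "\<pi> c \<in> F b \<Longrightarrow> c \<in> carrier G \<Longrightarrow> c \<in> B - A" for c
    proof -
      assume c: "\<pi> c \<in> F b" "c \<in> carrier G"
      then obtain h where h: "h \<in> carrier G" "\<pi> c = \<pi> (inv h \<otimes> b \<otimes> h)" unfolding F_def by auto
      then have "c \<otimes> inv (inv h \<otimes> b \<otimes> h) \<in> A" using eqQ[of c "inv h \<otimes> b \<otimes> h"] bG c by simp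
      then have m: "c \<otimes> inv (inv h \<otimes> b \<otimes> h) \<in> B" using AB by auto
      have 2: "inv h \<otimes> b \<otimes> h \<in> B" using B.inv_op_closed1[of h b] h(1) b by auto
      have "c = (c \<otimes> inv (inv h \<otimes> b \<otimes> h)) \<otimes> (inv h \<otimes> b \<otimes> h)"
        using h(1) bG c by (simp add: m_assoc)
      then have cB: "c \<in> B" using m 2 B.m_closed by metis
      have "c \<notin> A"
      proof
        assume "c \<in> A"
        then have "\<pi> (inv h \<otimes> b \<otimes> h) = \<one>\<^bsub>Q\<^esub>"
          using ker[OF c(2)] h(2) by simp
        then have "inv h \<otimes> b \<otimes> h \<in> A" using ker[of "inv h \<otimes> b \<otimes> h"] h(1) bG by simp
        then have "h \<otimes> (inv h \<otimes> b \<otimes> h) \<otimes> inv h \<in> A" using A.inv_op_closed2 h(1) by blast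
        then have "b \<in> A" using h(1) bG by (simp add: m_assoc)
        then show False using b by auto
      qed
      with cB show ?thesis by simp
    qed
    \<comment> \<open>A class of \<open>r\<close> is the union of the cosets in \<open>F b\<close>,
      so its size is |A| times that of \<open>F b\<close>.\<close>
    have XU: "Y = \<Union>(F b)"
    proof (intro equalityI subsetI)
      fix c assume "c \<in> Y"
      then have "\<pi> c \<in> F b" "c \<in> B" using b unfolding r_def by auto
      moreover have "c \<in> \<pi> c" using \<open>c \<in> B\<close> BG rcos_self A.is_subgroup unfolding \<pi> by blast
      ultimately show "c \<in> \<Union>(F b)" by blast
    next
      fix c assume "c \<in> \<Union>(F b)"
      then obtain h where h: "h \<in> carrier G" "c \<in> A #> (inv h \<otimes> b \<otimes> h)" unfolding F_def \<pi> by auto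
      then have cG: "c \<in> carrier G" using bG r_coset_subset_G[OF A.subset] by (meson inv_closed m_closed subsetD)
      have "\<pi> c = \<pi> (inv h \<otimes> b \<otimes> h)"
        using repr_independence[OF h(2)] h(1) bG A.is_subgroup unfolding \<pi> by simp
      then have "\<pi> c \<in> F b" unfolding F_def using h(1) by auto
      then show "c \<in> Y" using Fin[OF _ cG] b unfolding r_def by auto
    qed
    have "card A * card (F b) = card (\<Union>(F b))"
    proof (rule card_partition)
      show "finite (F b)" unfolding F_def using finite_carrier by simp
      show "finite (\<Union> (F b))" unfolding XU[symmetric] using b finB unfolding r_def
        by (auto intro: finite_subset[OF _ finB])
      show "\<And>c. c \<in> F b \<Longrightarrow> card c = card A" using sub card_rcosets_equal A.subset by (metis subsetD)
      show "\<And>c1 c2. c1 \<in> F b \<Longrightarrow> c2 \<in> F b \<Longrightarrow> c1 \<noteq> c2 \<Longrightarrow> c1 \<inter> c2 = {}"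
        using rcos_disjoint[OF A.is_subgroup] sub by (meson disjnt_def pairwiseD subsetD)
    qed
    moreover have "p dvd card (F b)"
    proof -
      define S where "S = {s \<in> carrier G. \<pi> s \<otimes>\<^bsub>Q\<^esub> \<pi> b = \<pi> b \<otimes>\<^bsub>Q\<^esub> \<pi> s}"
      have S: "subgroup S G"
      proof (rule subgroupI)
        show "S \<subseteq> carrier G" "S \<noteq> {}" unfolding S_def using bG by (auto intro!: exI[of _ \<one>])
        fix s assume s: "s \<in> S"
        then have "\<pi> s \<otimes>\<^bsub>Q\<^esub> \<pi> b = \<pi> b \<otimes>\<^bsub>Q\<^esub> \<pi> s" "s \<in> carrier G" unfolding S_def by auto
        then have "inv\<^bsub>Q\<^esub> \<pi> s \<otimes>\<^bsub>Q\<^esub> \<pi> b = \<pi> b \<otimes>\<^bsub>Q\<^esub> inv\<^bsub>Q\<^esub> \<pi> s"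
          using bG \<pi>.H.commute_inv by simp
        then show "inv s \<in> S" unfolding S_def using \<open>s \<in> carrier G\<close> by (simp)
        fix t assume t: "t \<in> S"
        then have "\<pi> t \<otimes>\<^bsub>Q\<^esub> \<pi> b = \<pi> b \<otimes>\<^bsub>Q\<^esub> \<pi> t" "t \<in> carrier G" unfolding S_def by auto
        with s show "s \<otimes> t \<in> S" unfolding S_def using bG
          by (simp) (metis \<pi>.H.m_assoc \<pi>.hom_closed)
      qed
      have "card (F b) * card S = Coset.order G" unfolding F_def
      proof (rule orbit_card[OF S])
        fix g h assume gh: "g \<in> carrier G" "h \<in> carrier G"
        let ?a = "\<pi> g" and ?c = "\<pi> h" and ?b = "\<pi> b"
        have cl: "?a \<in> carrier Q" "?b \<in> carrier Q" "?c \<in> carrier Q" using gh bG by auto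
        have "inv\<^bsub>Q\<^esub> ?a \<otimes>\<^bsub>Q\<^esub> ?b \<otimes>\<^bsub>Q\<^esub> ?a = inv\<^bsub>Q\<^esub> ?c \<otimes>\<^bsub>Q\<^esub> ?b \<otimes>\<^bsub>Q\<^esub> ?c \<longleftrightarrow>
          ?a \<otimes>\<^bsub>Q\<^esub> inv\<^bsub>Q\<^esub> ?c \<otimes>\<^bsub>Q\<^esub> ?b = ?b \<otimes>\<^bsub>Q\<^esub> (?a \<otimes>\<^bsub>Q\<^esub> inv\<^bsub>Q\<^esub> ?c)"
          using cl by (rule \<pi>.H.conj_eq_iff)
        then show "(\<pi> (inv g \<otimes> b \<otimes> g) = \<pi> (inv h \<otimes> b \<otimes> h)) = (g \<otimes> inv h \<in> S)"
          unfolding S_def using gh bG by (simp)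
      qed
      then obtain i where i: "card (F b) = p ^ i" using dvd_orderD by (metis dvd_triv_left)
      \<comment> \<open>A class with a single coset would make \<open>b\<close> central modulo
        \<open>A\<close>, against \<open>nc\<close>.\<close>
      have "i \<noteq> 0"
      proof
        assume "i = 0"
        then have "card (F b) = 1" using i by simp
        then obtain C where C: "F b = {C}" by (auto simp: card_1_singleton_iff)
        have all: "\<pi> (inv h \<otimes> b \<otimes> h) = C" if "h \<in> carrier G" for h using C that unfolding F_def by auto
        have "C = \<pi> b" using all[of \<one>] bG by simp
        moreover obtain h where h: "h \<in> carrier G" "gcomm G b h \<notin> A" using nc b by blast
        ultimately have "\<pi> (inv h \<otimes> b \<otimes> h) = \<pi> b" using all by simp
        then have "\<pi> (gcomm G b h) = \<one>\<^bsub>Q\<^esub>" using h(1) bG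
          by (simp add: gcomm_def \<pi>.H.m_assoc)
        then show False using h ker[of "gcomm G b h"] bG by simp
      qed
      then show ?thesis using i by (simp add: dvd_power)
    qed
    ultimately show ?thesis using XU by (metis dvd_refl mult.commute mult_dvd_mono)
  qed
  have "p * card A dvd card (B - A)"
    by (rule equiv_imp_dvd_card[OF _ eq dvd_class]) (use finB in auto)
  moreover have "card (B - A) = card B - card A" using AB finA by (simp add: card_Diff_subset less_imp_le)
  moreover have "p * card A dvd card B" using card_subgroup_psubset A.is_subgroup B.is_subgroup AB by blast
  moreover have "card A \<le> card B" using AB finB card_mono by blast
  ultimately have "p * card A dvd card A" using dvd_diffD1[of "p * card A" "card B" "card A"] by simp
  moreover have "card A > 0" using finA A.one_closed by (metis card_gt_0_iff empty_iff)
  ultimately show False using prime_gt_1_nat[OF prime_p] by auto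
qed

end

section \<open>Maximal subgroups and the Frattini subgroup\<close>

text \<open>For normal \<open>A\<close> this is the subgroup generated by \<open>A\<close> and
  \<open>b\<close>; the explicit form gives access to the exponent of \<open>b\<close>.\<close>

definition adjoin :: "('a, 'b) monoid_scheme \<Rightarrow> 'a set \<Rightarrow> 'a \<Rightarrow> 'a set" where
  "adjoin G A b = {a \<otimes>\<^bsub>G\<^esub> b [^]\<^bsub>G\<^esub> (i::int) | a i. a \<in> A}"

section \<open>Adjoining one element to a normal subgroup\<close>

context group begin

lemma adjoin_subgroup:
  assumes A: "A \<lhd> G" and b: "b \<in> carrier G"
  shows "subgroup (adjoin G A b) G"
proof -
  interpret A: normal A G by fact
  show ?thesis
  proof (rule subgroupI)
    show "adjoin G A b \<subseteq> carrier G" using b unfolding adjoin_def by auto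
    show "adjoin G A b \<noteq> {}" unfolding adjoin_def using A.one_closed by blast
    fix x assume "x \<in> adjoin G A b"
    then obtain a i where x: "x = a \<otimes> b [^] (i::int)" "a \<in> A" unfolding adjoin_def by auto
    have aG: "a \<in> carrier G" using x(2) by simp
    have "b [^] (-i) \<otimes> inv a \<otimes> inv (b [^] (-i)) \<in> A"
      using x(2) b by (intro A.inv_op_closed2) auto
    moreover have "inv x = (b [^] (-i) \<otimes> inv a \<otimes> inv (b [^] (-i))) \<otimes> b [^] (-i)"
      unfolding x(1) using b aG by (simp add: inv_mult_group m_assoc int_pow_neg)
    ultimately show "inv x \<in> adjoin G A b" unfolding adjoin_def by blast
    fix y assume "y \<in> adjoin G A b"
    then obtain c j where y: "y = c \<otimes> b [^] (j::int)" "c \<in> A" unfolding adjoin_def by auto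
    have cG: "c \<in> carrier G" using y(2) by simp
    have "x \<otimes> y = (a \<otimes> (b [^] i \<otimes> c \<otimes> inv (b [^] i))) \<otimes> b [^] (i + j)"
      unfolding x(1) y(1) using b aG cG by (simp add: m_assoc int_pow_mult)
    moreover have "a \<otimes> (b [^] i \<otimes> c \<otimes> inv (b [^] i)) \<in> A"
      using x(2) y(2) b by (intro A.m_closed A.inv_op_closed2) auto
    ultimately show "x \<otimes> y \<in> adjoin G A b" unfolding adjoin_def by blast
  qed
qed

lemma adjoin_incl:
  assumes "A \<subseteq> carrier G" "b \<in> carrier G"
  shows "A \<subseteq> adjoin G A b" "\<one> \<in> A \<Longrightarrow> b \<in> adjoin G A b"
proof -
  show "A \<subseteq> adjoin G A b"
  proof
    fix a assume "a \<in> A"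
    then have "a = a \<otimes> b [^] (0::int)" using assms by auto
    then show "a \<in> adjoin G A b" unfolding adjoin_def using \<open>a \<in> A\<close> by blast
  qed
  assume "\<one> \<in> A"
  moreover have "b = \<one> \<otimes> b [^] (1::int)" using assms by (simp add: int_pow_1)
  ultimately show "b \<in> adjoin G A b" unfolding adjoin_def by blast
qed

lemma adjoin_least:
  assumes "subgroup K G" "A \<subseteq> K" "b \<in> K"
  shows "adjoin G A b \<subseteq> K"
  using assms subgroup_int_pow_closed[OF assms(1,3)] subgroup.m_closed[OF assms(1)]
  unfolding adjoin_def by blast

lemma int_pow_conjugate:
  assumes "x \<in> carrier G" "y \<in> carrier G"
  shows "x \<otimes> y [^] (i::int) \<otimes> inv x = (x \<otimes> y \<otimes> inv x) [^] i"
proof -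
  have "group_hom G G (\<lambda>y. x \<otimes> y \<otimes> inv x)"
    using assms(1) is_group by (auto simp: group_hom_def group_hom_axioms_def hom_def m_assoc)
  from group_hom.hom_int_pow[OF this assms(2), of i] show ?thesis .
qed

text \<open>Modulo \<open>A\<close> the element \<open>b\<close> is central, so conjugation fixes
  its powers modulo \<open>A\<close>.\<close>

lemma adjoin_normal:
  assumes A: "A \<lhd> G" and b: "b \<in> carrier G" and cen: "\<And>h. h \<in> carrier G \<Longrightarrow> gcomm G b h \<in> A"
  shows "adjoin G A b \<lhd> G"
proof (rule normal_invI[OF adjoin_subgroup[OF A b]])
  interpret A: normal A G by fact
  obtain Q :: "'a set monoid" and \<pi> where hom: "group_hom G Q \<pi>"
    and ker: "\<And>g. g \<in> carrier G \<Longrightarrow> \<pi> g = \<one>\<^bsub>Q\<^esub> \<longleftrightarrow> g \<in> A"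
    and eqQ: "\<And>g h. g \<in> carrier G \<Longrightarrow> h \<in> carrier G \<Longrightarrow> \<pi> g = \<pi> h \<longleftrightarrow> g \<otimes> inv h \<in> A"
    by (rule normal_quotientE[OF A], rule that)
  interpret \<pi>: group_hom G Q \<pi> using hom .
  fix x h assume xh: "x \<in> carrier G" "h \<in> adjoin G A b"
  then obtain a i where h: "h = a \<otimes> b [^] (i::int)" "a \<in> A" unfolding adjoin_def by auto
  have comm: "\<pi> b \<otimes>\<^bsub>Q\<^esub> \<pi> x = \<pi> x \<otimes>\<^bsub>Q\<^esub> \<pi> b"
    using cen[OF xh(1)] ker[of "gcomm G b x"] b xh(1) \<pi>.hom_gcomm \<pi>.H.gcomm_eq_one_iff by simp
  have "\<pi> (x \<otimes> h \<otimes> inv x) = \<pi> x \<otimes>\<^bsub>Q\<^esub> (\<pi> b [^]\<^bsub>Q\<^esub> i) \<otimes>\<^bsub>Q\<^esub> inv\<^bsub>Q\<^esub> \<pi> x"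
    unfolding h(1) using h(2) ker[of a] xh(1) b by (simp add: \<pi>.hom_int_pow)
  also have "\<dots> = (\<pi> x \<otimes>\<^bsub>Q\<^esub> \<pi> b \<otimes>\<^bsub>Q\<^esub> inv\<^bsub>Q\<^esub> \<pi> x) [^]\<^bsub>Q\<^esub> i"
    using \<pi>.H.int_pow_conjugate xh(1) b by auto
  also have "\<pi> x \<otimes>\<^bsub>Q\<^esub> \<pi> b \<otimes>\<^bsub>Q\<^esub> inv\<^bsub>Q\<^esub> \<pi> x = \<pi> b"
    unfolding comm[symmetric] using xh(1) b by (simp add: \<pi>.H.m_assoc)
  also have "\<pi> b [^]\<^bsub>Q\<^esub> i = \<pi> (b [^] i)" using b by (simp add: \<pi>.hom_int_pow)
  finally have "x \<otimes> h \<otimes> inv x \<otimes> inv (b [^] i) \<in> A"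
    using eqQ[of "x \<otimes> h \<otimes> inv x" "b [^] i"] xh h b by simp
  moreover have "x \<otimes> h \<otimes> inv x = (x \<otimes> h \<otimes> inv x \<otimes> inv (b [^] i)) \<otimes> b [^] i"
    using xh h b by (simp add: m_assoc)
  ultimately show "x \<otimes> h \<otimes> inv x \<in> adjoin G A b" unfolding adjoin_def by blast
qed

text \<open>Iterating the equation shows that y equals its power with exponent (p i)^n, and p^n
  already kills y.\<close>

lemma eq_one_of_eq_pow:
  assumes y: "y \<in> carrier G" "y [^] ((p::nat) ^ n) = \<one>" and eq: "y = y [^] (int p * i)"
  shows "y = \<one>"
proof -
  have "y = y [^] ((int p * i) ^ m)" for m
  proof (induction m)
    case (Suc m)
    have "y [^] ((int p * i) ^ Suc m) = (y [^] ((int p * i) ^ m)) [^] (int p * i)"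
      using y(1) by (simp add: int_pow_pow mult.commute)
    then show ?case using Suc eq by simp
  qed (use y in \<open>simp add: int_pow_1\<close>)
  from this[of n] have "y = y [^] (int (p ^ n) * i ^ n)" by (simp add: power_mult_distrib)
  also have "\<dots> = (y [^] int (p ^ n)) [^] (i ^ n)" using y(1) int_pow_pow by simp
  also have "y [^] int (p ^ n) = \<one>" using y(2) by (metis int_pow_int)
  finally show ?thesis by simp
qed

text \<open>By Bezout, y itself is a product of powers of y^p and y^i.\<close>

lemma mem_of_coprime_pow:
  assumes D: "subgroup D G" and y: "y \<in> carrier G" "y [^] (p::nat) \<in> D" "y [^] (i::int) \<in> D"
    and p: "Factorial_Ring.prime p" and i: "\<not> int p dvd i"
  shows "y \<in> D"
proof -
  have "coprime (int p) i" using p i by (simp add: prime_imp_coprime)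
  then obtain u v where uv: "u * int p + v * i = 1" using bezout_int[of "int p" i] by auto
  have "y = y [^] (u * int p + v * i)" using uv y(1) by (simp add: int_pow_1)
  also have "\<dots> = (y [^] int p) [^] u \<otimes> (y [^] i) [^] v"
    using y(1) by (simp add: int_pow_mult int_pow_pow mult.commute)
  also have "\<dots> \<in> D" using y subgroup_int_pow_closed[OF D] subgroup.m_closed[OF D]
    by (simp add: int_pow_int)
  finally show ?thesis .
qed

text \<open>Asking for both conjugates makes closure under inverses immediate.\<close>

lemma normalizer_subgroup:
  assumes M: "M \<subseteq> carrier G"
  shows "subgroup {g \<in> carrier G. \<forall>m\<in>M. g \<otimes> m \<otimes> inv g \<in> M \<and> inv g \<otimes> m \<otimes> g \<in> M} G" (is "subgroup ?T G")
proof (rule subgroupI)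
  have MG: "m \<in> M \<Longrightarrow> m \<in> carrier G" for m using M by blast
  show "?T \<subseteq> carrier G" by auto
  show "?T \<noteq> {}" using MG by (auto intro!: exI[of _ \<one>])
  show "inv s \<in> ?T" if "s \<in> ?T" for s using that by auto
  fix s t assume st: "s \<in> ?T" "t \<in> ?T"
  then have c: "s \<in> carrier G" "t \<in> carrier G" by auto
  {
    fix m assume m: "m \<in> M"
    have "s \<otimes> (t \<otimes> m \<otimes> inv t) \<otimes> inv s \<in> M" "inv t \<otimes> (inv s \<otimes> m \<otimes> s) \<otimes> t \<in> M"
      using st m by auto
    then have "(s \<otimes> t) \<otimes> m \<otimes> inv (s \<otimes> t) \<in> M" "inv (s \<otimes> t) \<otimes> m \<otimes> (s \<otimes> t) \<in> M"
      using c MG[OF m] by (simp_all add: m_assoc inv_mult_group)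
  }
  then show "s \<otimes> t \<in> ?T" using c by auto
qed

lemma subgroup_commutators_normal:
  assumes D: "subgroup D G" and c: "\<And>a b. a \<in> D \<Longrightarrow> b \<in> carrier G \<Longrightarrow> gcomm G a b \<in> D"
  shows "D \<lhd> G"
proof (rule normal_invI[OF D])
  fix x h assume xh: "x \<in> carrier G" "h \<in> D"
  have hG: "h \<in> carrier G" using xh D subgroup.subset by blast
  have "x \<otimes> h \<otimes> inv x = h \<otimes> gcomm G h (inv x)" using xh(1) hG by (simp add: gcomm_def m_assoc)
  also have "\<dots> \<in> D" using xh c D by (simp add: subgroup.m_closed)
  finally show "x \<otimes> h \<otimes> inv x \<in> D" .
qed

end

section \<open>Maximal subgroups of a finite p-group\<close>

context p_group begin

text \<open>The set obtained is maximal under inclusion among those with \<open>P\<close>, not an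
  upper bound of all of them.\<close>

lemma ex_greatest_subset:
  fixes P :: "'a set \<Rightarrow> bool"
  assumes "P A" "\<And>A. P A \<Longrightarrow> A \<subseteq> carrier G"
  shows "\<exists>M. P M \<and> (\<forall>K. P K \<and> M \<subseteq> K \<longrightarrow> K = M)"
proof -
  have "finite {A. P A}" using finite_carrier assms(2) by (auto intro: finite_subset[of _ "Pow (carrier G)"])
  then obtain M where "M \<in> {A. P A}" "\<And>K. K \<in> {A. P A} \<Longrightarrow> M \<le> K \<Longrightarrow> M = K"
    using finite_has_maximal2[of "{A. P A}" A] assms(1) by auto
  then show ?thesis by blast
qed

lemma ex_maximal_above:
  assumes "subgroup D G" "D \<noteq> carrier G"
  shows "\<exists>M. maximal_subgroup M G \<and> D \<subseteq> M"
proof -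
  have "\<exists>M. (subgroup M G \<and> D \<subseteq> M \<and> M \<noteq> carrier G) \<and>
    (\<forall>K. (subgroup K G \<and> D \<subseteq> K \<and> K \<noteq> carrier G) \<and> M \<subseteq> K \<longrightarrow> K = M)"
    by (rule ex_greatest_subset[of _ D]) (use assms subgroup.subset in auto)
  then obtain M where M: "subgroup M G" "D \<subseteq> M" "M \<noteq> carrier G"
    and max: "\<forall>K. (subgroup K G \<and> D \<subseteq> K \<and> K \<noteq> carrier G) \<and> M \<subseteq> K \<longrightarrow> K = M" by metis
  have "K = M \<or> K = carrier G" if "subgroup K G" "M \<subseteq> K" for K
    using max[rule_format, of K] that M(2) by (metis order_trans)
  then show ?thesis unfolding maximal_subgroup_def using M by metis
qed

text \<open>Modulo \<open>A\<close> the element b would be a power of b^p and hence trivial. The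
  lemma is applied when everything above \<open>A\<close> is generated by one further element: it
  forces b^p into \<open>A\<close>.\<close>

lemma pow_p_mem_of_central:
  assumes A: "A \<lhd> G" and b: "b \<in> carrier G" "b \<notin> A"
    and eq: "b \<in> adjoin G A (b [^] p)"
  shows False
proof -
  interpret A: normal A G by fact
  obtain Q :: "'a set monoid" and \<pi> where hom: "group_hom G Q \<pi>"
    and ker: "\<And>g. g \<in> carrier G \<Longrightarrow> \<pi> g = \<one>\<^bsub>Q\<^esub> \<longleftrightarrow> g \<in> A"
    by (rule normal_quotientE[OF A], rule that)
  interpret \<pi>: group_hom G Q \<pi> using hom .
  obtain a i where ai: "b = a \<otimes> (b [^] p) [^] (i::int)" "a \<in> A" using eq unfolding adjoin_def by auto
  have aG: "a \<in> carrier G" using ai by simp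
  have e: "b = a \<otimes> b [^] (int p * i)" using ai(1) b(1) int_pow_int[of G b p] int_pow_pow by metis
  have "\<pi> b = \<pi> a \<otimes>\<^bsub>Q\<^esub> \<pi> (b [^] (int p * i))" using aG b(1) \<pi>.hom_mult[of a "b [^] (int p * i)"] e
    by (metis int_pow_closed)
  then have 1: "\<pi> b = \<pi> b [^]\<^bsub>Q\<^esub> (int p * i)"
    using ker[OF aG] ai(2) b(1) by (simp add: \<pi>.hom_int_pow)
  obtain n where "b [^] (p ^ n) = \<one>" using exponent b(1) by blast
  then have 2: "\<pi> b [^]\<^bsub>Q\<^esub> (p ^ n) = \<one>\<^bsub>Q\<^esub>" using b(1) \<pi>.hom_nat_pow by (metis \<pi>.hom_one)
  have "\<pi> b = \<one>\<^bsub>Q\<^esub>" using \<pi>.H.eq_one_of_eq_pow[OF _ 2 1] b(1) by simp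
  then show False using ker b by simp
qed

text \<open>Let A be maximal among the normal subgroups of G inside M, and b outside A central
  modulo A. If b were in M, adjoining it to A would give a larger normal subgroup inside M. So b is
  outside M; it normalizes M because it commutes with M modulo A, and maximality makes M normal and
  G generated by M and b.\<close>

lemma maximal_subgroupE:
  assumes "maximal_subgroup M G"
  obtains b where "M \<lhd> G" "b \<in> carrier G - M" "b [^] p \<in> M" "adjoin G M b = carrier G"
proof -
  have M: "subgroup M G" "M \<noteq> carrier G" and max: "\<And>K. subgroup K G \<Longrightarrow> M \<subseteq> K \<Longrightarrow> K = M \<or> K = carrier G"
    using assms unfolding maximal_subgroup_def by auto
  obtain A where A: "A \<lhd> G" "A \<subseteq> M" and Amax: "\<And>K. K \<lhd> G \<Longrightarrow> K \<subseteq> M \<Longrightarrow> A \<subseteq> K \<Longrightarrow> K = A"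
  proof -
    have "\<exists>A. (A \<lhd> G \<and> A \<subseteq> M) \<and> (\<forall>K. (K \<lhd> G \<and> K \<subseteq> M) \<and> A \<subseteq> K \<longrightarrow> K = A)"
      by (rule ex_greatest_subset[of _ "{\<one>}"])
        (use one_is_normal subgroup.one_closed[OF M(1)] subgroup.subset[OF M(1)] in auto)
    then show thesis by (elim exE conjE) (rule that, assumption+, metis)
  qed
  have "A \<subset> carrier G" using A M subgroup.subset[OF M(1)] by blast
  then obtain b where b: "b \<in> carrier G - A" "\<And>h. h \<in> carrier G \<Longrightarrow> gcomm G b h \<in> A"
    using ex_central_modulo[OF A(1) normal_self] by blast
  have AG: "A \<subseteq> carrier G" "\<one> \<in> A" using A(1) normal_imp_subgroup subgroup.subset subgroup.one_closed by blast+
  have bM: "b \<notin> M"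
  proof
    assume "b \<in> M"
    then have "adjoin G A b \<subseteq> M" using adjoin_least M(1) A(2) by blast
    moreover have "adjoin G A b \<lhd> G" using adjoin_normal A(1) b by blast
    ultimately have "adjoin G A b = A" using Amax adjoin_incl(1)[OF AG(1)] b(1) by blast
    then show False using adjoin_incl(2)[OF AG(1) _ AG(2)] b(1) by blast
  qed
  have MG: "m \<in> M \<Longrightarrow> m \<in> carrier G" for m using M(1) subgroup.subset by blast
  define T where "T = {g \<in> carrier G. \<forall>m\<in>M. g \<otimes> m \<otimes> inv g \<in> M \<and> inv g \<otimes> m \<otimes> g \<in> M}"
  have "subgroup T G" unfolding T_def using normalizer_subgroup MG by blast
  moreover have "M \<subseteq> T" unfolding T_def using M(1) MG by (auto simp: subgroup.m_closed subgroup.m_inv_closed)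
  moreover have "b \<in> T"
  proof -
    {
      fix m assume m: "m \<in> M"
      have "gcomm G b (inv m) \<otimes> m \<in> M" "m \<otimes> gcomm G b (b \<otimes> m \<otimes> inv b) \<in> M"
        using b m MG A(2) M(1) by (auto simp: subgroup.m_closed subset_iff)
      then have "inv b \<otimes> m \<otimes> b \<in> M" "b \<otimes> m \<otimes> inv b \<in> M"
        using b(1) MG[OF m] by (simp_all add: gcomm_def m_assoc inv_mult_group)
    }
    then show ?thesis using b(1) unfolding T_def by auto
  qed
  ultimately have "T = carrier G" using max bM by blast
  then have MN: "M \<lhd> G" unfolding T_def by (intro normal_invI[OF M(1)]) blast
  have M1: "\<one> \<in> M" using M(1) subgroup.one_closed by blast
  have "adjoin G M b = carrier G"
    using max[OF adjoin_subgroup[OF MN]] adjoin_incl[OF subgroup.subset[OF M(1)]] bM M1 b(1) by blast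
  moreover have "b [^] p \<in> M"
  proof (rule ccontr)
    assume n: "b [^] p \<notin> M"
    have bp: "b [^] p \<in> carrier G" using b by simp
    have "adjoin G M (b [^] p) = carrier G"
      using max[OF adjoin_subgroup[OF MN bp]] adjoin_incl[OF subgroup.subset[OF M(1)] bp] n M1 by blast
    then show False using pow_p_mem_of_central[OF MN _ bM] b(1) by blast
  qed
  ultimately show ?thesis using that MN b(1) bM by blast
qed

text \<open>G/M is cyclic, generated by the image of an element b with b^p in M; hence it is abelian
  of exponent p.\<close>

lemma maximal_subgroup_facts:
  assumes M: "maximal_subgroup M G"
  shows "M \<lhd> G" "\<And>x. x \<in> carrier G \<Longrightarrow> x [^] p \<in> M"
    "\<And>x y. x \<in> carrier G \<Longrightarrow> y \<in> carrier G \<Longrightarrow> gcomm G x y \<in> M"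
proof -
  obtain b where b: "M \<lhd> G" "b \<in> carrier G - M" "b [^] p \<in> M" "adjoin G M b = carrier G"
    using maximal_subgroupE[OF M] by blast
  show "M \<lhd> G" by fact
  interpret M: normal M G by fact
  obtain Q :: "'a set monoid" and \<pi> where hom: "group_hom G Q \<pi>"
    and ker: "\<And>g. g \<in> carrier G \<Longrightarrow> \<pi> g = \<one>\<^bsub>Q\<^esub> \<longleftrightarrow> g \<in> M"
    by (rule normal_quotientE[OF b(1)], rule that)
  interpret \<pi>: group_hom G Q \<pi> using hom .
  have bG: "b \<in> carrier G" using b by simp
  have rep: "\<exists>i::int. \<pi> x = \<pi> b [^]\<^bsub>Q\<^esub> i" if x: "x \<in> carrier G" for x
  proof -
    obtain m i where mi: "x = m \<otimes> b [^] (i::int)" "m \<in> M" using b(4) x unfolding adjoin_def by blast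
    then have "\<pi> x = \<pi> b [^]\<^bsub>Q\<^esub> i" using ker[of m] bG by (simp add: \<pi>.hom_int_pow)
    then show ?thesis by blast
  qed
  have pib: "\<pi> b \<in> carrier Q" using bG by simp
  fix x assume x: "x \<in> carrier G"
  obtain i where i: "\<pi> x = \<pi> b [^]\<^bsub>Q\<^esub> (i::int)" using rep[OF x] by blast
  have "\<pi> (x [^] p) = (\<pi> b [^]\<^bsub>Q\<^esub> i) [^]\<^bsub>Q\<^esub> int p" using x i by (simp add: \<pi>.hom_nat_pow int_pow_int)
  also have "\<dots> = (\<pi> b [^]\<^bsub>Q\<^esub> int p) [^]\<^bsub>Q\<^esub> i" using pib by (simp add: \<pi>.H.int_pow_pow mult.commute)
  also have "\<pi> b [^]\<^bsub>Q\<^esub> int p = \<one>\<^bsub>Q\<^esub>" using ker[of "b [^] p"] b(3) bG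
    by (simp add: int_pow_int \<pi>.hom_nat_pow)
  finally have "\<pi> (x [^] p) = \<one>\<^bsub>Q\<^esub>" by simp
  then show "x [^] p \<in> M" using ker[of "x [^] p"] x by simp
  fix y assume y: "y \<in> carrier G"
  obtain j where j: "\<pi> y = \<pi> b [^]\<^bsub>Q\<^esub> (j::int)" using rep[OF y] by blast
  have "\<pi> x \<otimes>\<^bsub>Q\<^esub> \<pi> y = \<pi> y \<otimes>\<^bsub>Q\<^esub> \<pi> x" unfolding i j using pib
    by (simp add: \<pi>.H.int_pow_mult[symmetric] add.commute)
  then have "\<pi> (gcomm G x y) = \<one>\<^bsub>Q\<^esub>" using x y \<pi>.hom_gcomm \<pi>.H.gcomm_eq_one_iff by simp
  then show "gcomm G x y \<in> M" using ker[of "gcomm G x y"] x y by simp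
qed

text \<open>G/M is cyclic of order p, and the exponent of its generator is read in the prime field
  of F. The integer picked by \<open>e\<close> is determined only modulo p, which
  \<open>of_int\<close> forgets.\<close>

lemma ex_additive_hom:
  assumes M: "maximal_subgroup M G" and char: "CHAR('f::field) = p"
  shows "\<exists>f :: 'a \<Rightarrow> 'f. (\<forall>x\<in>carrier G. \<forall>y\<in>carrier G. f (x \<otimes> y) = f x + f y) \<and>
    (\<forall>x\<in>carrier G. f x = 0 \<longleftrightarrow> x \<in> M)"
proof -
  obtain b where b: "M \<lhd> G" "b \<in> carrier G - M" "b [^] p \<in> M" "adjoin G M b = carrier G"
    using maximal_subgroupE[OF M] by blast
  interpret M: normal M G by fact
  have bG: "b \<in> carrier G" using b by simp
  obtain Q :: "'a set monoid" and \<pi> where hom: "group_hom G Q \<pi>"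
    and ker: "\<And>g. g \<in> carrier G \<Longrightarrow> \<pi> g = \<one>\<^bsub>Q\<^esub> \<longleftrightarrow> g \<in> M"
    by (rule normal_quotientE[OF b(1)], rule that)
  interpret \<pi>: group_hom G Q \<pi> using hom .
  have pib: "\<pi> b \<in> carrier Q" using bG by simp
  have pow1: "\<pi> b [^]\<^bsub>Q\<^esub> i = \<one>\<^bsub>Q\<^esub> \<longleftrightarrow> int p dvd i" for i :: int
  proof
    assume "\<pi> b [^]\<^bsub>Q\<^esub> i = \<one>\<^bsub>Q\<^esub>"
    then have "b [^] i \<in> M" using ker[of "b [^] i"] bG by (simp add: \<pi>.hom_int_pow)
    then show "int p dvd i" using mem_of_coprime_pow[OF M.is_subgroup bG b(3) _ prime_p] b(2) by blast
  next
    assume "int p dvd i"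
    then obtain k where k: "i = int p * k" by blast
    have "\<pi> b [^]\<^bsub>Q\<^esub> int p = \<one>\<^bsub>Q\<^esub>" using ker[of "b [^] p"] b(3) bG by (simp add: int_pow_int \<pi>.hom_nat_pow)
    then show "\<pi> b [^]\<^bsub>Q\<^esub> i = \<one>\<^bsub>Q\<^esub>" unfolding k using pib by (metis \<pi>.H.int_pow_one \<pi>.H.int_pow_pow)
  qed
  define e where "e x = (SOME i::int. \<pi> x = \<pi> b [^]\<^bsub>Q\<^esub> i)" for x
  have e: "\<pi> x = \<pi> b [^]\<^bsub>Q\<^esub> e x" if x: "x \<in> carrier G" for x
  proof -
    obtain m i where mi: "x = m \<otimes> b [^] (i::int)" "m \<in> M" using b(4) x unfolding adjoin_def by blast
    then have "\<pi> x = \<pi> b [^]\<^bsub>Q\<^esub> i" using ker[of m] bG by (simp add: \<pi>.hom_int_pow)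
    then show ?thesis unfolding e_def by (rule someI)
  qed
  have of_int_eq: "(of_int i :: 'f) = 0 \<longleftrightarrow> int p dvd i" for i
    using of_int_eq_0_iff_char_dvd[of i, where 'a='f] char by simp
  have "(of_int (e (x \<otimes> y)) :: 'f) = of_int (e x) + of_int (e y)"
    if xy: "x \<in> carrier G" "y \<in> carrier G" for x y
  proof -
    have "\<pi> b [^]\<^bsub>Q\<^esub> (e x + e y) = \<pi> b [^]\<^bsub>Q\<^esub> e (x \<otimes> y)"
      using e[OF xy(1)] e[OF xy(2)] e[of "x \<otimes> y"] xy pib by (simp add: \<pi>.H.int_pow_mult)
    then have "\<pi> b [^]\<^bsub>Q\<^esub> (e (x \<otimes> y) - (e x + e y)) = \<one>\<^bsub>Q\<^esub>"
      using pib by (simp add: \<pi>.H.int_pow_diff del: add_diff_eq)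
    then have "(of_int (e (x \<otimes> y) - (e x + e y)) :: 'f) = 0" using pow1 of_int_eq by blast
    then show ?thesis by (metis of_int_add of_int_diff eq_iff_diff_eq_0)
  qed
  moreover have "(of_int (e x) :: 'f) = 0 \<longleftrightarrow> x \<in> M" if x: "x \<in> carrier G" for x
    using of_int_eq pow1 e[OF x] ker[OF x] by simp
  ultimately show ?thesis by (intro exI[of _ "\<lambda>x. of_int (e x)"]) blast
qed

text \<open>G/D is elementary abelian, so some hyperplane misses x. Let M be maximal among the
  subgroups above D without x, and K a larger subgroup; then x is in K. For any y, adjoining y to M
  either gives M again or reaches x = m y^i; in the second case p does not divide i, while y^p lies
  in M, so y is in K.\<close>

lemma ex_maximal_avoiding:
  assumes D: "subgroup D G" and pow: "\<And>x. x \<in> carrier G \<Longrightarrow> x [^] p \<in> D"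
    and comm: "\<And>x y. x \<in> carrier G \<Longrightarrow> y \<in> carrier G \<Longrightarrow> gcomm G x y \<in> D"
    and x: "x \<in> carrier G - D"
  shows "\<exists>M. maximal_subgroup M G \<and> x \<notin> M"
proof -
  obtain M where M: "subgroup M G" "D \<subseteq> M" "x \<notin> M"
    and max: "\<And>K. subgroup K G \<Longrightarrow> D \<subseteq> K \<Longrightarrow> x \<notin> K \<Longrightarrow> M \<subseteq> K \<Longrightarrow> K = M"
  proof -
    have "\<exists>M. (subgroup M G \<and> D \<subseteq> M \<and> x \<notin> M) \<and>
      (\<forall>K. (subgroup K G \<and> D \<subseteq> K \<and> x \<notin> K) \<and> M \<subseteq> K \<longrightarrow> K = M)"
      by (rule ex_greatest_subset[of _ D]) (use D x subgroup.subset in auto)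
    then show thesis by (elim exE conjE) (rule that, assumption+, metis)
  qed
  have MG: "m \<in> M \<Longrightarrow> m \<in> carrier G" for m using M(1) subgroup.subset by blast
  have MN: "M \<lhd> G" using comm M MG by (intro subgroup_commutators_normal) blast+
  have "K = carrier G" if K: "subgroup K G" "M \<subseteq> K" "K \<noteq> M" for K
  proof
    show "K \<subseteq> carrier G" using K(1) subgroup.subset by blast
    have xK: "x \<in> K" using K max M by blast
    show "carrier G \<subseteq> K"
    proof
      fix y assume y: "y \<in> carrier G"
      have inc: "M \<subseteq> adjoin G M y" "y \<in> adjoin G M y"
        using adjoin_incl[OF subgroup.subset[OF M(1)] y] subgroup.one_closed[OF M(1)] by auto
      show "y \<in> K"
      proof (cases "x \<in> adjoin G M y")
        case False
        then have "adjoin G M y = M" using max[OF adjoin_subgroup[OF MN y]] inc M(2) by blast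
        then show ?thesis using inc K(2) by blast
      next
        case True
        then obtain m i where mi: "x = m \<otimes> y [^] (i::int)" "m \<in> M" unfolding adjoin_def by blast
        have "y [^] i = inv m \<otimes> x" using mi MG y by (simp)
        then have yi: "y [^] i \<in> K" using mi(2) xK K by (auto simp: subgroup.m_closed subgroup.m_inv_closed)
        have yp: "y [^] p \<in> M" using pow y M(2) by blast
        have "\<not> int p dvd i"
        proof
          assume "int p dvd i"
          then obtain k where "i = int p * k" by blast
          then have "y [^] i = (y [^] p) [^] k" using y by (simp add: int_pow_pow[symmetric] int_pow_int)
          then have "y [^] i \<in> M" using yp subgroup_int_pow_closed[OF M(1)] by simp
          then have "x \<in> M" unfolding mi(1) by (rule subgroup.m_closed[OF M(1) mi(2)])
          then show False using M(3) by blast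
        qed
        then show ?thesis using mem_of_coprime_pow[OF K(1) y _ yi prime_p] yp K(2) by blast
      qed
    qed
  qed
  then show ?thesis using M x unfolding maximal_subgroup_def by blast
qed

lemma frattini_subgroup: "subgroup (frattini G) G"
proof (rule subgroupI)
  have s: "maximal_subgroup M G \<Longrightarrow> subgroup M G" for M unfolding maximal_subgroup_def by blast
  show "frattini G \<subseteq> carrier G" unfolding frattini_def by blast
  have "\<one> \<in> frattini G" unfolding frattini_def using s subgroup.one_closed by fastforce
  then show "frattini G \<noteq> {}" by blast
  show "\<And>a. a \<in> frattini G \<Longrightarrow> inv a \<in> frattini G" unfolding frattini_def
    using subgroup.m_inv_closed[OF s] by blast
  show "\<And>a b. a \<in> frattini G \<Longrightarrow> b \<in> frattini G \<Longrightarrow> a \<otimes> b \<in> frattini G" unfolding frattini_def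
    using subgroup.m_closed[OF s] by blast
qed

lemma pow_in_frattini: "x \<in> carrier G \<Longrightarrow> x [^] p \<in> frattini G"
  unfolding frattini_def using maximal_subgroup_facts(2) by auto

lemma gcomm_in_frattini:
  "x \<in> carrier G \<Longrightarrow> y \<in> carrier G \<Longrightarrow> gcomm G x y \<in> frattini G"
  unfolding frattini_def using maximal_subgroup_facts(3) by auto

text \<open>Together with \<open>pow_in_frattini\<close> and \<open>gcomm_in_frattini\<close> this
  describes the Frattini subgroup as the least subgroup containing all p-th powers and commutators,
  which is how it is mostly handled below.\<close>

lemma frattini_least:
  assumes "subgroup D G" "\<And>x. x \<in> carrier G \<Longrightarrow> x [^] p \<in> D"
    "\<And>x y. x \<in> carrier G \<Longrightarrow> y \<in> carrier G \<Longrightarrow> gcomm G x y \<in> D"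
  shows "frattini G \<subseteq> D"
  using ex_maximal_avoiding[OF assms] unfolding frattini_def by blast

end

section \<open>The Frattini subgroup of a subgroup, and chief factors\<close>

lemma (in group) gcomm_consistent:
  assumes "subgroup K G" "a \<in> K" "b \<in> K"
  shows "gcomm (G\<lparr>carrier := K\<rparr>) a b = gcomm G a b"
  using assms by (simp add: gcomm_def m_inv_consistent subgroup.m_inv_closed)

context p_group begin

text \<open>Expresses the Frattini subgroup of \<open>K\<close> with the operations of G, so that
  the restricted structure can be forgotten.\<close>

lemma subgroup_frattini:
  assumes K: "subgroup K G"
  shows "subgroup (frattini (G\<lparr>carrier := K\<rparr>)) G" "frattini (G\<lparr>carrier := K\<rparr>) \<subseteq> K"
    "\<And>x. x \<in> K \<Longrightarrow> x [^] p \<in> frattini (G\<lparr>carrier := K\<rparr>)"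
    "\<And>x y. x \<in> K \<Longrightarrow> y \<in> K \<Longrightarrow> gcomm G x y \<in> frattini (G\<lparr>carrier := K\<rparr>)"
    "\<And>D. subgroup D G \<Longrightarrow> D \<subseteq> K \<Longrightarrow> (\<And>x. x \<in> K \<Longrightarrow> x [^] p \<in> D) \<Longrightarrow>
      (\<And>x y. x \<in> K \<Longrightarrow> y \<in> K \<Longrightarrow> gcomm G x y \<in> D) \<Longrightarrow> frattini (G\<lparr>carrier := K\<rparr>) \<subseteq> D"
proof -
  interpret K: p_group "G\<lparr>carrier := K\<rparr>" p using subgroup_p_group[OF K] .
  have pc: "x [^]\<^bsub>G\<lparr>carrier := K\<rparr>\<^esub> (n::nat) = x [^] n" for x n by (simp add: nat_pow_def)
  show 1: "frattini (G\<lparr>carrier := K\<rparr>) \<subseteq> K" unfolding frattini_def by auto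
  show "subgroup (frattini (G\<lparr>carrier := K\<rparr>)) G" using K.frattini_subgroup K incl_subgroup by blast
  show "\<And>x. x \<in> K \<Longrightarrow> x [^] p \<in> frattini (G\<lparr>carrier := K\<rparr>)" using K.pow_in_frattini pc by simp
  show "\<And>x y. x \<in> K \<Longrightarrow> y \<in> K \<Longrightarrow> gcomm G x y \<in> frattini (G\<lparr>carrier := K\<rparr>)"
    using K.gcomm_in_frattini gcomm_consistent[OF K] by simp
  fix D assume D: "subgroup D G" "D \<subseteq> K" "\<And>x. x \<in> K \<Longrightarrow> x [^] p \<in> D"
    "\<And>x y. x \<in> K \<Longrightarrow> y \<in> K \<Longrightarrow> gcomm G x y \<in> D"
  show "frattini (G\<lparr>carrier := K\<rparr>) \<subseteq> D"
    by (rule K.frattini_least) (use D pc gcomm_consistent[OF K] subgroup_incl[OF D(1) K D(2)] in auto)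
qed

text \<open>The elements all of whose conjugates lie in the Frattini subgroup form a subgroup containing
  all \<open>p\<close>-th powers and commutators, hence the whole Frattini subgroup.\<close>

lemma frattini_normal:
  assumes K: "K \<lhd> G"
  shows "frattini (G\<lparr>carrier := K\<rparr>) \<lhd> G"
proof -
  interpret K: normal K G by fact
  let ?W = "frattini (G\<lparr>carrier := K\<rparr>)"
  note W = subgroup_frattini[OF K.is_subgroup]
  define D where "D = {c \<in> K. \<forall>g\<in>carrier G. g \<otimes> c \<otimes> inv g \<in> ?W}"
  have cl: "k \<in> K \<Longrightarrow> g \<in> carrier G \<Longrightarrow> g \<otimes> k \<otimes> inv g \<in> K" for g k by (rule K.inv_op_closed2)
  have KG: "k \<in> K \<Longrightarrow> k \<in> carrier G" for k by simp
  have "subgroup D G"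
  proof (rule subgroupI)
    show "D \<subseteq> carrier G" unfolding D_def by auto
    show "D \<noteq> {}" unfolding D_def using subgroup.one_closed[OF W(1)] by (auto intro!: exI[of _ \<one>])
    fix a assume a: "a \<in> D"
    have "g \<otimes> inv a \<otimes> inv g = inv (g \<otimes> a \<otimes> inv g)" if "g \<in> carrier G" for g
      using that a unfolding D_def by (simp add: inv_mult_group m_assoc)
    then show "inv a \<in> D" using a subgroup.m_inv_closed[OF W(1)] unfolding D_def by auto
    fix b assume b: "b \<in> D"
    have "g \<otimes> (a \<otimes> b) \<otimes> inv g = (g \<otimes> a \<otimes> inv g) \<otimes> (g \<otimes> b \<otimes> inv g)" if "g \<in> carrier G" for g
      using that a b unfolding D_def by (simp add: m_assoc)
    then show "a \<otimes> b \<in> D" using a b subgroup.m_closed[OF W(1)] unfolding D_def by auto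
  qed
  moreover have "x [^] p \<in> D" if x: "x \<in> K" for x
  proof -
    have "g \<otimes> (x [^] p) \<otimes> inv g = (g \<otimes> x \<otimes> inv g) [^] p" if "g \<in> carrier G" for g
      using that x int_pow_conjugate[of g x "int p"] by (simp add: int_pow_int)
    then show ?thesis using x W(3) cl unfolding D_def by auto (metis W(2) W(3) subsetD)
  qed
  moreover have "gcomm G x y \<in> D" if x: "x \<in> K" "y \<in> K" for x y
  proof -
    have "g \<otimes> gcomm G x y \<otimes> inv g = gcomm G (g \<otimes> x \<otimes> inv g) (g \<otimes> y \<otimes> inv g)" if "g \<in> carrier G" for g
      using that x by (simp add: gcomm_def inv_mult_group m_assoc)
    then show ?thesis using x W(4) cl W(2) unfolding D_def by auto
  qed
  ultimately have "?W \<subseteq> D" by (intro W(5)) (auto simp: D_def)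
  then show ?thesis by (intro normal_invI[OF W(1)]) (auto simp: D_def)
qed

text \<open>A subgroup strictly above \<open>A\<close> has order at least p|A|, so nothing lies
  strictly between \<open>A\<close> and \<open>B\<close>.\<close>

lemma adjoin_eq_of_index_p:
  assumes A: "A \<lhd> G" and B: "subgroup B G" and AB: "A \<subseteq> B" "card B = p * card A"
    and b: "b \<in> B" "b \<notin> A"
  shows "adjoin G A b = B"
proof -
  have AG: "A \<subseteq> carrier G" "\<one> \<in> A" using A normal_imp_subgroup subgroup.subset subgroup.one_closed by blast+
  have bG: "b \<in> carrier G" using b B subgroup.subset by blast
  have sub: "adjoin G A b \<subseteq> B" using adjoin_least[OF B AB(1) b(1)] .
  have "A \<subset> adjoin G A b" using adjoin_incl[OF AG(1) bG] AG(2) b(2) by blast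
  then have "p * card A dvd card (adjoin G A b)"
    using card_subgroup_psubset adjoin_subgroup[OF A bG] normal_imp_subgroup[OF A] by blast
  moreover have "card (adjoin G A b) > 0"
    using subgroup_finite[OF adjoin_subgroup[OF A bG]] adjoin_incl(2)[OF AG(1) bG AG(2)] by (auto simp: card_gt_0_iff)
  ultimately have "card B \<le> card (adjoin G A b)" using AB(2) dvd_imp_le by simp
  then show ?thesis using card_seteq[OF subgroup_finite[OF B] sub] by simp
qed

text \<open>Chief factors of a finite p-group are central of order p. For L maximal among the normal
  subgroups of G from A upwards and strictly below B, some b in B - L is central modulo L, and
  adjoining it to L gives B. Were b^p outside L, it would be central as well and adjoining it would
  also give B, against \<open>pow_p_mem_of_central\<close>.\<close>

lemma ex_chief_below:
  assumes A: "A \<lhd> G" and B: "B \<lhd> G" and AB: "A \<subset> B"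
  shows "\<exists>L. L \<lhd> G \<and> A \<subseteq> L \<and> L \<subset> B \<and> card B = p * card L \<and>
    (\<forall>b\<in>B. \<forall>h\<in>carrier G. gcomm G b h \<in> L) \<and> (\<forall>b\<in>B. b [^] p \<in> L)"
proof -
  have sub: "K \<lhd> G \<Longrightarrow> K \<subseteq> carrier G" for K using normal_imp_subgroup subgroup.subset by blast
  obtain L where L: "L \<lhd> G" "A \<subseteq> L" "L \<subset> B"
    and max: "\<And>K. K \<lhd> G \<Longrightarrow> A \<subseteq> K \<Longrightarrow> K \<subset> B \<Longrightarrow> L \<subseteq> K \<Longrightarrow> K = L"
  proof -
    have "\<exists>L. (L \<lhd> G \<and> A \<subseteq> L \<and> L \<subset> B) \<and> (\<forall>K. (K \<lhd> G \<and> A \<subseteq> K \<and> K \<subset> B) \<and> L \<subseteq> K \<longrightarrow> K = L)"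
      by (rule ex_greatest_subset[of _ A]) (use A AB sub in auto)
    then show thesis by (elim exE conjE) (rule that, assumption+, metis)
  qed
  interpret L: normal L G by fact
  have L1: "\<one> \<in> L" by simp
  obtain b where b: "b \<in> B - L" and cen: "\<And>h. h \<in> carrier G \<Longrightarrow> gcomm G b h \<in> L"
    using ex_central_modulo[OF L(1) B L(3)] by blast
  have BS: "subgroup B G" using B normal_imp_subgroup by blast
  have bG: "b \<in> carrier G" using b sub[OF B] by blast
  have inc: "L \<subseteq> adjoin G L b" "b \<in> adjoin G L b" using adjoin_incl[OF sub[OF L(1)] bG] L1 by auto
  have LbB: "adjoin G L b = B"
  proof (rule ccontr)
    assume "adjoin G L b \<noteq> B"
    then have "adjoin G L b \<subset> B" using adjoin_least[OF BS] L(3) b by blast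
    then show False using max[OF adjoin_normal[OF L(1) bG cen]] inc L(2) b by blast
  qed
  obtain Q :: "'a set monoid" and \<pi> where hom: "group_hom G Q \<pi>"
    and ker: "\<And>g. g \<in> carrier G \<Longrightarrow> \<pi> g = \<one>\<^bsub>Q\<^esub> \<longleftrightarrow> g \<in> L"
    by (rule normal_quotientE[OF L(1)], rule that)
  interpret \<pi>: group_hom G Q \<pi> using hom .
  have pib: "\<pi> b \<in> carrier Q" using bG by simp
  have comm: "\<pi> b [^]\<^bsub>Q\<^esub> (i::int) \<otimes>\<^bsub>Q\<^esub> \<pi> h = \<pi> h \<otimes>\<^bsub>Q\<^esub> \<pi> b [^]\<^bsub>Q\<^esub> i" if h: "h \<in> carrier G" for h i
  proof -
    have c: "\<pi> b \<otimes>\<^bsub>Q\<^esub> \<pi> h = \<pi> h \<otimes>\<^bsub>Q\<^esub> \<pi> b"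
      using cen[OF h] ker[of "gcomm G b h"] bG h \<pi>.hom_gcomm \<pi>.H.gcomm_eq_one_iff by simp
    have "\<pi> h \<otimes>\<^bsub>Q\<^esub> \<pi> b [^]\<^bsub>Q\<^esub> i \<otimes>\<^bsub>Q\<^esub> inv\<^bsub>Q\<^esub> \<pi> h = (\<pi> h \<otimes>\<^bsub>Q\<^esub> \<pi> b \<otimes>\<^bsub>Q\<^esub> inv\<^bsub>Q\<^esub> \<pi> h) [^]\<^bsub>Q\<^esub> i"
      using \<pi>.H.int_pow_conjugate h bG by auto
    also have "\<pi> h \<otimes>\<^bsub>Q\<^esub> \<pi> b \<otimes>\<^bsub>Q\<^esub> inv\<^bsub>Q\<^esub> \<pi> h = \<pi> b" unfolding c[symmetric] using h bG by (simp add: \<pi>.H.m_assoc)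
    finally have "\<pi> h \<otimes>\<^bsub>Q\<^esub> \<pi> b [^]\<^bsub>Q\<^esub> i \<otimes>\<^bsub>Q\<^esub> inv\<^bsub>Q\<^esub> \<pi> h \<otimes>\<^bsub>Q\<^esub> \<pi> h = \<pi> b [^]\<^bsub>Q\<^esub> i \<otimes>\<^bsub>Q\<^esub> \<pi> h" by simp
    then show ?thesis using h bG by (simp add: \<pi>.H.m_assoc)
  qed
  have bp: "b [^] p \<in> L"
  proof (rule ccontr)
    assume n: "b [^] p \<notin> L"
    have bpG: "b [^] p \<in> carrier G" using bG by simp
    have cen': "gcomm G (b [^] p) h \<in> L" if h: "h \<in> carrier G" for h
      using comm[OF h, of "int p"] ker[of "gcomm G (b [^] p) h"] bpG h \<pi>.hom_gcomm \<pi>.H.gcomm_eq_one_iff bG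
      by (simp add: int_pow_int \<pi>.hom_nat_pow)
    have "b [^] p \<in> B" using subgroup_int_pow_closed[OF BS, of b "int p"] b by (simp add: int_pow_int)
    then have s: "adjoin G L (b [^] p) \<subseteq> B" using adjoin_least[OF BS] L(3) by blast
    have inc': "L \<subseteq> adjoin G L (b [^] p)" "b [^] p \<in> adjoin G L (b [^] p)"
      using adjoin_incl[OF sub[OF L(1)] bpG] L1 by auto
    have "adjoin G L (b [^] p) = B"
    proof (rule ccontr)
      assume "adjoin G L (b [^] p) \<noteq> B"
      then show False using max[OF adjoin_normal[OF L(1) bpG cen']] inc' L(2) s n by blast
    qed
    then show False using pow_p_mem_of_central[OF L(1) bG] b by blast
  qed
  have rep: "\<exists>i::int. \<pi> x = \<pi> b [^]\<^bsub>Q\<^esub> i" if "x \<in> B" for x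
  proof -
    have "x \<in> adjoin G L b" using LbB that by simp
    then obtain l i where mi: "x = l \<otimes> b [^] (i::int)" "l \<in> L" unfolding adjoin_def by auto
    then have "\<pi> x = \<pi> b [^]\<^bsub>Q\<^esub> i" using ker[of l] bG by (simp add: \<pi>.hom_int_pow)
    then show ?thesis by blast
  qed
  have "gcomm G x h \<in> L" if x: "x \<in> B" and h: "h \<in> carrier G" for x h
  proof -
    have xG: "x \<in> carrier G" using x sub[OF B] by blast
    obtain i where "\<pi> x = \<pi> b [^]\<^bsub>Q\<^esub> (i::int)" using rep[OF x] by blast
    then have "\<pi> x \<otimes>\<^bsub>Q\<^esub> \<pi> h = \<pi> h \<otimes>\<^bsub>Q\<^esub> \<pi> x" using comm[OF h] by simp
    then have "\<pi> (gcomm G x h) = \<one>\<^bsub>Q\<^esub>" using xG h \<pi>.hom_gcomm \<pi>.H.gcomm_eq_one_iff by simp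
    then show ?thesis using ker[of "gcomm G x h"] xG h by simp
  qed
  moreover have pb1: "\<pi> b [^]\<^bsub>Q\<^esub> int p = \<one>\<^bsub>Q\<^esub>" using ker[of "b [^] p"] bp bG by (simp add: int_pow_int \<pi>.hom_nat_pow)
  have "x [^] p \<in> L" if x: "x \<in> B" for x
  proof -
    have xG: "x \<in> carrier G" using x sub[OF B] by blast
    obtain i where i: "\<pi> x = \<pi> b [^]\<^bsub>Q\<^esub> (i::int)" using rep[OF x] by blast
    have "\<pi> (x [^] p) = (\<pi> b [^]\<^bsub>Q\<^esub> i) [^]\<^bsub>Q\<^esub> int p" using xG i by (simp add: \<pi>.hom_nat_pow int_pow_int)
    also have "\<dots> = (\<pi> b [^]\<^bsub>Q\<^esub> int p) [^]\<^bsub>Q\<^esub> i" using pib by (simp add: \<pi>.H.int_pow_pow mult.commute)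
    finally have "\<pi> (x [^] p) = \<one>\<^bsub>Q\<^esub>" using pb1 by simp
    then show ?thesis using ker[of "x [^] p"] xG by simp
  qed
  moreover have "card B = p * card L"
  proof (rule antisym)
    \<comment> \<open>Reducing the exponent of \<open>b\<close> modulo p leaves at most p cosets of
      \<open>L\<close> in \<open>B\<close>.\<close>
    have "B \<subseteq> (\<lambda>(l, i). l \<otimes> b [^] (i::nat)) ` (L \<times> {..<p})"
    proof
      fix x assume x: "x \<in> B"
      have xG: "x \<in> carrier G" using x sub[OF B] by blast
      obtain i where i: "\<pi> x = \<pi> b [^]\<^bsub>Q\<^esub> (i::int)" using rep[OF x] by blast
      have p0: "int p > 0" using prime_gt_0_nat[OF prime_p] by simp
      define j where "j = nat (i mod int p)"
      have j: "j < p" "i = int p * (i div int p) + int j" using p0 unfolding j_def by (auto simp: nat_less_iff)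
      have "\<pi> b [^]\<^bsub>Q\<^esub> i = (\<pi> b [^]\<^bsub>Q\<^esub> int p) [^]\<^bsub>Q\<^esub> (i div int p) \<otimes>\<^bsub>Q\<^esub> \<pi> b [^]\<^bsub>Q\<^esub> int j"
        using j(2) pib by (metis \<pi>.H.int_pow_mult \<pi>.H.int_pow_pow)
      then have "\<pi> x = \<pi> (b [^] j)" unfolding i using pb1 pib bG by (simp add: int_pow_int \<pi>.hom_nat_pow)
      then have "\<pi> (x \<otimes> inv (b [^] j)) = \<one>\<^bsub>Q\<^esub>" using xG bG by (simp del: \<pi>.hom_nat_pow)
      then have "x \<otimes> inv (b [^] j) \<in> L" using ker[of "x \<otimes> inv (b [^] j)"] xG bG by simp
      moreover have "x = (x \<otimes> inv (b [^] j)) \<otimes> b [^] j" using xG bG by (simp add: m_assoc)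
      ultimately show "x \<in> (\<lambda>(l, i). l \<otimes> b [^] (i::nat)) ` (L \<times> {..<p})" using j(1) by force
    qed
    then have "card B \<le> card (L \<times> {..<p})"
      using subgroup_finite[OF L.is_subgroup] by (intro surj_card_le) auto
    then show "card B \<le> p * card L" by (simp add: card_cartesian_product mult.commute)
    have "card B > 0" using subgroup_finite[OF BS] b by (auto simp: card_gt_0_iff)
    then show "p * card L \<le> card B" using card_subgroup_psubset[OF L.is_subgroup BS L(3)] dvd_imp_le by blast
  qed
  ultimately show ?thesis using L by blast
qed

end

section \<open>Commutators with an element outside the section centralizer\<close>

lemma (in group_hom) commuting_subgroup:
  assumes z: "z \<in> carrier G"
  shows "subgroup {g \<in> carrier G. h g \<otimes>\<^bsub>H\<^esub> h z = h z \<otimes>\<^bsub>H\<^esub> h g} G" (is "subgroup ?S G")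
proof (rule G.subgroupI)
  show "?S \<subseteq> carrier G" by blast
  show "?S \<noteq> {}" using z by (auto intro!: exI[of _ \<one>])
  show "inv a \<in> ?S" if "a \<in> ?S" for a using that z H.commute_inv by simp
  fix a b assume "a \<in> ?S" "b \<in> ?S"
  then show "a \<otimes> b \<in> ?S" using z by simp (metis H.m_assoc hom_closed)
qed

text \<open>Modulo \<open>B\<close> the generators commute, so the centralizer of each of them is
  everything; hence the centralizer of every element contains both generators.\<close>

lemma (in group) gcomm_in_of_generators:
  assumes gen: "generate G {x, y} = carrier G" and xy: "x \<in> carrier G" "y \<in> carrier G"
    and B: "B \<lhd> G" and c: "gcomm G y x \<in> B" and a: "a \<in> carrier G" and b: "b \<in> carrier G"
  shows "gcomm G a b \<in> B"
proof -
  obtain Q :: "'a set monoid" and \<pi> where hom: "group_hom G Q \<pi>"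
    and ker: "\<And>g. g \<in> carrier G \<Longrightarrow> \<pi> g = \<one>\<^bsub>Q\<^esub> \<longleftrightarrow> g \<in> B"
    by (rule normal_quotientE[OF B], rule that)
  interpret \<pi>: group_hom G Q \<pi> using hom .
  have iff: "gcomm G a b \<in> B \<longleftrightarrow> \<pi> a \<otimes>\<^bsub>Q\<^esub> \<pi> b = \<pi> b \<otimes>\<^bsub>Q\<^esub> \<pi> a"
    if "a \<in> carrier G" "b \<in> carrier G" for a b
    using ker[of "gcomm G a b"] that \<pi>.hom_gcomm \<pi>.H.gcomm_eq_one_iff by simp
  have yx: "\<pi> y \<otimes>\<^bsub>Q\<^esub> \<pi> x = \<pi> x \<otimes>\<^bsub>Q\<^esub> \<pi> y" using iff[OF xy(2,1)] c by simp
  have all: "{g \<in> carrier G. \<pi> g \<otimes>\<^bsub>Q\<^esub> \<pi> z = \<pi> z \<otimes>\<^bsub>Q\<^esub> \<pi> g} = carrier G" (is "?S = _")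
    if z: "z \<in> carrier G" "\<pi> x \<otimes>\<^bsub>Q\<^esub> \<pi> z = \<pi> z \<otimes>\<^bsub>Q\<^esub> \<pi> x" "\<pi> y \<otimes>\<^bsub>Q\<^esub> \<pi> z = \<pi> z \<otimes>\<^bsub>Q\<^esub> \<pi> y" for z
    using generate_subgroup_incl[of "{x, y}" ?S] \<pi>.commuting_subgroup[OF z(1)] z xy gen by blast
  have "\<pi> g \<otimes>\<^bsub>Q\<^esub> \<pi> x = \<pi> x \<otimes>\<^bsub>Q\<^esub> \<pi> g" "\<pi> g \<otimes>\<^bsub>Q\<^esub> \<pi> y = \<pi> y \<otimes>\<^bsub>Q\<^esub> \<pi> g"
    if "g \<in> carrier G" for g
    using all[OF xy(1)] all[OF xy(2)] yx that by auto
  then show ?thesis using all[OF b] iff[OF a b] a b by (metis (mono_tags, lifting) mem_Collect_eq)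
qed

lemma (in group) derived_least:
  assumes "subgroup B G" "\<And>a b. a \<in> carrier G \<Longrightarrow> b \<in> carrier G \<Longrightarrow> gcomm G a b \<in> B"
  shows "commutator_subgroup G \<subseteq> B"
proof -
  have "h1 \<otimes> h2 \<otimes> inv h1 \<otimes> inv h2 \<in> B" if "h1 \<in> carrier G" "h2 \<in> carrier G" for h1 h2
    using assms(2)[of "inv h1" "inv h2"] that by (simp add: gcomm_def)
  then have "derived_set G (carrier G) \<subseteq> B" by auto
  then show ?thesis unfolding derived_def using generate_subgroup_incl assms(1) by blast
qed

text \<open>In general \<open>[ab, x]\<close> is the conjugate of \<open>[a, x]\<close> by b, times
  \<open>[b, x]\<close>; the last hypothesis removes the conjugation.\<close>

lemma (in group) gcomm_mult:
  assumes "a \<in> carrier G" "b \<in> carrier G" "x \<in> carrier G"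
    and "gcomm G a x \<otimes> b = b \<otimes> gcomm G a x"
  shows "gcomm G (a \<otimes> b) x = gcomm G a x \<otimes> gcomm G b x"
proof -
  have "gcomm G (a \<otimes> b) x = inv b \<otimes> (gcomm G a x \<otimes> b) \<otimes> gcomm G b x"
    using assms(1-3) by (simp add: gcomm_def inv_mult_group m_assoc)
  also have "\<dots> = gcomm G a x \<otimes> gcomm G b x" unfolding assms(4) using assms(1-3) by (simp add: m_assoc)
  finally show ?thesis .
qed

text \<open>Modulo \<open>W\<close> the map \<open>n \<mapsto> [n, x]\<close> is a homomorphism on \<open>N\<close>, and its image is a normal subgroup
  modulo which the generators \<open>x\<close> and \<open>y\<close> commute.\<close>

lemma (in group) commutators_cover_derived:
  assumes N: "N \<lhd> G" and W: "W \<lhd> G"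
    and x: "x \<in> carrier G" and y: "y \<in> N" and gen: "generate G {x, y} = carrier G"
    and DN: "commutator_subgroup G \<subseteq> N"
    and cen: "\<And>n h. n \<in> N \<Longrightarrow> h \<in> commutator_subgroup G \<Longrightarrow> gcomm G n h \<in> W"
    and h: "h \<in> commutator_subgroup G"
  shows "\<exists>n\<in>N. gcomm G n x \<otimes> inv h \<in> W"
proof -
  let ?D = "commutator_subgroup G"
  interpret N: normal N G by fact
  interpret D: normal ?D G by (rule derived_self_is_normal)
  obtain Q :: "'a set monoid" and \<pi> where hom: "group_hom G Q \<pi>"
    and ker: "\<And>g. g \<in> carrier G \<Longrightarrow> \<pi> g = \<one>\<^bsub>Q\<^esub> \<longleftrightarrow> g \<in> W"
    and eqQ: "\<And>g h. g \<in> carrier G \<Longrightarrow> h \<in> carrier G \<Longrightarrow> \<pi> g = \<pi> h \<longleftrightarrow> g \<otimes> inv h \<in> W"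
    by (rule normal_quotientE[OF W], rule that)
  interpret \<pi>: group_hom G Q \<pi> using hom .
  have comm: "\<pi> n \<otimes>\<^bsub>Q\<^esub> \<pi> h = \<pi> h \<otimes>\<^bsub>Q\<^esub> \<pi> n" if "n \<in> N" "h \<in> ?D" for n h
    using cen[OF that] ker[of "gcomm G n h"] that \<pi>.hom_gcomm \<pi>.H.gcomm_eq_one_iff by simp
  have cD: "gcomm G n x \<in> ?D" if "n \<in> N" for n using gcomm_in_derived x that by simp
  have mult: "\<pi> (gcomm G (a \<otimes> b) x) = \<pi> (gcomm G a x) \<otimes>\<^bsub>Q\<^esub> \<pi> (gcomm G b x)" if "a \<in> N" "b \<in> N" for a b
    using that x comm[OF that(2) cD[OF that(1)]] \<pi>.H.gcomm_mult[of "\<pi> a" "\<pi> b" "\<pi> x"]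
    by (simp add: \<pi>.hom_gcomm)
  \<comment> \<open>The elements of \<open>D\<close> that agree modulo \<open>W\<close> with some
    \<open>[n, x]\<close>; the aim is to show that these are all of \<open>D\<close>.\<close>
  define B where "B = {g \<in> ?D. \<exists>n\<in>N. \<pi> (gcomm G n x) = \<pi> g}"
  have one: "\<pi> (gcomm G \<one> x) = \<one>\<^bsub>Q\<^esub>" using x by (simp add: gcomm_def)
  have BS: "subgroup B G"
  proof (rule subgroupI)
    show "B \<subseteq> carrier G" unfolding B_def using D.subset by blast
    have "\<pi> (gcomm G \<one> x) = \<pi> \<one>" using one by simp
    then have "\<one> \<in> B" unfolding B_def using D.one_closed N.one_closed by blast
    then show "B \<noteq> {}" by blast
    fix a assume "a \<in> B"
    then obtain n where n: "a \<in> ?D" "n \<in> N" "\<pi> (gcomm G n x) = \<pi> a" unfolding B_def by blast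
    have "\<pi> a \<otimes>\<^bsub>Q\<^esub> \<pi> (gcomm G (inv n) x) = \<one>\<^bsub>Q\<^esub>" using mult[of n "inv n"] n one by simp
    then have "\<pi> (gcomm G (inv n) x) = inv\<^bsub>Q\<^esub> \<pi> a"
      using n x \<pi>.H.inv_equality[of "\<pi> (gcomm G (inv n) x)" "\<pi> a"] \<pi>.H.inv_comm by simp
    then have "\<pi> (gcomm G (inv n) x) = \<pi> (inv a)" using n(1) by simp
    then show "inv a \<in> B" unfolding B_def using n by (auto intro!: bexI[of _ "inv n"])
    fix b assume "b \<in> B"
    then obtain m where m: "b \<in> ?D" "m \<in> N" "\<pi> (gcomm G m x) = \<pi> b" unfolding B_def by blast
    show "a \<otimes> b \<in> B" unfolding B_def using mult[of n m] n m by (auto intro!: bexI[of _ "n \<otimes> m"])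
  qed
  \<comment> \<open>Normality is checked on the generators and their inverses. Elements of
    \<open>N\<close> centralize \<open>D\<close> modulo \<open>W\<close> and do not change b there,
    while x and its inverse carry \<open>[n, x]\<close> to the commutator of the conjugated n with
    x.\<close>
  have conj: "g \<otimes> b \<otimes> inv g \<in> B" if g: "g \<in> {x, y, inv x, inv y}" and b: "b \<in> B" for g b
  proof -
    obtain n where n: "b \<in> ?D" "n \<in> N" "\<pi> (gcomm G n x) = \<pi> b" using b unfolding B_def by blast
    have gG: "g \<in> carrier G" using g x y by auto
    have cl: "g \<otimes> b \<otimes> inv g \<in> ?D" using D.inv_op_closed2[OF gG n(1)] .
    show ?thesis
    proof (cases "g \<in> N")
      case True
      have "\<pi> (g \<otimes> b \<otimes> inv g) = \<pi> b" using comm[OF True n(1)] gG n(1) by (simp add: \<pi>.H.m_assoc)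
      then show ?thesis unfolding B_def using cl n by auto
    next
      case False
      then have gx: "g = x \<or> g = inv x" using g y by auto
      have "gcomm G (g \<otimes> n \<otimes> inv g) x = g \<otimes> gcomm G n x \<otimes> inv g"
        using gx x n(2) by (auto simp: gcomm_def inv_mult_group m_assoc)
      then have "\<pi> (gcomm G (g \<otimes> n \<otimes> inv g) x) = \<pi> (g \<otimes> b \<otimes> inv g)" using n gG x by simp
      moreover have "g \<otimes> n \<otimes> inv g \<in> N" using N.inv_op_closed2[OF gG n(2)] .
      ultimately show ?thesis unfolding B_def using cl by blast
    qed
  qed
  have BG: "B \<subseteq> carrier G" using BS subgroup.subset by blast
  have yG: "y \<in> carrier G" using y by simp
  have "carrier G \<subseteq> {g \<in> carrier G. \<forall>m\<in>B. g \<otimes> m \<otimes> inv g \<in> B \<and> inv g \<otimes> m \<otimes> g \<in> B}" (is "_ \<subseteq> ?T")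
    unfolding gen[symmetric]
  proof (rule generate_subgroup_incl)
    have "\<forall>g\<in>{x, y}. inv g \<in> {x, y, inv x, inv y} \<and> inv (inv g) = g" using x yG by auto
    then show "{x, y} \<subseteq> {g \<in> generate G {x, y}. \<forall>m\<in>B. g \<otimes> m \<otimes> inv g \<in> B \<and> inv g \<otimes> m \<otimes> g \<in> B}"
      using conj[of "inv x"] conj[of "inv y"] conj[of x] conj[of y] x yG
      by (auto intro: generate.incl)
    show "subgroup {g \<in> generate G {x, y}. \<forall>m\<in>B. g \<otimes> m \<otimes> inv g \<in> B \<and> inv g \<otimes> m \<otimes> g \<in> B} G"
      unfolding gen using normalizer_subgroup[OF BG] .
  qed
  then have BN: "B \<lhd> G" by (intro normal_invI[OF BS]) blast
  have "gcomm G y x \<in> B" unfolding B_def using cD[OF y] y by blast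
  then have "gcomm G a b \<in> B" if "a \<in> carrier G" "b \<in> carrier G" for a b
    using gcomm_in_of_generators[OF gen x yG BN _ that] by blast
  then have "?D \<subseteq> B" by (rule derived_least[OF BS])
  then obtain n where "n \<in> N" "\<pi> (gcomm G n x) = \<pi> h" using h unfolding B_def by blast
  then show ?thesis using eqQ[of "gcomm G n x" h] x h by auto
qed

text \<open>The space of homomorphisms from G to the additive group of the field has dimension at
  most two. This trace of 2-generation can be read off the group algebra.\<close>

definition dependent_homs :: "('a, 'b) monoid_scheme \<Rightarrow> 'f::field itself \<Rightarrow> bool" where
  "dependent_homs G _ \<longleftrightarrow> (\<forall>f1 f2 f3 :: 'a \<Rightarrow> 'f.
     (\<forall>f\<in>{f1, f2, f3}. \<forall>x\<in>carrier G. \<forall>y\<in>carrier G. f (x \<otimes>\<^bsub>G\<^esub> y) = f x + f y) \<longrightarrow>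
     (\<exists>c1 c2 c3. (c1, c2, c3) \<noteq> (0, 0, 0) \<and> (\<forall>x\<in>carrier G. c1 * f1 x + c2 * f2 x + c3 * f3 x = 0)))"

section \<open>Choosing a second generator in N; the section centralizer as a normal
  subgroup\<close>

context p_group begin

lemma maximal_of_index_p:
  assumes N: "subgroup N G" and idx: "Coset.order G = p * card N"
  shows "maximal_subgroup N G"
  unfolding maximal_subgroup_def
proof (intro conjI allI impI)
  have N0: "card N > 0" using subgroup_finite[OF N] subgroup.one_closed[OF N] by (metis card_gt_0_iff empty_iff)
  show "subgroup N G" by fact
  show "N \<noteq> carrier G" using idx N0 prime_gt_1_nat[OF prime_p] unfolding Coset.order_def by auto
  fix K assume K: "subgroup K G \<and> N \<subseteq> K"
  show "K = N \<or> K = carrier G"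
  proof (cases "K = N")
    case False
    then have "p * card N dvd card K" using card_subgroup_psubset[OF N] K by blast
    moreover have "card K > 0" using subgroup_finite[of K] K N0 by (metis card_gt_0_iff card.empty less_numeral_extra(3) subset_empty)
    ultimately have "Coset.order G \<le> card K" unfolding idx using dvd_imp_le by blast
    then have "K = carrier G" using K card_seteq[OF finite_carrier, of K] subgroup.subset[of K G] unfolding Coset.order_def by blast
    then show ?thesis ..
  qed auto
qed

text \<open>Take a maximal subgroup M containing x and some y in N outside M. If x and y lay in a
  maximal subgroup K, the three additive maps with kernels N, M and K would be independent:
  evaluation at y isolates the second, at x the first, and at a point outside K the third.\<close>

lemma ex_second_generator:
  assumes dep: "dependent_homs G TYPE('f::field)" and char: "CHAR('f) = p"
    and N: "maximal_subgroup N G" and x: "x \<in> carrier G - N" and nc: "generate G {x} \<noteq> carrier G"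
  shows "\<exists>y\<in>N. generate G {x, y} = carrier G"
proof -
  have NS: "subgroup N G" using N unfolding maximal_subgroup_def by blast
  have xG: "x \<in> carrier G" using x by simp
  obtain M where M: "maximal_subgroup M G" "generate G {x} \<subseteq> M"
    using ex_maximal_above[OF generate_is_subgroup nc] xG by blast
  have xM: "x \<in> M" using M(2) generate.incl[of x "{x}" G] by blast
  have "subgroup M G \<and> N \<subseteq> M \<longrightarrow> M = N \<or> M = carrier G" "subgroup M G" "M \<noteq> carrier G"
    using N M(1) unfolding maximal_subgroup_def by blast+
  then have "\<not> N \<subseteq> M" using x xM by blast
  then obtain y where y: "y \<in> N" "y \<notin> M" by blast
  have yG: "y \<in> carrier G" using y NS subgroup.subset by blast
  have "generate G {x, y} = carrier G"
  proof (rule ccontr)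
    assume ne: "generate G {x, y} \<noteq> carrier G"
    obtain K where K: "maximal_subgroup K G" "generate G {x, y} \<subseteq> K"
      using ex_maximal_above[OF generate_is_subgroup ne] xG yG by blast
    have xyK: "x \<in> K" "y \<in> K" using K(2) generate.incl[of _ "{x, y}" G] by blast+
    have KS: "subgroup K G" "K \<noteq> carrier G" using K(1) unfolding maximal_subgroup_def by blast+
    obtain z where z: "z \<in> carrier G" "z \<notin> K" using KS subgroup.subset[OF KS(1)] by blast
    obtain f1 :: "'a \<Rightarrow> 'f" where f1: "\<forall>x\<in>carrier G. \<forall>y\<in>carrier G. f1 (x \<otimes> y) = f1 x + f1 y"
      "\<forall>x\<in>carrier G. f1 x = 0 \<longleftrightarrow> x \<in> N" using ex_additive_hom[OF N char] by blast
    obtain f2 :: "'a \<Rightarrow> 'f" where f2: "\<forall>x\<in>carrier G. \<forall>y\<in>carrier G. f2 (x \<otimes> y) = f2 x + f2 y"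
      "\<forall>x\<in>carrier G. f2 x = 0 \<longleftrightarrow> x \<in> M" using ex_additive_hom[OF M(1) char] by blast
    obtain f3 :: "'a \<Rightarrow> 'f" where f3: "\<forall>x\<in>carrier G. \<forall>y\<in>carrier G. f3 (x \<otimes> y) = f3 x + f3 y"
      "\<forall>x\<in>carrier G. f3 x = 0 \<longleftrightarrow> x \<in> K" using ex_additive_hom[OF K(1) char] by blast
    have "\<forall>f\<in>{f1, f2, f3}. \<forall>x\<in>carrier G. \<forall>y\<in>carrier G. f (x \<otimes> y) = f x + f y"
      using f1(1) f2(1) f3(1) by simp
    then obtain c1 c2 c3 where c: "(c1, c2, c3) \<noteq> (0, 0, 0)"
      "\<forall>x\<in>carrier G. c1 * f1 x + c2 * f2 x + c3 * f3 x = 0"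
      using dep unfolding dependent_homs_def by blast
    have "c2 * f2 y = 0" using c(2) yG f1(2) f3(2) y xyK by fastforce
    then have c2: "c2 = 0" using f2(2) yG y by simp
    have "c1 * f1 x = 0" using c(2) xG f2(2) f3(2) xM xyK by fastforce
    then have c1: "c1 = 0" using f1(2) xG x by simp
    have "c3 * f3 z = 0" using c(2) z c1 c2 by fastforce
    then have "c3 = 0" using f3(2) z by simp
    then show False using c(1) c1 c2 by simp
  qed
  then show ?thesis using y by blast
qed

lemma section_centralizer_alt:
  "section_centralizer G = {g \<in> carrier G. \<forall>h\<in>commutator_subgroup G.
     gcomm G g h \<in> frattini (G\<lparr>carrier := commutator_subgroup G\<rparr>)}"
  unfolding section_centralizer_def gcomm_def ..

lemma section_centralizer_normal:
  "section_centralizer G \<lhd> G" "commutator_subgroup G \<subseteq> section_centralizer G"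
proof -
  let ?D = "commutator_subgroup G" and ?N = "section_centralizer G"
  let ?W = "frattini (G\<lparr>carrier := ?D\<rparr>)"
  interpret D: normal ?D G by (rule derived_self_is_normal)
  have W: "?W \<lhd> G" by (rule frattini_normal[OF derived_self_is_normal])
  obtain Q :: "'a set monoid" and \<pi> where hom: "group_hom G Q \<pi>"
    and ker: "\<And>g. g \<in> carrier G \<Longrightarrow> \<pi> g = \<one>\<^bsub>Q\<^esub> \<longleftrightarrow> g \<in> ?W"
    by (rule normal_quotientE[OF W], rule that)
  interpret \<pi>: group_hom G Q \<pi> using hom .
  have iff: "gcomm G g h \<in> ?W \<longleftrightarrow> \<pi> g \<otimes>\<^bsub>Q\<^esub> \<pi> h = \<pi> h \<otimes>\<^bsub>Q\<^esub> \<pi> g" if "g \<in> carrier G" "h \<in> ?D" for g h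
    using ker[of "gcomm G g h"] that \<pi>.hom_gcomm \<pi>.H.gcomm_eq_one_iff by simp
  have N: "?N = carrier G \<inter> (\<Inter>h\<in>?D. {g \<in> carrier G. \<pi> g \<otimes>\<^bsub>Q\<^esub> \<pi> h = \<pi> h \<otimes>\<^bsub>Q\<^esub> \<pi> g})"
    unfolding section_centralizer_alt by (auto simp: iff)
  have "subgroup ?N G"
  proof (rule subgroupI)
    show "?N \<subseteq> carrier G" unfolding N by blast
    have "\<one> \<in> ?N" unfolding N using subgroup.one_closed[OF \<pi>.commuting_subgroup[OF D.mem_carrier]] by simp
    then show "?N \<noteq> {}" by blast
    show "inv a \<in> ?N" if "a \<in> ?N" for a
      using that subgroup.m_inv_closed[OF \<pi>.commuting_subgroup[OF D.mem_carrier]] unfolding N by simp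
    show "a \<otimes> b \<in> ?N" if "a \<in> ?N" "b \<in> ?N" for a b
      using that subgroup.m_closed[OF \<pi>.commuting_subgroup[OF D.mem_carrier]] unfolding N by simp
  qed
  moreover show DN: "?D \<subseteq> ?N"
    unfolding section_centralizer_alt using subgroup_frattini(4)[OF D.is_subgroup] by auto
  ultimately show "?N \<lhd> G" using gcomm_in_derived
    by (intro subgroup_commutators_normal) (auto simp: section_centralizer_alt)
qed

end

text \<open>The class-two power formula; \<open>w\<close> is the commutator of \<open>c\<close> and
  \<open>a\<close>, and moving the factors \<open>a\<close> to the left past the \<open>c\<close>
  collects a binomial number of copies of it.\<close>

lemma (in group) pow_mult_comm_central:
  assumes a: "a \<in> carrier G" and c: "c \<in> carrier G" and w: "w \<in> carrier G"
    and ca: "c \<otimes> a = a \<otimes> c \<otimes> w" and wa: "w \<otimes> a = a \<otimes> w" and wc: "w \<otimes> c = c \<otimes> w"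
  shows "(a \<otimes> c) [^] (n::nat) = a [^] n \<otimes> c [^] n \<otimes> w [^] (n * (n - 1) div 2)"
proof (induction n)
  case (Suc n)
  have wna: "w [^] (m::nat) \<otimes> a = a \<otimes> w [^] m" for m using group_commutes_pow[OF wa w a] .
  have wnc: "w [^] (m::nat) \<otimes> c = c \<otimes> w [^] m" for m using group_commutes_pow[OF wc w c] .
  have cna: "c [^] (m::nat) \<otimes> a = a \<otimes> c [^] m \<otimes> w [^] m" for m
  proof (induction m)
    case (Suc m)
    have "c [^] Suc m \<otimes> a = c [^] m \<otimes> (c \<otimes> a)" using a c by (simp add: m_assoc)
    also have "\<dots> = (c [^] m \<otimes> a) \<otimes> (c \<otimes> w)" using a c w by (simp add: ca m_assoc)
    also have "\<dots> = a \<otimes> c [^] m \<otimes> (w [^] m \<otimes> c) \<otimes> w" using a c w Suc by (simp add: m_assoc)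
    also have "\<dots> = a \<otimes> c [^] Suc m \<otimes> w [^] Suc m" unfolding wnc using a c w by (simp add: m_assoc)
    finally show ?case .
  qed (use a c w in simp)
  have e: "Suc n * (Suc n - 1) div 2 = n + n * (n - 1) div 2"
    by (cases n) (simp_all add: algebra_simps)
  let ?k = "n * (n - 1) div 2"
  have "(a \<otimes> c) [^] Suc n = a [^] n \<otimes> c [^] n \<otimes> (w [^] ?k \<otimes> a) \<otimes> c"
    using a c w by (simp add: Suc m_assoc)
  also have "\<dots> = a [^] n \<otimes> (c [^] n \<otimes> a) \<otimes> (w [^] ?k \<otimes> c)" unfolding wna using a c w by (simp add: m_assoc)
  also have "\<dots> = a [^] n \<otimes> a \<otimes> c [^] n \<otimes> (w [^] n \<otimes> c) \<otimes> w [^] ?k" unfolding cna wnc[of ?k] using a c w by (simp add: m_assoc)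
  also have "\<dots> = a [^] Suc n \<otimes> c [^] Suc n \<otimes> (w [^] n \<otimes> w [^] ?k)" unfolding wnc using a c w by (simp add: m_assoc)
  also have "w [^] n \<otimes> w [^] ?k = w [^] (Suc n * (Suc n - 1) div 2)" unfolding e using w by (simp add: nat_pow_mult)
  finally show ?case .
qed (use a c w in simp)

text \<open>Moving \<open>d\<close> past the inverse of \<open>a\<close> costs the inverse of
  \<open>w\<close>, and moving it past \<open>a\<close> gives \<open>w\<close> back.\<close>

lemma (in group) commutes_gcomm:
  assumes a: "a \<in> carrier G" and x: "x \<in> carrier G" and d: "d \<in> carrier G"
    and dx: "d \<otimes> x = x \<otimes> d" and da: "gcomm G d a = w"
    and w: "w \<in> carrier G" "w \<otimes> x = x \<otimes> w" "w \<otimes> a = a \<otimes> w" "w \<otimes> d = d \<otimes> w"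
  shows "d \<otimes> gcomm G a x = gcomm G a x \<otimes> d"
proof -
  have 1: "d \<otimes> a = a \<otimes> (d \<otimes> w)" unfolding da[symmetric] using a d by (simp add: gcomm_def m_assoc)
  have ix: "d \<otimes> inv x = inv x \<otimes> d" "w \<otimes> inv x = inv x \<otimes> w" using commute_inv[of x d] commute_inv[of x w] dx w(2) d x w(1) by auto
  have ia: "w \<otimes> inv a = inv a \<otimes> w" using commute_inv[of a w] w(1,3) a by auto
  have "inv a \<otimes> d = d \<otimes> w \<otimes> inv a"
  proof -
    have "inv a \<otimes> (d \<otimes> a) \<otimes> inv a = inv a \<otimes> (a \<otimes> (d \<otimes> w)) \<otimes> inv a" by (simp add: 1)
    then show ?thesis using a d w(1) by (simp add: m_assoc)
  qed
  then have 2: "d \<otimes> inv a = inv a \<otimes> d \<otimes> inv w"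
    using ia commute_inv[of w "inv a"] a d w(1) by (metis inv_closed inv_solve_right' m_assoc m_closed)
  have iwx: "inv w \<otimes> x = x \<otimes> inv w" "inv w \<otimes> inv x = inv x \<otimes> inv w" "inv w \<otimes> a = a \<otimes> inv w"
    using commute_inv[of w] w ix a x by auto
  have "d \<otimes> gcomm G a x = (d \<otimes> inv a) \<otimes> inv x \<otimes> a \<otimes> x" using a x d by (simp add: gcomm_def m_assoc)
  also have "\<dots> = inv a \<otimes> d \<otimes> (inv w \<otimes> inv x) \<otimes> a \<otimes> x" unfolding 2 using a x d w(1) by (simp add: m_assoc)
  also have "\<dots> = inv a \<otimes> (d \<otimes> inv x) \<otimes> (inv w \<otimes> a) \<otimes> x" unfolding iwx(2) using a x d w(1) by (simp add: m_assoc)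
  also have "\<dots> = inv a \<otimes> inv x \<otimes> (d \<otimes> a) \<otimes> inv w \<otimes> x" unfolding iwx(3) ix(1) using a x d w(1) by (simp add: m_assoc)
  also have "\<dots> = inv a \<otimes> inv x \<otimes> a \<otimes> (d \<otimes> x)" unfolding 1 using a x d w(1) by (simp add: m_assoc)
  also have "\<dots> = gcomm G a x \<otimes> d" unfolding dx using a x d by (simp add: gcomm_def m_assoc)
  finally show ?thesis .
qed

context p_group begin

text \<open>Here \<open>c\<close> and \<open>d\<close> generate \<open>D\<close> modulo \<open>W\<close>, and \<open>W/L\<close> is a central section of exponent \<open>p\<close>.
  One of \<open>[d, x]\<close> and \<open>[a\<^sup>p, x]\<close> lies outside \<open>L\<close>: if \<open>[d, x] \<in> L\<close>, then \<open>D/L\<close> is abelian, and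
  \<open>[a\<^sup>p, x] \<in> c\<^sup>pL\<close> because \<open>p\<close> is odd, while \<open>c\<^sup>p \<in> L\<close> would make \<open>D/L\<close> elementary abelian.\<close>

lemma ex_commutator_in_section:
  assumes odd: "odd p" and D: "D = commutator_subgroup G" and W: "W = frattini (G\<lparr>carrier := D\<rparr>)"
    and x: "x \<in> carrier G" and a: "a \<in> section_centralizer G"
    and c: "c = gcomm G a x" and d: "d = gcomm G c x"
    and R: "R \<lhd> G" "W \<subseteq> R" "R \<subseteq> D" "card D = p * card R" "card R = p * card W"
    and cR: "c \<notin> R" and dR: "d \<in> R" and dW: "d \<notin> W" and RW: "\<And>r h. r \<in> R \<Longrightarrow> h \<in> carrier G \<Longrightarrow> gcomm G r h \<in> W"
    and L: "L \<lhd> G" "L \<subset> W" "\<And>w h. w \<in> W \<Longrightarrow> h \<in> carrier G \<Longrightarrow> gcomm G w h \<in> L" "\<And>w. w \<in> W \<Longrightarrow> w [^] p \<in> L"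
  shows "\<exists>m\<in>section_centralizer G. gcomm G m x \<in> W - L"
proof (rule ccontr)
  let ?N = "section_centralizer G"
  assume "\<not> ?thesis"
  then have no: "gcomm G m x \<in> L" if "m \<in> ?N" "gcomm G m x \<in> W" for m using that by blast
  interpret N: normal ?N G by (rule section_centralizer_normal(1))
  interpret D: normal D G unfolding D by (rule derived_self_is_normal)
  note WF = subgroup_frattini[OF D.is_subgroup, folded W]
  have WN: "W \<lhd> G" unfolding W using frattini_normal[OF D.normal_axioms] .
  interpret W: normal W G by fact
  interpret L: normal L G by fact
  have DN: "D \<subseteq> ?N" unfolding D by (rule section_centralizer_normal(2))
  have ND: "gcomm G n h \<in> W" if "n \<in> ?N" "h \<in> D" for n h
    using that unfolding section_centralizer_alt W D by blast
  have aG: "a \<in> carrier G" using a by simp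
  have cD: "c \<in> D" unfolding c D using gcomm_in_derived aG x by blast
  have dD: "d \<in> D" using dR R(3) by blast
  have cG: "c \<in> carrier G" and dG: "d \<in> carrier G" using cD dD by auto
  obtain Q :: "'a set monoid" and \<rho> where hom: "group_hom G Q \<rho>"
    and ker: "\<And>g. g \<in> carrier G \<Longrightarrow> \<rho> g = \<one>\<^bsub>Q\<^esub> \<longleftrightarrow> g \<in> L"
    by (rule normal_quotientE[OF L(1)], rule that)
  interpret \<rho>: group_hom G Q \<rho> using hom .
  have comm: "\<rho> g \<otimes>\<^bsub>Q\<^esub> \<rho> h = \<rho> h \<otimes>\<^bsub>Q\<^esub> \<rho> g" if "g \<in> carrier G" "h \<in> carrier G" "gcomm G g h \<in> L" for g h
    using ker[of "gcomm G g h"] that \<rho>.hom_gcomm \<rho>.H.gcomm_eq_one_iff by simp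
  have cenW: "\<rho> w \<otimes>\<^bsub>Q\<^esub> \<rho> h = \<rho> h \<otimes>\<^bsub>Q\<^esub> \<rho> w" if "w \<in> W" "h \<in> carrier G" for w h
    using comm[of w h] L(3) that by simp
  have powW: "\<rho> w [^]\<^bsub>Q\<^esub> p = \<one>\<^bsub>Q\<^esub>" if "w \<in> W" for w
    using L(4)[OF that] ker[of "w [^] p"] that by (simp add: \<rho>.hom_nat_pow)
  have "gcomm G d x \<in> L" using no[of d] RW[OF dR x] dD DN by blast
  then have dx: "\<rho> d \<otimes>\<^bsub>Q\<^esub> \<rho> x = \<rho> x \<otimes>\<^bsub>Q\<^esub> \<rho> d" using comm dG x by blast
  have daW: "gcomm G d a \<in> W" using RW[OF dR aG] .
  \<comment> \<open>Modulo \<open>L\<close> the element \<open>d\<close> commutes with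
    \<open>x\<close>, and with \<open>a\<close> up to \<open>[d, a]\<close>, which lies in
    \<open>W\<close> and is central there. Hence it commutes with \<open>c = [a, x]\<close>.\<close>
  have dc: "\<rho> d \<otimes>\<^bsub>Q\<^esub> \<rho> c = \<rho> c \<otimes>\<^bsub>Q\<^esub> \<rho> d"
    using \<rho>.H.commutes_gcomm[of "\<rho> a" "\<rho> x" "\<rho> d" "\<rho> (gcomm G d a)"] dx cenW[OF daW] aG x dG
    unfolding c by (simp add: \<rho>.hom_gcomm)
  have cp: "\<rho> c [^]\<^bsub>Q\<^esub> p \<noteq> \<one>\<^bsub>Q\<^esub>"
  proof
    assume cp: "\<rho> c [^]\<^bsub>Q\<^esub> p = \<one>\<^bsub>Q\<^esub>"
    \<comment> \<open>Since \<open>d = [c, x]\<close>, conjugation turns \<open>c d\<close> into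
      \<open>c\<close>; taking p-th powers kills d^p along with c^p.\<close>
    have cx: "\<rho> x \<otimes>\<^bsub>Q\<^esub> (\<rho> c \<otimes>\<^bsub>Q\<^esub> \<rho> d) \<otimes>\<^bsub>Q\<^esub> inv\<^bsub>Q\<^esub> \<rho> x = \<rho> c"
      unfolding d using cG x by (simp add: \<rho>.hom_gcomm gcomm_def \<rho>.H.m_assoc)
    have "\<rho> c [^]\<^bsub>Q\<^esub> int p = \<rho> x \<otimes>\<^bsub>Q\<^esub> (\<rho> c \<otimes>\<^bsub>Q\<^esub> \<rho> d) [^]\<^bsub>Q\<^esub> int p \<otimes>\<^bsub>Q\<^esub> inv\<^bsub>Q\<^esub> \<rho> x"
      using \<rho>.H.int_pow_conjugate[of "\<rho> x" "\<rho> c \<otimes>\<^bsub>Q\<^esub> \<rho> d" "int p"] cG dG x cx by simp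
    also have "(\<rho> c \<otimes>\<^bsub>Q\<^esub> \<rho> d) [^]\<^bsub>Q\<^esub> int p = \<rho> d [^]\<^bsub>Q\<^esub> p"
      using \<rho>.H.pow_mult_distrib[of "\<rho> c" "\<rho> d" p] dc cG dG cp by (simp add: int_pow_int)
    finally have "\<rho> x \<otimes>\<^bsub>Q\<^esub> \<rho> d [^]\<^bsub>Q\<^esub> p \<otimes>\<^bsub>Q\<^esub> inv\<^bsub>Q\<^esub> \<rho> x = \<one>\<^bsub>Q\<^esub>" using cp by (simp add: int_pow_int)
    moreover have "\<rho> d [^]\<^bsub>Q\<^esub> p = inv\<^bsub>Q\<^esub> \<rho> x \<otimes>\<^bsub>Q\<^esub> (\<rho> x \<otimes>\<^bsub>Q\<^esub> \<rho> d [^]\<^bsub>Q\<^esub> p \<otimes>\<^bsub>Q\<^esub> inv\<^bsub>Q\<^esub> \<rho> x) \<otimes>\<^bsub>Q\<^esub> \<rho> x"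
      using dG x by (simp add: \<rho>.H.m_assoc)
    ultimately have dp: "\<rho> d [^]\<^bsub>Q\<^esub> p = \<one>\<^bsub>Q\<^esub>" using x by simp
    \<comment> \<open>Adjoining \<open>d\<close> to \<open>W\<close> gives \<open>R\<close> and
      adjoining \<open>c\<close> to \<open>R\<close> gives \<open>D\<close>, both by index p. So
      properties of \<open>D\<close> modulo \<open>L\<close> need only be checked on
      \<open>W\<close>, \<open>d\<close> and \<open>c\<close>.\<close>
    have D_sub: "D \<subseteq> K" if K: "subgroup K G" "W \<subseteq> K" "d \<in> K" "c \<in> K" for K
    proof -
      have "R \<subseteq> K" using adjoin_least[OF K(1,2,3)]
          adjoin_eq_of_index_p[OF WN normal_imp_subgroup[OF R(1)] R(2,5) dR dW] by simp
      then show ?thesis using adjoin_least[OF K(1) _ K(4), of R]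
          adjoin_eq_of_index_p[OF R(1) D.is_subgroup R(3,4) cD cR] by simp
    qed
    have commD: "\<rho> h \<otimes>\<^bsub>Q\<^esub> \<rho> k = \<rho> k \<otimes>\<^bsub>Q\<^esub> \<rho> h"
      if "k \<in> carrier G" "\<rho> d \<otimes>\<^bsub>Q\<^esub> \<rho> k = \<rho> k \<otimes>\<^bsub>Q\<^esub> \<rho> d" "\<rho> c \<otimes>\<^bsub>Q\<^esub> \<rho> k = \<rho> k \<otimes>\<^bsub>Q\<^esub> \<rho> c" "h \<in> D" for h k
      using D_sub[OF \<rho>.commuting_subgroup[OF that(1)]] that cenW W.subset cG dG by blast
    have abel: "\<rho> h \<otimes>\<^bsub>Q\<^esub> \<rho> k = \<rho> k \<otimes>\<^bsub>Q\<^esub> \<rho> h" if "h \<in> D" "k \<in> D" for h k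
      using commD[of k h] commD[OF dG _ dc[symmetric] that(2)] commD[OF cG dc _ that(2)] that by simp
    define P where "P = {h \<in> D. \<rho> h [^]\<^bsub>Q\<^esub> p = \<one>\<^bsub>Q\<^esub>}"
    have "subgroup P G"
    proof (rule subgroupI)
      show "P \<subseteq> carrier G" unfolding P_def using D.subset by blast
      have "\<one> \<in> P" unfolding P_def by simp
      then show "P \<noteq> {}" by blast
      show "inv h \<in> P" if "h \<in> P" for h
        using that unfolding P_def by (simp add: \<rho>.H.nat_pow_inv)
      show "h \<otimes> k \<in> P" if "h \<in> P" "k \<in> P" for h k
        using that \<rho>.H.pow_mult_distrib[OF abel, of h k p] unfolding P_def by simp
    qed
    then have DP: "D \<subseteq> P" by (rule D_sub) (use powW cp dp WF(2) cD dD in \<open>auto simp: P_def\<close>)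
    have "W \<subseteq> L"
    proof (rule WF(5)[OF L.is_subgroup])
      show "L \<subseteq> D" using L(2) WF(2) by blast
      show "gcomm G h k \<in> L" if "h \<in> D" "k \<in> D" for h k
        using abel[OF that] that ker[of "gcomm G h k"] \<rho>.hom_gcomm \<rho>.H.gcomm_eq_one_iff by simp
      show "h [^] p \<in> L" if "h \<in> D" for h
        using subsetD[OF DP that] that ker[of "h [^] p"] unfolding P_def by (simp add: \<rho>.hom_nat_pow)
    qed
    then show False using L(2) by blast
  qed
  have caW: "gcomm G c a \<in> W"
    using W.m_inv_closed[OF ND[OF a cD]] inv_gcomm[OF aG cG] by simp
  \<comment> \<open>Conjugation by x takes a to \<open>a c\<close>. The p-th power of this relation
    will give \<open>[a^p, x] = c^p\<close> modulo \<open>L\<close>.\<close>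
  have xa: "\<rho> x \<otimes>\<^bsub>Q\<^esub> (\<rho> a \<otimes>\<^bsub>Q\<^esub> \<rho> c) \<otimes>\<^bsub>Q\<^esub> inv\<^bsub>Q\<^esub> \<rho> x = \<rho> a"
    unfolding c using aG x by (simp add: \<rho>.hom_gcomm gcomm_def \<rho>.H.m_assoc)
  \<comment> \<open>For odd p the binomial exponent is a multiple of p, so the correction factor
    from \<open>W\<close> vanishes modulo \<open>L\<close>.\<close>
  have "p * (p - 1) div 2 = p * ((p - 1) div 2)" using odd by (simp add: div_mult_swap)
  then have w0: "\<rho> (gcomm G c a) [^]\<^bsub>Q\<^esub> (p * (p - 1) div 2) = \<one>\<^bsub>Q\<^esub>"
    using powW[OF caW] caW by (simp add: \<rho>.H.nat_pow_pow[symmetric] del: \<rho>.hom_nat_pow)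
  have "\<rho> c \<otimes>\<^bsub>Q\<^esub> \<rho> a = \<rho> a \<otimes>\<^bsub>Q\<^esub> \<rho> c \<otimes>\<^bsub>Q\<^esub> \<rho> (gcomm G c a)"
    using aG cG by (simp add: \<rho>.hom_gcomm gcomm_def \<rho>.H.m_assoc)
  then have acp: "(\<rho> a \<otimes>\<^bsub>Q\<^esub> \<rho> c) [^]\<^bsub>Q\<^esub> p = \<rho> a [^]\<^bsub>Q\<^esub> p \<otimes>\<^bsub>Q\<^esub> \<rho> c [^]\<^bsub>Q\<^esub> p"
    using \<rho>.H.pow_mult_comm_central[of "\<rho> a" "\<rho> c" "\<rho> (gcomm G c a)" p] cenW[OF caW] w0 aG cG by simp
  have "\<rho> a [^]\<^bsub>Q\<^esub> p = \<rho> x \<otimes>\<^bsub>Q\<^esub> (\<rho> a [^]\<^bsub>Q\<^esub> p \<otimes>\<^bsub>Q\<^esub> \<rho> c [^]\<^bsub>Q\<^esub> p) \<otimes>\<^bsub>Q\<^esub> inv\<^bsub>Q\<^esub> \<rho> x"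
    using \<rho>.H.int_pow_conjugate[of "\<rho> x" "\<rho> a \<otimes>\<^bsub>Q\<^esub> \<rho> c" "int p"] aG cG x xa acp by (simp add: int_pow_int)
  then have "inv\<^bsub>Q\<^esub> \<rho> x \<otimes>\<^bsub>Q\<^esub> \<rho> a [^]\<^bsub>Q\<^esub> p \<otimes>\<^bsub>Q\<^esub> \<rho> x = \<rho> a [^]\<^bsub>Q\<^esub> p \<otimes>\<^bsub>Q\<^esub> \<rho> c [^]\<^bsub>Q\<^esub> p"
  proof -
    let ?u = "\<rho> a [^]\<^bsub>Q\<^esub> p \<otimes>\<^bsub>Q\<^esub> \<rho> c [^]\<^bsub>Q\<^esub> p"
    have "inv\<^bsub>Q\<^esub> \<rho> x \<otimes>\<^bsub>Q\<^esub> (\<rho> x \<otimes>\<^bsub>Q\<^esub> ?u \<otimes>\<^bsub>Q\<^esub> inv\<^bsub>Q\<^esub> \<rho> x) \<otimes>\<^bsub>Q\<^esub> \<rho> x = ?u"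
      using aG cG x by (simp add: \<rho>.H.m_assoc)
    then show "\<rho> a [^]\<^bsub>Q\<^esub> p = \<rho> x \<otimes>\<^bsub>Q\<^esub> ?u \<otimes>\<^bsub>Q\<^esub> inv\<^bsub>Q\<^esub> \<rho> x \<Longrightarrow>
      inv\<^bsub>Q\<^esub> \<rho> x \<otimes>\<^bsub>Q\<^esub> \<rho> a [^]\<^bsub>Q\<^esub> p \<otimes>\<^bsub>Q\<^esub> \<rho> x = ?u" by simp
  qed
  then have "gcomm Q (\<rho> a [^]\<^bsub>Q\<^esub> p) (\<rho> x) = \<rho> c [^]\<^bsub>Q\<^esub> p"
    using aG cG x by (simp add: gcomm_def \<rho>.H.m_assoc)
  then have eq: "\<rho> (gcomm G (a [^] p) x) = \<rho> (c [^] p)" using aG cG x by (simp add: \<rho>.hom_gcomm \<rho>.hom_nat_pow)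
  then have "gcomm G (a [^] p) x \<otimes> inv (c [^] p) \<in> L"
    using ker[of "gcomm G (a [^] p) x \<otimes> inv (c [^] p)"] aG cG x by simp
  then have "gcomm G (a [^] p) x \<otimes> inv (c [^] p) \<in> W" using L(2) by blast
  moreover have cpW: "c [^] p \<in> W" using WF(3)[OF cD] .
  ultimately have "gcomm G (a [^] p) x \<otimes> inv (c [^] p) \<otimes> c [^] p \<in> W" using W.m_closed by blast
  then have "gcomm G (a [^] p) x \<in> W" using aG cG x by (simp add: m_assoc)
  moreover have "a [^] p \<in> ?N" using N.subgroup_axioms a subgroup_int_pow_closed[of ?N a "int p"] by (simp add: int_pow_int)
  ultimately have "gcomm G (a [^] p) x \<in> L" using no by blast
  then have "\<rho> (gcomm G (a [^] p) x) = \<one>\<^bsub>Q\<^esub>" using ker[of "gcomm G (a [^] p) x"] aG x by simp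
  then show False using eq cp cG by (simp add: \<rho>.hom_nat_pow)
qed

end

section \<open>The number of commutators with a fixed element outside N\<close>

context p_group begin

lemma prime_power_cases:
  assumes "card A = p ^ i" "card B = p ^ j" "card A \<le> card B"
  shows "i \<le> j" "card B = p ^ (j - i) * card A"
proof -
  show "i \<le> j" using assms prime_gt_1_nat[OF prime_p] by simp
  then show "card B = p ^ (j - i) * card A" using assms by (simp add: power_add[symmetric])
qed

text \<open>The cases follow the rank of D/W, where W is the Frattini subgroup of D. Ranks 0 and 1
  are impossible: x would centralize D/W. Rank at least 3 gives p^3 values by \<open>cover\<close>.
  In rank 2, if W is trivial the values are exactly D; otherwise a commutator \<open>[m, x]\<close>
  in W outside a normal L of index p in W extends the covering from D/W to D/L, which has order
  p^3.\<close>

lemma card_commutators: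
  assumes odd: "odd p" and D: "D = commutator_subgroup G" and x: "x \<in> carrier G - section_centralizer G"
    and cover: "\<And>h. h \<in> D \<Longrightarrow>
      \<exists>n\<in>section_centralizer G. gcomm G n x \<otimes> inv h \<in> frattini (G\<lparr>carrier := D\<rparr>)"
  shows "card ((\<lambda>n. gcomm G n x) ` section_centralizer G) = card D \<or>
    p ^ 3 \<le> card ((\<lambda>n. gcomm G n x) ` section_centralizer G)"
proof -
  let ?N = "section_centralizer G" and ?C = "(\<lambda>n. gcomm G n x) ` section_centralizer G"
  define W where "W = frattini (G\<lparr>carrier := D\<rparr>)"
  have xG: "x \<in> carrier G" using x by simp
  interpret N: normal ?N G by (rule section_centralizer_normal(1))
  interpret D: normal D G unfolding D by (rule derived_self_is_normal)
  note WF = subgroup_frattini[OF D.is_subgroup, folded W_def]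
  have WN: "W \<lhd> G" unfolding W_def using frattini_normal[OF D.normal_axioms] .
  interpret W: normal W G by fact
  have DN: "D \<subseteq> ?N" unfolding D by (rule section_centralizer_normal(2))
  have ND: "gcomm G n h \<in> W" if "n \<in> ?N" "h \<in> D" for n h
    using that unfolding section_centralizer_alt W_def D by blast
  have CD: "?C \<subseteq> D" unfolding D using gcomm_in_derived xG by auto
  have finD: "finite D" using subgroup_finite[OF D.is_subgroup] .
  have finC: "finite ?C" using finD CD finite_subset by blast
  have not_all: "\<not> (\<forall>h\<in>D. gcomm G h x \<in> W)"
  proof
    assume all: "\<forall>h\<in>D. gcomm G h x \<in> W"
    have "gcomm G x h \<in> W" if "h \<in> D" for h
      using W.m_inv_closed[of "gcomm G h x"] all that inv_gcomm[of h x] xG by simp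
    then show False using x unfolding section_centralizer_alt W_def D by blast
  qed
  have card_ge: "card D div card L \<le> card ?C"
    if L: "L \<lhd> G" "L \<subseteq> D" and cov: "\<And>h. h \<in> D \<Longrightarrow> \<exists>n\<in>?N. gcomm G n x \<otimes> inv h \<in> L" for L
  proof -
    obtain Q :: "'a set monoid" and \<rho> where hom: "group_hom G Q \<rho>" and rho: "\<rho> = (\<lambda>g. L #> g)"
      and eqQ: "\<And>g h. g \<in> carrier G \<Longrightarrow> h \<in> carrier G \<Longrightarrow> \<rho> g = \<rho> h \<longleftrightarrow> g \<otimes> inv h \<in> L"
      by (rule normal_quotientE[OF L(1)], rule that)
    have cL: "card (\<rho> ` D) * card L = card D" unfolding rho
      using normal_card_image[OF L(1) D.is_subgroup L(2) finite_carrier] .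
    moreover have "card L > 0"
      using finite_subset[OF L(2) finD] subgroup.one_closed[OF normal_imp_subgroup[OF L(1)]]
      by (metis card_gt_0_iff empty_iff)
    ultimately have "card D div card L = card (\<rho> ` D)" unfolding cL[symmetric] by simp
    moreover have "\<rho> ` D \<subseteq> \<rho> ` ?C"
    proof
      fix q assume "q \<in> \<rho> ` D"
      then obtain h where h: "h \<in> D" "q = \<rho> h" by blast
      then obtain n where n: "n \<in> ?N" "gcomm G n x \<otimes> inv h \<in> L" using cov by blast
      then have "\<rho> (gcomm G n x) = q" using eqQ[of "gcomm G n x" h] h xG by simp
      then show "q \<in> \<rho> ` ?C" using n(1) by blast
    qed
    then have "card (\<rho> ` D) \<le> card ?C"
      by (rule le_trans[OF card_mono[OF finite_imageI[OF finC]] card_image_le[OF finC]])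
    ultimately show ?thesis by simp
  qed
  obtain i where i: "card D = p ^ i" using subgroup_card_pow[OF D.is_subgroup] by blast
  obtain j where j: "card W = p ^ j" using subgroup_card_pow[OF W.is_subgroup] by blast
  note ji = prime_power_cases[OF j i card_mono[OF finD WF(2)]]
  have W0: "card W > 0" using j prime_gt_0_nat[OF prime_p] by simp
  have p1: "p > 1" using prime_gt_1_nat[OF prime_p] .
  consider "i = j" | "i = j + 1" | "i = j + 2" | "i \<ge> j + 3" using ji(1) by linarith
  then show ?thesis
  proof cases
    case 1
    then have "W = D" using card_seteq[OF finD WF(2)] i j by simp
    then show ?thesis using not_all gcomm_in_derived xG unfolding D by fastforce
  next
    case 2
    then have c: "card D = p * card W" using ji(2) by simp
    then have "W \<subset> D" using WF(2) W0 p1 by (intro psubsetI) auto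
    then obtain L where L: "L \<lhd> G" "W \<subseteq> L" "L \<subset> D" "card D = p * card L"
      "\<forall>b\<in>D. \<forall>h\<in>carrier G. gcomm G b h \<in> L"
      using ex_chief_below[OF WN D.normal_axioms] by blast
    have "card L = card W" using L(4) c p1 by simp
    then have "W = L" using card_seteq[of L W] L(2,3) finD finite_subset[of L D] by auto
    then show ?thesis using not_all L(5) xG by blast
  next
    case 4
    have "card D div card W = p ^ (i - j)" using ji(2) W0 by simp
    moreover have "p ^ 3 \<le> p ^ (i - j)" using 4 p1 by (intro power_increasing) auto
    ultimately show ?thesis using card_ge[OF WN WF(2)] cover unfolding W_def by fastforce
  next
    case 3
    then have c: "card D = p * (p * card W)" using ji(2) by (simp add: power2_eq_square)
    then have WD: "W \<subset> D" using WF(2) W0 p1 by (intro psubsetI) auto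
    then obtain R where R: "R \<lhd> G" "W \<subseteq> R" "R \<subset> D" "card D = p * card R"
      and RD: "\<And>b h. b \<in> D \<Longrightarrow> h \<in> carrier G \<Longrightarrow> gcomm G b h \<in> R"
      using ex_chief_below[OF WN D.normal_axioms] by blast
    have cR: "card R = p * card W" using R(4) c p1 by simp
    have finR: "finite R" using R(3) finD finite_subset by blast
    have "W \<subset> R" using R(2) cR W0 p1 by (intro psubsetI) auto
    \<comment> \<open>By its order \<open>L'\<close> is \<open>W\<close>; its purpose is that all
      commutators of \<open>R\<close> with G lie in \<open>W\<close>.\<close>
    then obtain L' where L': "L' \<lhd> G" "W \<subseteq> L'" "L' \<subset> R" "card R = p * card L'"
      and RL': "\<And>b h. b \<in> R \<Longrightarrow> h \<in> carrier G \<Longrightarrow> gcomm G b h \<in> L'"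
      using ex_chief_below[OF WN R(1)] by blast
    have "card L' = card W" using L'(4) cR p1 by simp
    then have "L' = W" using card_seteq[of L' W] L'(2,3) finR finite_subset[of L' R] by auto
    then have RW: "\<And>r h. r \<in> R \<Longrightarrow> h \<in> carrier G \<Longrightarrow> gcomm G r h \<in> W" using RL' by blast
    show ?thesis
    proof (cases "W = {\<one>}")
      case True
      have "D \<subseteq> ?C"
      proof
        fix h assume h: "h \<in> D"
        then obtain n where n: "n \<in> ?N" "gcomm G n x \<otimes> inv h = \<one>" using cover True unfolding W_def by auto
        then have "gcomm G n x = h" using h xG by (metis D.mem_carrier N.mem_carrier gcomm_closed inv_closed inv_equality inv_inv)
        then show "h \<in> ?C" using n(1) by blast
      qed
      then show ?thesis using CD by (metis subset_antisym)
    next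
      case False
      then have "{\<one>} \<subset> W" using W.one_closed by blast
      then obtain L where L: "L \<lhd> G" "L \<subset> W" "card W = p * card L"
        and LW: "\<And>b h. b \<in> W \<Longrightarrow> h \<in> carrier G \<Longrightarrow> gcomm G b h \<in> L" and Lp: "\<And>b. b \<in> W \<Longrightarrow> b [^] p \<in> L"
        using ex_chief_below[OF one_is_normal WN] by blast
      interpret L: normal L G by fact
      obtain Q :: "'a set monoid" and \<rho> where hom: "group_hom G Q \<rho>"
        and ker: "\<And>g. g \<in> carrier G \<Longrightarrow> \<rho> g = \<one>\<^bsub>Q\<^esub> \<longleftrightarrow> g \<in> L"
        and eqQ: "\<And>g h. g \<in> carrier G \<Longrightarrow> h \<in> carrier G \<Longrightarrow> \<rho> g = \<rho> h \<longleftrightarrow> g \<otimes> inv h \<in> L"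
        by (rule normal_quotientE[OF L(1)], rule that)
      interpret \<rho>: group_hom G Q \<rho> using hom .
      \<comment> \<open>Some \<open>h\<close> in \<open>D\<close> is moved by \<open>x\<close>
        modulo \<open>W\<close>, and \<open>c = [a, x]\<close> agrees with it modulo
        \<open>W\<close>. So \<open>d = [c, x]\<close> is outside \<open>W\<close>, and then
        \<open>c\<close> is outside \<open>R\<close>, because commutators of \<open>R\<close> lie in
        \<open>W\<close>.\<close>
      obtain h where h: "h \<in> D" "gcomm G h x \<notin> W" using not_all by blast
      obtain a where a: "a \<in> ?N" "gcomm G a x \<otimes> inv h \<in> W" using cover[OF h(1)] unfolding W_def by blast
      define c where "c = gcomm G a x"
      define d where "d = gcomm G c x"
      have aG: "a \<in> carrier G" and hG: "h \<in> carrier G" using a h by auto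
      have cD: "c \<in> D" unfolding c_def D using gcomm_in_derived aG xG by blast
      have cG: "c \<in> carrier G" using cD by simp
      have dR: "d \<in> R" unfolding d_def using RD[OF cD xG] .
      have dW: "d \<notin> W"
      proof
        assume dW: "d \<in> W"
        obtain P :: "'a set monoid" and \<pi> where hom': "group_hom G P \<pi>"
          and ker': "\<And>g. g \<in> carrier G \<Longrightarrow> \<pi> g = \<one>\<^bsub>P\<^esub> \<longleftrightarrow> g \<in> W"
          and eq': "\<And>g h. g \<in> carrier G \<Longrightarrow> h \<in> carrier G \<Longrightarrow> \<pi> g = \<pi> h \<longleftrightarrow> g \<otimes> inv h \<in> W"
          by (rule normal_quotientE[OF WN], rule that)
        interpret \<pi>: group_hom G P \<pi> using hom' .
        have "\<pi> c = \<pi> h" using eq'[of c h] a(2) cG hG unfolding c_def by simp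
        then have "\<pi> (gcomm G h x) = \<pi> d" unfolding d_def using cG hG xG by (simp add: \<pi>.hom_gcomm)
        then show False using ker'[of d] ker'[of "gcomm G h x"] dW h(2) hG xG cG unfolding d_def by simp
      qed
      have cR': "c \<notin> R" using RW xG dW unfolding d_def by blast
      obtain m where m: "m \<in> ?N" "gcomm G m x \<in> W - L"
        using ex_commutator_in_section[OF odd D W_def xG a(1) c_def d_def R(1,2) _ R(4) cR cR' dR dW RW L(1,2) LW Lp] R(3)
        by blast
      have mG: "m \<in> carrier G" using m by simp
      define w where "w = gcomm G m x"
      have w: "w \<in> W" "w \<notin> L" "w \<in> carrier G" using m mG xG unfolding w_def by auto
      have adj: "adjoin G L w = W"
        using adjoin_eq_of_index_p[OF L(1) W.is_subgroup _ L(3) w(1,2)] L(2) by blast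
      have cenW: "\<rho> v \<otimes>\<^bsub>Q\<^esub> \<rho> g = \<rho> g \<otimes>\<^bsub>Q\<^esub> \<rho> v" if "v \<in> W" "g \<in> carrier G" for v g
        using LW[OF that] ker[of "gcomm G v g"] that \<rho>.hom_gcomm \<rho>.H.gcomm_eq_one_iff by simp
      have mx: "inv\<^bsub>Q\<^esub> \<rho> x \<otimes>\<^bsub>Q\<^esub> \<rho> m \<otimes>\<^bsub>Q\<^esub> \<rho> x = \<rho> m \<otimes>\<^bsub>Q\<^esub> \<rho> w"
        unfolding w_def using mG xG by (simp add: \<rho>.hom_gcomm gcomm_def \<rho>.H.m_assoc)
      \<comment> \<open>Modulo \<open>L\<close> the commutator \<open>w = [m, x]\<close> is central,
        so powers of \<open>m\<close> produce all powers of \<open>w\<close>.\<close>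
      have mpow: "\<rho> (gcomm G (m [^] k) x) = \<rho> w [^]\<^bsub>Q\<^esub> k" for k :: int
      proof -
        have "inv\<^bsub>Q\<^esub> \<rho> x \<otimes>\<^bsub>Q\<^esub> \<rho> m [^]\<^bsub>Q\<^esub> k \<otimes>\<^bsub>Q\<^esub> \<rho> x = (\<rho> m \<otimes>\<^bsub>Q\<^esub> \<rho> w) [^]\<^bsub>Q\<^esub> k"
          using \<rho>.H.int_pow_conjugate[of "inv\<^bsub>Q\<^esub> \<rho> x" "\<rho> m" k] mG xG mx by simp
        also have "\<dots> = \<rho> m [^]\<^bsub>Q\<^esub> k \<otimes>\<^bsub>Q\<^esub> \<rho> w [^]\<^bsub>Q\<^esub> k"
          using \<rho>.H.int_pow_mult_distrib[of "\<rho> m" "\<rho> w" k] cenW[OF w(1) mG] mG w by simp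
        finally show ?thesis using mG xG w
          by (simp add: \<rho>.hom_gcomm gcomm_def \<rho>.H.m_assoc \<rho>.hom_int_pow)
      qed
      have cov: "\<exists>n\<in>?N. gcomm G n x \<otimes> inv g \<in> L" if g: "g \<in> D" for g
      proof -
        obtain n where n: "n \<in> ?N" "gcomm G n x \<otimes> inv g \<in> W" using cover[OF g] unfolding W_def by blast
        have nG: "n \<in> carrier G" and gG: "g \<in> carrier G" using n g by auto
        \<comment> \<open>The defect of the covering modulo \<open>W\<close> is, modulo
          \<open>L\<close>, a power of \<open>w\<close>; multiplying n by the matching power of
          \<open>m\<close> removes it.\<close>
        have "inv (gcomm G n x \<otimes> inv g) \<in> adjoin G L w" using n(2) adj by simp
        then obtain l k where l: "inv (gcomm G n x \<otimes> inv g) = l \<otimes> w [^] (k::int)" "l \<in> L" unfolding adjoin_def by auto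
        then have lw: "inv\<^bsub>Q\<^esub> (\<rho> (gcomm G n x \<otimes> inv g)) = \<rho> w [^]\<^bsub>Q\<^esub> k"
          using \<rho>.hom_inv[of "gcomm G n x \<otimes> inv g"] ker[of l] nG gG xG w by (simp add: \<rho>.hom_int_pow)
        have mk: "m [^] k \<in> ?N" using subgroup_int_pow_closed[OF N.is_subgroup m(1)] .
        have mkW: "\<rho> (gcomm G (m [^] k) x) \<otimes>\<^bsub>Q\<^esub> \<rho> n = \<rho> n \<otimes>\<^bsub>Q\<^esub> \<rho> (gcomm G (m [^] k) x)"
          unfolding mpow using cenW[of "w [^] k" n] subgroup_int_pow_closed[OF W.is_subgroup w(1)] nG w
          by (simp add: \<rho>.hom_int_pow)
        have "\<rho> (gcomm G (m [^] k \<otimes> n) x) = \<rho> (gcomm G (m [^] k) x) \<otimes>\<^bsub>Q\<^esub> \<rho> (gcomm G n x)"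
          using \<rho>.H.gcomm_mult[of "\<rho> (m [^] k)" "\<rho> n" "\<rho> x"] mkW mG nG xG by (simp add: \<rho>.hom_gcomm)
        also have "\<dots> = \<rho> g"
          unfolding mpow lw[symmetric] using nG gG xG by (simp add: \<rho>.H.inv_mult_group \<rho>.H.m_assoc)
        finally have "gcomm G (m [^] k \<otimes> n) x \<otimes> inv g \<in> L"
          using eqQ[of "gcomm G (m [^] k \<otimes> n) x" g] mG nG xG gG by simp
        then show ?thesis using mk n(1) by blast
      qed
      have "card D = p ^ 3 * card L" using c L(3) by (simp add: power3_eq_cube)
      moreover have "card L > 0" using L(3) W0 by (metis gr0I mult_0_right less_irrefl)
      ultimately have "card D div card L = p ^ 3" by simp
      then show ?thesis using card_ge[OF L(1) _ cov] L(2) WF(2) by fastforce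
    qed
  qed
qed

end

section \<open>Counting commuting pairs\<close>

definition commuting_pairs :: "('a, 'b) monoid_scheme \<Rightarrow> nat" where
  "commuting_pairs G = (\<Sum>x\<in>carrier G. card {y \<in> carrier G. y \<otimes>\<^bsub>G\<^esub> x = x \<otimes>\<^bsub>G\<^esub> y})"

lemma (in group) centralizer_subgroup:
  assumes "x \<in> carrier G" "subgroup N G"
  shows "subgroup {n \<in> N. n \<otimes> x = x \<otimes> n} G"
proof -
  have "group_hom G G (\<lambda>g. g)" by (simp add: group_hom_def group_hom_axioms_def hom_def is_group)
  from group_hom.commuting_subgroup[OF this assms(1)]
  have "subgroup (N \<inter> {g \<in> carrier G. g \<otimes> x = x \<otimes> g}) G"
    using assms(2) by (intro subgroups_Inter_pair)
  moreover have "N \<inter> {g \<in> carrier G. g \<otimes> x = x \<otimes> g} = {n \<in> N. n \<otimes> x = x \<otimes> n}"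
    using subgroup.subset[OF assms(2)] by blast
  ultimately show ?thesis by simp
qed

text \<open>\<open>[n, x]\<close> is the conjugate of the inverse of x by n, times x. It therefore
  depends exactly on the right coset of n modulo the centralizer of x in N.\<close>

lemma (in group) card_gcomm_image:
  assumes N: "subgroup N G" and x: "x \<in> carrier G"
  shows "card ((\<lambda>n. gcomm G n x) ` N) * card {n \<in> N. n \<otimes> x = x \<otimes> n} = card N"
proof -
  let ?S = "{n \<in> N. n \<otimes> x = x \<otimes> n}"
  interpret N: group "G\<lparr>carrier := N\<rparr>" using N by (rule subgroup_imp_group)
  have NG: "n \<in> N \<Longrightarrow> n \<in> carrier G" for n using subgroup.subset[OF N] by blast
  have S: "subgroup ?S (G\<lparr>carrier := N\<rparr>)"
    using subgroup_incl[OF centralizer_subgroup[OF x N] N] by blast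
  have "gcomm G g x = gcomm G h x \<longleftrightarrow> g \<otimes> inv h \<in> ?S" if "g \<in> N" "h \<in> N" for g h
  proof -
    have gh: "g \<in> carrier G" "h \<in> carrier G" "g \<otimes> inv h \<in> N" "g \<otimes> inv h \<in> carrier G"
      using that NG N by (auto simp: subgroup.m_closed subgroup.m_inv_closed)
    have "gcomm G g x = gcomm G h x \<longleftrightarrow> inv g \<otimes> inv x \<otimes> g = inv h \<otimes> inv x \<otimes> h"
      unfolding gcomm_def using gh x by simp
    also have "\<dots> \<longleftrightarrow> g \<otimes> inv h \<otimes> inv x = inv x \<otimes> (g \<otimes> inv h)" using gh x by (intro conj_eq_iff) auto
    also have "\<dots> \<longleftrightarrow> (g \<otimes> inv h) \<otimes> x = x \<otimes> (g \<otimes> inv h)"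
      using commute_inv[of x "g \<otimes> inv h"] commute_inv[of "inv x" "g \<otimes> inv h"] gh(4) x by (metis inv_closed inv_inv)
    finally show ?thesis using gh(3) by simp
  qed
  then show ?thesis using N.orbit_card[OF S, of "\<lambda>n. gcomm G n x"] N
    by (simp add: Coset.order_def m_inv_consistent)
qed

lemma sum_card_swap:
  assumes "finite A" "finite B"
  shows "(\<Sum>x\<in>A. card {y \<in> B. P x y}) = (\<Sum>y\<in>B. card {x \<in> A. P x y})"
proof -
  have "card {y \<in> B. P x y} = (\<Sum>y\<in>B. if P x y then 1 else 0)" for x
    using assms(2) by (simp add: sum.If_cases Int_def)
  moreover have "card {x \<in> A. P x y} = (\<Sum>x\<in>A. if P x y then 1 else 0)" for y
    using assms(1) by (simp add: sum.If_cases Int_def)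
  ultimately show ?thesis using sum.swap[of "\<lambda>x y. if P x y then 1 else 0" B A] by simp
qed

context p_group begin

text \<open>The centralizer of x contains x and so exceeds its intersection with N; its index over
  that intersection is at most |G : N| = p.\<close>

lemma card_centralizer_outside:
  assumes N: "N \<lhd> G" and idx: "card (carrier G) = p * card N" and x: "x \<in> carrier G - N"
  shows "card {y \<in> carrier G. y \<otimes> x = x \<otimes> y} = p * card {y \<in> N. y \<otimes> x = x \<otimes> y}"
proof -
  let ?C = "{y \<in> carrier G. y \<otimes> x = x \<otimes> y}" and ?S = "{y \<in> N. y \<otimes> x = x \<otimes> y}"
  have NS: "subgroup N G" using N normal_imp_subgroup by blast
  have xG: "x \<in> carrier G" using x by simp
  have N0: "card N > 0" using subgroup_finite[OF NS] subgroup.one_closed[OF NS] by (metis card_gt_0_iff empty_iff)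
  have C: "subgroup ?C G" by (rule centralizer_subgroup[OF xG subgroup_self])
  have S: "subgroup ?S G" by (rule centralizer_subgroup[OF xG NS])
  have "?S \<subset> ?C" using x subgroup.subset[OF NS] by auto
  then have dvd: "p * card ?S dvd card ?C" by (rule card_subgroup_psubset[OF S C])
  have c1: "card ((\<lambda>g. N #> g) ` ?C) * card ?S = card ?C"
  proof -
    define K where "K = ?C"
    define T where "T = ?S"
    have K: "subgroup K G" using C unfolding K_def .
    have T: "subgroup T (G\<lparr>carrier := K\<rparr>)" unfolding T_def K_def
      using subgroup_incl[OF S C] \<open>?S \<subset> ?C\<close> by blast
    interpret K: group "G\<lparr>carrier := K\<rparr>" using K by (rule subgroup_imp_group)
    have "(N #> g = N #> h) = (g \<otimes> inv h \<in> T)" if gh: "g \<in> K" "h \<in> K" for g h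
    proof -
      have 1: "g \<otimes> inv h \<in> K" by (intro subgroup.m_closed[OF K] subgroup.m_inv_closed[OF K] gh)
      have "g \<in> carrier G" "h \<in> carrier G" using gh subgroup.subset[OF K] by blast+
      then have "(N #> g = N #> h) = (g \<otimes> inv h \<in> N)" by (rule normal_quotient_hom(3)[OF N])
      moreover have "g \<otimes> inv h \<in> T \<longleftrightarrow> g \<otimes> inv h \<in> N" using 1 unfolding T_def K_def by simp
      ultimately show ?thesis by simp
    qed
    then have "card ((\<lambda>g. N #> g) ` K) * card T = card K"
      using K.orbit_card[OF T, of "\<lambda>g. N #> g"] m_inv_consistent[OF K] by (simp add: Coset.order_def)
    then show ?thesis unfolding K_def T_def .
  qed
  have c2: "card ((\<lambda>g. N #> g) ` ?C) \<le> p"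
  proof -
    have "card ((\<lambda>g. N #> g) ` carrier G) * card N = p * card N"
      using normal_card_image[OF N subgroup_self subgroup.subset[OF NS] finite_carrier] idx by simp
    then have "card ((\<lambda>g. N #> g) ` carrier G) = p" using N0 by simp
    then show ?thesis using card_mono[of "(\<lambda>g. N #> g) ` carrier G" "(\<lambda>g. N #> g) ` ?C"] finite_carrier by auto
  qed
  have "card ?C \<le> p * card ?S" by (subst c1[symmetric]) (rule mult_le_mono1[OF c2])
  moreover have "card ?C > 0" using subgroup_finite[OF C] subgroup.one_closed[OF C] by (metis (no_types, lifting) card_gt_0_iff empty_iff)
  ultimately show ?thesis using dvd_imp_le[OF dvd] by simp
qed

text \<open>The second sum counts the commuting pairs with x outside and y inside N. Swapping the
  two coordinates gives as many pairs again, and by \<open>card_centralizer_outside\<close> all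
  pairs with x outside N are p times as many; this accounts for the factor p + 1.\<close>

lemma commuting_pairs_index_p:
  assumes N: "N \<lhd> G" and idx: "card (carrier G) = p * card N"
  shows "commuting_pairs G = (\<Sum>x\<in>N. card {y \<in> N. y \<otimes> x = x \<otimes> y}) +
    (p + 1) * (\<Sum>x\<in>carrier G - N. card {y \<in> N. y \<otimes> x = x \<otimes> y})"
proof -
  have NG: "N \<subseteq> carrier G" using N normal_imp_subgroup subgroup.subset by blast
  have finN: "finite N" using NG finite_carrier finite_subset by blast
  let ?P = "\<Sum>x\<in>carrier G - N. card {y \<in> N. y \<otimes> x = x \<otimes> y}"
  have "commuting_pairs G = (\<Sum>x\<in>N. card {y \<in> carrier G. y \<otimes> x = x \<otimes> y}) +
     (\<Sum>x\<in>carrier G - N. card {y \<in> carrier G. y \<otimes> x = x \<otimes> y})"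
    unfolding commuting_pairs_def using sum.subset_diff[OF NG finite_carrier] by (simp add: add.commute)
  also have "(\<Sum>x\<in>carrier G - N. card {y \<in> carrier G. y \<otimes> x = x \<otimes> y}) = p * ?P"
    using card_centralizer_outside[OF N idx] by (simp add: sum_distrib_left)
  also have "(\<Sum>x\<in>N. card {y \<in> carrier G. y \<otimes> x = x \<otimes> y}) =
    (\<Sum>x\<in>N. card {y \<in> N. y \<otimes> x = x \<otimes> y} + card {y \<in> carrier G - N. y \<otimes> x = x \<otimes> y})"
  proof (rule sum.cong[OF refl])
    fix x assume "x \<in> N"
    have "{y \<in> carrier G. y \<otimes> x = x \<otimes> y} = {y \<in> N. y \<otimes> x = x \<otimes> y} \<union> {y \<in> carrier G - N. y \<otimes> x = x \<otimes> y}"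
      using NG by blast
    then show "card {y \<in> carrier G. y \<otimes> x = x \<otimes> y} =
      card {y \<in> N. y \<otimes> x = x \<otimes> y} + card {y \<in> carrier G - N. y \<otimes> x = x \<otimes> y}"
      using finN finite_carrier by (simp add: card_Un_disjoint disjoint_iff)
  qed
  also have "\<dots> = (\<Sum>x\<in>N. card {y \<in> N. y \<otimes> x = x \<otimes> y}) + (\<Sum>x\<in>N. card {y \<in> carrier G - N. y \<otimes> x = x \<otimes> y})"
    by (rule sum.distrib)
  also have "(\<Sum>x\<in>N. card {y \<in> carrier G - N. y \<otimes> x = x \<otimes> y}) = (\<Sum>y\<in>carrier G - N. card {x \<in> N. y \<otimes> x = x \<otimes> y})"
    using finN finite_carrier by (intro sum_card_swap) auto
  also have "\<dots> = ?P" by (intro sum.cong refl arg_cong[where f = card] Collect_cong) auto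
  finally show ?thesis by (simp add: algebra_simps)
qed

text \<open>With m = |N|, the centre Z of N has at most m/p elements, each commuting with m, and
  every other element commutes with at most m/p. The total is at most m^2 (1/p + 1/p -
  1/p^2).\<close>

lemma commuting_pairs_nonabelian_le:
  assumes N: "subgroup N G" and nc: "\<not> (\<forall>x\<in>N. \<forall>y\<in>N. y \<otimes> x = x \<otimes> y)"
  shows "(\<Sum>x\<in>N. card {y \<in> N. y \<otimes> x = x \<otimes> y}) * p ^ 2 \<le> (2 * p - 1) * card N ^ 2"
proof -
  define m where "m = card N"
  have NG: "N \<subseteq> carrier G" using N subgroup.subset by blast
  have finN: "finite N" using NG finite_carrier finite_subset by blast
  have p0: "p > 0" using prime_gt_0_nat[OF prime_p] .
  have small: "p * card S \<le> m" if "subgroup S G" "S \<subset> N" for S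
  proof -
    have "m > 0" unfolding m_def using finN that by (auto simp: card_gt_0_iff)
    then show ?thesis using card_subgroup_psubset[OF that(1) N that(2)] dvd_imp_le unfolding m_def by blast
  qed
  define Z where "Z = {x \<in> N. \<forall>y\<in>N. y \<otimes> x = x \<otimes> y}"
  have "subgroup Z G"
  proof (rule subgroupI)
    show "Z \<subseteq> carrier G" unfolding Z_def using NG by blast
    have "\<one> \<in> Z" unfolding Z_def using subgroup.one_closed[OF N] NG by auto
    then show "Z \<noteq> {}" by blast
    show "inv a \<in> Z" if "a \<in> Z" for a
      using that subgroup.m_inv_closed[OF N, of a] commute_inv[of a] NG unfolding Z_def by (auto simp: subset_iff)
    show "a \<otimes> b \<in> Z" if "a \<in> Z" "b \<in> Z" for a b
    proof -
      have ab: "a \<in> N" "b \<in> N" "a \<in> carrier G" "b \<in> carrier G" using that NG unfolding Z_def by auto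
      have "y \<otimes> (a \<otimes> b) = (a \<otimes> b) \<otimes> y" if y: "y \<in> N" for y
      proof -
        have yG: "y \<in> carrier G" using y NG by blast
        have ya: "y \<otimes> a = a \<otimes> y" "y \<otimes> b = b \<otimes> y" using \<open>a \<in> Z\<close> \<open>b \<in> Z\<close> y unfolding Z_def by auto
        have "y \<otimes> (a \<otimes> b) = (y \<otimes> a) \<otimes> b" using ab yG by (simp add: m_assoc)
        also have "\<dots> = a \<otimes> (y \<otimes> b)" unfolding ya(1) using ab yG by (simp add: m_assoc)
        finally show ?thesis unfolding ya(2) using ab yG by (simp add: m_assoc)
      qed
      then show ?thesis unfolding Z_def using subgroup.m_closed[OF N ab(1,2)] by blast
    qed
  qed
  moreover have ZN: "Z \<subset> N" using nc unfolding Z_def by blast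
  ultimately have Zm: "p * card Z \<le> m" using small by blast
  have "(\<Sum>x\<in>N. card {y \<in> N. y \<otimes> x = x \<otimes> y}) * p =
    (\<Sum>x\<in>Z. p * card {y \<in> N. y \<otimes> x = x \<otimes> y}) + (\<Sum>x\<in>N - Z. p * card {y \<in> N. y \<otimes> x = x \<otimes> y})"
    using sum.subset_diff[of Z N "\<lambda>x. p * card {y \<in> N. y \<otimes> x = x \<otimes> y}"] ZN finN
    by (simp add: sum_distrib_left mult.commute add.commute psubset_imp_subset)
  also have "\<dots> \<le> (\<Sum>x\<in>Z. p * m) + (\<Sum>x\<in>N - Z. m)"
  proof (intro add_mono sum_mono)
    fix x assume "x \<in> Z"
    show "p * card {y \<in> N. y \<otimes> x = x \<otimes> y} \<le> p * m"
      unfolding m_def using finN by (intro mult_le_mono2 card_mono) auto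
  next
    fix x assume x: "x \<in> N - Z"
    then obtain y where "y \<in> N" "y \<otimes> x \<noteq> x \<otimes> y" unfolding Z_def by blast
    then have "{y \<in> N. y \<otimes> x = x \<otimes> y} \<subset> N" by blast
    then show "p * card {y \<in> N. y \<otimes> x = x \<otimes> y} \<le> m"
      using small centralizer_subgroup[OF _ N, of x] x NG by blast
  qed
  also have "\<dots> = (p * card Z) * m + (m - card Z) * m"
    using ZN finN finite_subset[of Z N] by (simp add: card_Diff_subset m_def mult.assoc psubset_imp_subset)
  finally have "(\<Sum>x\<in>N. card {y \<in> N. y \<otimes> x = x \<otimes> y}) * p * p \<le> ((p * card Z) * m + (m - card Z) * m) * p"
    by (rule mult_le_mono1)
  also have "\<dots> \<le> (2 * p - 1) * m ^ 2"
  proof -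
    have cm: "card Z \<le> m" using ZN card_mono[OF finN] unfolding m_def by blast
    \<comment> \<open>The estimate is rewritten to increase with |Z|, so that \<open>Zm\<close> may
      be inserted without subtraction.\<close>
    have "((p * card Z) * m + (m - card Z) * m) * p = m * (m * p + (p * card Z) * (p - 1))"
    proof -
      obtain r where r: "m = card Z + r" using cm le_Suc_ex by blast
      obtain q where q: "p = Suc q" using p0 by (cases p) auto
      show ?thesis unfolding r q by (simp add: algebra_simps)
    qed
    also have "\<dots> \<le> m * (m * p + m * (p - 1))" using Zm by (intro mult_le_mono2 add_left_mono mult_le_mono1)
    also have "\<dots> = (2 * p - 1) * m ^ 2"
    proof -
      obtain q where q: "p = Suc q" using p0 by (cases p) auto
      show ?thesis unfolding q by (simp add: algebra_simps power2_eq_square)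
    qed
    finally show ?thesis .
  qed
  finally show ?thesis unfolding m_def by (simp add: power2_eq_square mult.assoc)
qed

text \<open>Provides the generators for \<open>commutators_cover_derived\<close>. The element x
  alone cannot generate G: a cyclic G has trivial commutator subgroup, and x would lie in the
  section centralizer.\<close>

lemma section_centralizer_cover:
  assumes dep: "dependent_homs G TYPE('f::field)" and char: "CHAR('f) = p"
    and idx: "card (carrier G) = p * card (section_centralizer G)" and x: "x \<in> carrier G - section_centralizer G"
    and W: "W \<lhd> G" and cen: "\<And>n h. n \<in> section_centralizer G \<Longrightarrow> h \<in> commutator_subgroup G \<Longrightarrow> gcomm G n h \<in> W"
    and h: "h \<in> commutator_subgroup G"
  shows "\<exists>n\<in>section_centralizer G. gcomm G n x \<otimes> inv h \<in> W"
proof -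
  let ?N = "section_centralizer G"
  have N: "?N \<lhd> G" by (rule section_centralizer_normal)
  have xG: "x \<in> carrier G" using x by simp
  have "maximal_subgroup ?N G"
    using maximal_of_index_p[OF normal_imp_subgroup[OF N]] idx by (simp add: Coset.order_def)
  moreover have "generate G {x} \<noteq> carrier G"
  proof
    assume gen: "generate G {x} = carrier G"
    have "gcomm G a b \<in> {\<one>}" if "a \<in> carrier G" "b \<in> carrier G" for a b
      using gcomm_in_of_generators[of x x "{\<one>}" a b] gen xG one_is_normal that gcomm_eq_one_iff[of x x] by simp
    then have "commutator_subgroup G \<subseteq> {\<one>}"
      using derived_least[OF triv_subgroup] by blast
    then have "gcomm G x h \<in> frattini (G\<lparr>carrier := commutator_subgroup G\<rparr>)" if "h \<in> commutator_subgroup G" for h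
      using subgroup_frattini(1)[OF derived_is_subgroup[of "carrier G"]] xG that
      by (auto simp: gcomm_def subgroup.one_closed)
    then show False using x unfolding section_centralizer_alt by blast
  qed
  ultimately obtain y where "y \<in> ?N" "generate G {x, y} = carrier G"
    using ex_second_generator[OF dep char _ x] by blast
  then show ?thesis
    using commutators_cover_derived[OF N W xG _ _ section_centralizer_normal(2) cen h] by blast
qed

text \<open>An abelian N centralizes D, so the covering holds modulo the trivial subgroup: the map
  taking n to \<open>[n, x]\<close> sends N onto D.\<close>

lemma abelian_section_centralizer:
  assumes dep: "dependent_homs G TYPE('f::field)" and char: "CHAR('f) = p"
    and idx: "card (carrier G) = p * card (section_centralizer G)"
    and ab: "\<And>x y. x \<in> section_centralizer G \<Longrightarrow> y \<in> section_centralizer G \<Longrightarrow> y \<otimes> x = x \<otimes> y"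
  shows "\<And>x. x \<in> carrier G - section_centralizer G \<Longrightarrow>
      card {n \<in> section_centralizer G. n \<otimes> x = x \<otimes> n} * card (commutator_subgroup G) = card (section_centralizer G)"
    and "odd p"
proof -
  let ?N = "section_centralizer G" and ?D = "commutator_subgroup G"
  interpret N: normal ?N G by (rule section_centralizer_normal)
  have DN: "?D \<subseteq> ?N" by (rule section_centralizer_normal)
  have cov: "\<exists>n\<in>?N. gcomm G n x = h" if x: "x \<in> carrier G - ?N" and h: "h \<in> ?D" for x h
  proof -
    have "gcomm G n h \<in> {\<one>}" if "n \<in> ?N" "h \<in> ?D" for n h
      using ab[of h n] that DN by (auto simp: gcomm_eq_one_iff)
    then obtain n where n: "n \<in> ?N" "gcomm G n x \<otimes> inv h = \<one>"
      using section_centralizer_cover[OF dep char idx x one_is_normal _ h] by blast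
    have "h \<in> carrier G" "x \<in> carrier G" using subsetD[OF DN h] x by simp_all
    then have "gcomm G n x = h" using n inv_equality[of "gcomm G n x" "inv h"] by simp
    then show ?thesis using n(1) by blast
  qed
  show "card {n \<in> ?N. n \<otimes> x = x \<otimes> n} * card ?D = card ?N" if x: "x \<in> carrier G - ?N" for x
  proof -
    have "(\<lambda>n. gcomm G n x) ` ?N = ?D" using cov[OF x] gcomm_in_derived x by auto
    then show ?thesis using card_gcomm_image[OF N.is_subgroup, of x] x by (simp add: mult.commute)
  qed
  show "odd p"
  proof (rule ccontr)
    assume "\<not> odd p"
    then have p2: "p = 2" using prime_p primes_dvd_imp_eq two_is_prime_nat by blast
    have "card ?N > 0" using subgroup_finite[OF N.is_subgroup] N.one_closed by (metis card_gt_0_iff empty_iff)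
    then have "card (carrier G) \<noteq> card ?N" using idx p2 by simp
    then have "\<not> carrier G \<subseteq> ?N" using N.subset by (metis subset_antisym)
    then obtain x where x: "x \<in> carrier G - ?N" by blast
    have xG: "x \<in> carrier G" using x by simp
    have "maximal_subgroup ?N G"
      using maximal_of_index_p[OF N.is_subgroup] idx by (simp add: Coset.order_def)
    then have xx: "x \<otimes> x \<in> ?N" using maximal_subgroup_facts(2)[OF _ xG] p2 xG by (simp add: numeral_2_eq_2)
    have "gcomm G x h \<in> frattini (G\<lparr>carrier := ?D\<rparr>)" if h: "h \<in> ?D" for h
    proof -
      obtain n where n: "n \<in> ?N" "h = gcomm G n x" using cov[OF x h] by blast
      have nG: "n \<in> carrier G" and hG: "h \<in> carrier G" using n xG by auto
      \<comment> \<open>This is the identity that \<open>[n, x]\<close> times its conjugate by x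
        equals \<open>[n, x^2]\<close>; as x^2 is in the abelian N, the result is trivial.\<close>
      have "h \<otimes> (inv x \<otimes> h \<otimes> x) = inv n \<otimes> inv (x \<otimes> x) \<otimes> (n \<otimes> (x \<otimes> x))"
        unfolding n(2) using nG xG by (simp add: gcomm_def m_assoc inv_mult_group)
      also have "\<dots> = \<one>" unfolding ab[OF xx n(1)] using nG xG by (simp add: m_assoc inv_mult_group)
      finally have "inv (inv x \<otimes> h \<otimes> x) = h"
        using hG xG by (intro inv_equality) simp_all
      then have "inv x \<otimes> h \<otimes> x = inv h" using hG xG by (metis inv_closed inv_inv m_closed)
      then have "inv (inv x \<otimes> h \<otimes> x) \<otimes> h = h \<otimes> h" using hG by simp
      moreover have "inv (inv x \<otimes> h \<otimes> x) \<otimes> h = gcomm G x h" using hG xG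
        by (simp add: gcomm_def inv_mult_group m_assoc)
      moreover have "h \<otimes> h \<in> frattini (G\<lparr>carrier := ?D\<rparr>)"
        using subgroup_frattini(3)[OF derived_is_subgroup[of "carrier G"] h] p2 hG by (simp add: numeral_2_eq_2)
      ultimately show ?thesis by simp
    qed
    then show False using x unfolding section_centralizer_alt by blast
  qed
qed

end

text \<open>Comparing commuting pairs gives m^2 + (p+1) P = A + (p+1) P', where P and P' count over
  the elements outside the section centralizers. A small A on the right must be balanced by a large
  P'. If |D| is at least p^3, all commutator sets in H are too large for this; if it is smaller,
  they have size |D| as in G, so P' = P and A = m^2.\<close>

lemma section_centralizer_abelian_transfer:
  fixes G :: "('g, 'm) monoid_scheme" and H :: "('h, 'n) monoid_scheme"
  assumes G: "p_group G p" and H: "p_group H p" and char: "CHAR('f::field) = p"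
    and dep: "dependent_homs G TYPE('f)" "dependent_homs H TYPE('f)"
    and idx: "card (carrier G) = p * card (section_centralizer G)" "card (carrier H) = p * card (section_centralizer H)"
    and ab: "\<And>x y. x \<in> section_centralizer G \<Longrightarrow> y \<in> section_centralizer G \<Longrightarrow> y \<otimes>\<^bsub>G\<^esub> x = x \<otimes>\<^bsub>G\<^esub> y"
    and card_eq: "card (carrier G) = card (carrier H)"
    and cardD: "card (commutator_subgroup G) = card (commutator_subgroup H)"
    and cp: "commuting_pairs G = commuting_pairs H"
  shows "\<forall>x\<in>section_centralizer H. \<forall>y\<in>section_centralizer H. y \<otimes>\<^bsub>H\<^esub> x = x \<otimes>\<^bsub>H\<^esub> y"
proof (rule ccontr)
  assume nc: "\<not> ?thesis"
  interpret G: p_group G p by fact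
  interpret H: p_group H p by fact
  let ?N = "section_centralizer G" and ?M = "section_centralizer H"
  let ?D = "commutator_subgroup G" and ?E = "commutator_subgroup H"
  interpret N: normal ?N G by (rule G.section_centralizer_normal)
  interpret M: normal ?M H by (rule H.section_centralizer_normal)
  have p1: "p > 1" using prime_gt_1_nat[OF G.prime_p] .
  define m where "m = card ?N"
  define d where "d = card ?D"
  have mM: "card ?M = m" using idx card_eq p1 unfolding m_def by simp
  have m0: "m > 0" unfolding m_def using G.subgroup_finite[OF N.is_subgroup] N.one_closed by (metis card_gt_0_iff empty_iff)
  have odd: "odd p" using G.abelian_section_centralizer(2)[OF dep(1) char idx(1) ab] by simp
  then have p3: "p \<ge> 3" using p1 by (cases "p = 2") auto
  have ES: "subgroup ?E H" using H.derived_is_subgroup by blast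
  have d0: "d > 0" unfolding d_def cardD using H.subgroup_finite[OF ES] subgroup.one_closed[OF ES] by (metis card_gt_0_iff empty_iff)
  define P where "P = (\<Sum>x\<in>carrier G - ?N. card {y \<in> ?N. y \<otimes>\<^bsub>G\<^esub> x = x \<otimes>\<^bsub>G\<^esub> y})"
  define P' where "P' = (\<Sum>x\<in>carrier H - ?M. card {y \<in> ?M. y \<otimes>\<^bsub>H\<^esub> x = x \<otimes>\<^bsub>H\<^esub> y})"
  define A where "A = (\<Sum>x\<in>?M. card {y \<in> ?M. y \<otimes>\<^bsub>H\<^esub> x = x \<otimes>\<^bsub>H\<^esub> y})"
  have "(\<Sum>x\<in>?N. card {y \<in> ?N. y \<otimes>\<^bsub>G\<^esub> x = x \<otimes>\<^bsub>G\<^esub> y}) = (\<Sum>x\<in>?N. m)"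
    unfolding m_def using ab by (intro sum.cong refl arg_cong[where f = card]) auto
  then have eq: "m * m + (p + 1) * P = A + (p + 1) * P'"
    using cp G.commuting_pairs_index_p[OF N.normal_axioms idx(1)] H.commuting_pairs_index_p[OF M.normal_axioms idx(2)]
    unfolding P_def P'_def A_def by (simp add: m_def)
  have A: "A * p ^ 2 \<le> (2 * p - 1) * m ^ 2"
    using H.commuting_pairs_nonabelian_le[OF M.is_subgroup nc] unfolding A_def mM .
  have Pd: "P * d = (p - 1) * m * m"
  proof -
    have "P * d = (\<Sum>x\<in>carrier G - ?N. m)" unfolding P_def sum_distrib_right d_def m_def
      using G.abelian_section_centralizer(1)[OF dep(1) char idx(1) ab] by (intro sum.cong refl) auto
    also have "\<dots> = (p - 1) * m * m" using G.subgroup_finite[OF N.is_subgroup] N.subset idx(1)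
      by (simp add: card_Diff_subset m_def diff_mult_distrib)
    finally show ?thesis .
  qed
  have cardHM: "card (carrier H - ?M) = (p - 1) * m"
    using H.subgroup_finite[OF M.is_subgroup] M.subset idx(2) mM by (simp add: card_Diff_subset diff_mult_distrib)
  have cl: "card ((\<lambda>n. gcomm H n x) ` ?M) = d \<or> p ^ 3 \<le> card ((\<lambda>n. gcomm H n x) ` ?M)"
    if x: "x \<in> carrier H - ?M" for x
    unfolding d_def cardD
  proof (rule H.card_commutators[OF odd refl x])
    fix h assume h: "h \<in> ?E"
    have "gcomm H n h \<in> frattini (H\<lparr>carrier := ?E\<rparr>)" if "n \<in> ?M" "h \<in> ?E" for n h
      using that unfolding H.section_centralizer_alt by simp
    then show "\<exists>n\<in>?M. gcomm H n x \<otimes>\<^bsub>H\<^esub> inv\<^bsub>H\<^esub> h \<in> frattini (H\<lparr>carrier := ?E\<rparr>)"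
      by (rule H.section_centralizer_cover[OF dep(2) char idx(2) x H.frattini_normal[OF H.derived_self_is_normal] _ h])
  qed
  have sz: "card ((\<lambda>n. gcomm H n x) ` ?M) * card {n \<in> ?M. n \<otimes>\<^bsub>H\<^esub> x = x \<otimes>\<^bsub>H\<^esub> n} = m"
    if x: "x \<in> carrier H - ?M" for x
    using H.card_gcomm_image[OF M.is_subgroup, of x] x mM by simp
  have m2: "m ^ 2 = m * m" by (rule power2_eq_square)
  show False
  proof (cases "p ^ 3 \<le> d")
    case True
    then have c3: "p ^ 3 \<le> card ((\<lambda>n. gcomm H n x) ` ?M)" if "x \<in> carrier H - ?M" for x
      using cl[OF that] by auto
    have "P' * p ^ 3 \<le> (\<Sum>x\<in>carrier H - ?M. m)"
      unfolding P'_def sum_distrib_right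
    proof (rule sum_mono)
      fix x assume x: "x \<in> carrier H - ?M"
      show "card {y \<in> ?M. y \<otimes>\<^bsub>H\<^esub> x = x \<otimes>\<^bsub>H\<^esub> y} * p ^ 3 \<le> m"
        using mult_le_mono1[OF c3[OF x], of "card {y \<in> ?M. y \<otimes>\<^bsub>H\<^esub> x = x \<otimes>\<^bsub>H\<^esub> y}"] sz[OF x] by (simp add: mult.commute)
    qed
    then have P': "P' * p ^ 3 \<le> (p - 1) * m * m" using cardHM by simp
    \<comment> \<open>The summand (p+1) P is dropped: m^2 alone already exceeds what H can
      provide.\<close>
    have "m * m * p ^ 3 \<le> (A + (p + 1) * P') * p ^ 3"
      unfolding eq[symmetric] by (intro mult_le_mono1) simp
    also have "\<dots> = p * (A * p ^ 2) + (p + 1) * (P' * p ^ 3)"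
      by (simp add: power2_eq_square power3_eq_cube algebra_simps)
    also have "\<dots> \<le> p * ((2 * p - 1) * m ^ 2) + (p + 1) * ((p - 1) * m * m)"
      using A P' by (intro add_mono mult_le_mono2) auto
    also have "\<dots> = (p * (2 * p - 1) + (p + 1) * (p - 1)) * (m * m)" unfolding m2 by (simp add: algebra_simps)
    \<comment> \<open>Cancelling m^2 leaves p^3 at most 3 p^2 - p - 1, which fails for every p from
      3 on.\<close>
    finally have "p ^ 3 \<le> p * (2 * p - 1) + (p + 1) * (p - 1)" using m0 by (simp add: mult.commute)
    then have "int (p ^ 3) \<le> int (p * (2 * p - 1) + (p + 1) * (p - 1))" by (simp only: of_nat_le_iff)
    also have "\<dots> = 3 * int p ^ 2 - int p - 1"
    proof -
      obtain q where "p = Suc q" using p1 by (cases p) auto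
      then show ?thesis by (simp add: algebra_simps power2_eq_square)
    qed
    finally have "int p ^ 2 * (int p - 3) + int p + 1 \<le> 0" by (simp add: power2_eq_square power3_eq_cube algebra_simps)
    moreover have "int p ^ 2 * (int p - 3) \<ge> 0" using p3 by simp
    ultimately show False using p3 by linarith
  next
    case False
    \<comment> \<open>The commutators lie in a group of order \<open>d\<close> below p^3, which
      excludes the second alternative of \<open>cl\<close>.\<close>
    have cd: "card ((\<lambda>n. gcomm H n x) ` ?M) = d" if x: "x \<in> carrier H - ?M" for x
    proof -
      have "(\<lambda>n. gcomm H n x) ` ?M \<subseteq> ?E" using H.gcomm_in_derived x by auto
      then have "card ((\<lambda>n. gcomm H n x) ` ?M) \<le> d" unfolding d_def cardD
        using card_mono[OF H.subgroup_finite[OF ES]] by blast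
      then show ?thesis using cl[OF x] False by linarith
    qed
    have "P' * d = (\<Sum>x\<in>carrier H - ?M. m)" unfolding P'_def sum_distrib_right
      using sz cd by (intro sum.cong refl) (simp add: mult.commute)
    then have "P' * d = P * d" using cardHM Pd by simp
    then have "A = m * m" using eq d0 by simp
    then have "m * m * p ^ 2 \<le> (2 * p - 1) * (m * m)" using A unfolding m2 by simp
    then have "p ^ 2 \<le> 2 * p - 1" using m0 by (simp add: mult.commute)
    then have "p * p \<le> 2 * p - 1" by (simp add: power2_eq_square)
    moreover have "3 * p \<le> p * p" using p3 by simp
    ultimately show False using p3 by linarith
  qed
qed

section \<open>Group algebras as function spaces\<close>

text \<open>All functions into the field form one ambient vector space with group algebras as
  subspaces, so that spans and dimensions need no carrier.\<close>

definition fscale :: "'f::field \<Rightarrow> ('a \<Rightarrow> 'f) \<Rightarrow> 'a \<Rightarrow> 'f" where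
  "fscale c u = (\<lambda>x. c * u x)"

lemma fscale_apply: "fscale c u x = c * u x" by (simp add: fscale_def)

interpretation fv: vector_space fscale
  by unfold_locales (auto simp: fscale_def algebra_simps)

interpretation fvp: vector_space_pair fscale fscale ..

definition delta :: "'a \<Rightarrow> 'a \<Rightarrow> 'f::field" where
  "delta g = (\<lambda>x. if x = g then 1 else 0)"

lemma delta_apply: "delta g x = (if x = g then 1 else 0)" by (simp add: delta_def)

lemma minus_fun_apply: "(u - v) x = u x - (v x :: 'f::field)" by (simp add: fun_diff_def)

text \<open>As simplification rules the pointwise equations would rewrite inside eta-expanded terms.\<close>

declare plus_fun_apply [simp del] zero_fun_apply [simp del] minus_apply [simp del] uminus_apply [simp del]

lemmas fun_apply = plus_fun_apply zero_fun_apply minus_fun_apply fscale_apply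

lemma sum_fun_apply: "(\<Sum>i\<in>I. u i) x = (\<Sum>i\<in>I. u i x :: 'f::field)"
  by (induction I rule: infinite_finite_induct) (auto simp: fun_apply)

text \<open>Evaluating a linear relation at a point of \<open>I\<close> isolates one
  coefficient.\<close>

lemma independent_of_dual_evaluations:
  fixes b :: "'a \<Rightarrow> 'a \<Rightarrow> 'f::field"
  assumes fin: "finite I" and b: "\<And>g h. g \<in> I \<Longrightarrow> h \<in> I \<Longrightarrow> b g h = (if g = h then 1 else 0)"
  shows "inj_on b I" "fv.independent (b ` I)"
proof -
  show inj: "inj_on b I"
  proof (rule inj_onI)
    fix g h assume gh: "g \<in> I" "h \<in> I" "b g = b h"
    then have "b h g = 1" using b[of g g] by simp
    then show "g = h" using b[OF gh(2,1)] by (metis zero_neq_one)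
  qed
  show "fv.independent (b ` I)"
  proof (rule fv.independent_if_scalars_zero)
    show "finite (b ` I)" using fin by simp
    fix c x assume s: "(\<Sum>x\<in>b ` I. fscale (c x) x) = 0" and "x \<in> b ` I"
    then obtain h where h: "h \<in> I" "x = b h" by blast
    have "0 = (\<Sum>g\<in>I. fscale (c (b g)) (b g)) h"
      using s by (simp add: sum.reindex[OF inj] zero_fun_def)
    also have "\<dots> = (\<Sum>g\<in>I. if g = h then c (b g) else 0)"
      unfolding sum_fun_apply using b[OF _ h(1)] by (intro sum.cong) (auto simp: fun_apply)
    also have "\<dots> = c x" using fin h by simp
    finally show "c x = 0" by simp
  qed
qed

lemma (in vector_space) dim_image_inj:
  assumes "vector_space s'" "Vector_Spaces.linear scale s' f" "subspace S" "inj_on f S"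
  shows "vector_space.dim s' (f ` S) = dim S"
proof -
  interpret V': vector_space s' by fact
  interpret P: vector_space_pair scale s' ..
  obtain B where B: "B \<subseteq> S" "independent B" "S \<subseteq> span B" "card B = dim S" using basis_exists by blast
  have sB: "span B = S" using B(1,3) assms(3) span_minimal by blast
  have "V'.independent (f ` B)"
    using P.linear_independent_injective_image[OF assms(2) B(2)] assms(4) sB by simp
  moreover have "f ` S = V'.span (f ` B)" using P.linear_span_image[OF assms(2), of B] sB by simp
  moreover have "card (f ` B) = card B" using card_image inj_on_subset[OF assms(4) B(1)] by blast
  ultimately show ?thesis using V'.dim_span_eq_card_independent B(4) by metis
qed

text \<open>A basis contained in \<open>B\<close> has as many elements as the dimension, so it
  exhausts \<open>B\<close>.\<close>

lemma (in vector_space) independent_of_card_le_dim: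
  assumes "finite B" "card B \<le> dim (span B)"
  shows "independent B"
proof -
  obtain B' where B': "B' \<subseteq> span B" "independent B'" "card B' = dim (span B)" "span B \<subseteq> span B'"
    using basis_exists by metis
  obtain C where C: "C \<subseteq> B" "independent C" "B \<subseteq> span C"
    using maximal_independent_subset[of B] by blast
  have "span C = span B" using C by (metis span_mono span_span subset_antisym)
  then have "card C = dim (span B)" using C(2) dim_span_eq_card_independent by metis
  then have "C = B" using card_seteq[OF assms(1) C(1)] assms(2) by simp
  then show ?thesis using C(2) by simp
qed

text \<open>The kernel of the linear map from functions on \<open>A\<close> to functions on \<open>f ` A\<close> induced by \<open>f\<close>.\<close>

definition fiber_diffs :: "'a set \<Rightarrow> ('a \<Rightarrow> 'k) \<Rightarrow> ('a \<Rightarrow> 'f::field) set" where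
  "fiber_diffs A f = fv.span {delta g - delta h | g h. g \<in> A \<and> h \<in> A \<and> f g = f h}"

lemma fiber_diffs_subspace: "fv.subspace (fiber_diffs A f)"
  unfolding fiber_diffs_def by simp

lemma fiber_diffsI: "g \<in> A \<Longrightarrow> h \<in> A \<Longrightarrow> f g = f h \<Longrightarrow> delta g - delta h \<in> fiber_diffs A f"
  unfolding fiber_diffs_def by (intro fv.span_base) blast

lemma delta_decomposition:
  assumes "finite A" "\<And>x. x \<notin> A \<Longrightarrow> u x = 0"
  shows "u = (\<Sum>g\<in>A. fscale (u g) (delta g))"
proof
  fix x
  have "(\<Sum>g\<in>A. fscale (u g) (delta g)) x = (\<Sum>g\<in>A. if g = x then u g else 0)"
    unfolding sum_fun_apply by (intro sum.cong) (auto simp: delta_apply fun_apply)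
  also have "\<dots> = u x" using assms by simp
  finally show "u x = (\<Sum>g\<in>A. fscale (u g) (delta g)) x" by simp
qed

text \<open>The map \<open>r\<close> selects one point in each fibre. Every other point contributes
  its difference from the selected one, and evaluation at the unselected points is dual to these
  differences.\<close>

lemma fiber_diffs_basis:
  fixes f :: "'a \<Rightarrow> 'k"
  assumes fin: "finite A" and r: "\<And>g. g \<in> A \<Longrightarrow> r (f g) \<in> A \<and> f (r (f g)) = f g"
  defines "I \<equiv> {g \<in> A. g \<noteq> r (f g)}"
  defines "b \<equiv> (\<lambda>g. delta g - delta (r (f g)) :: 'a \<Rightarrow> 'f::field)"
  shows "inj_on b I" "fv.independent (b ` I)" "card I + card (f ` A) = card A"
proof -
  have e: "b g h = (if g = h then 1 else 0)" if gh: "g \<in> I" "h \<in> I" for g h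
  proof -
    have "h \<noteq> r (f g)"
    proof
      assume h: "h = r (f g)"
      then have "f h = f g" using r[of g] gh(1) unfolding I_def by blast
      then show False using h gh(2) unfolding I_def by simp
    qed
    then show ?thesis unfolding b_def by (simp add: delta_apply fun_apply)
  qed
  have "finite I" unfolding I_def using fin by simp
  note ind = independent_of_dual_evaluations[where b = b, OF this e]
  show "inj_on b I" by (rule ind(1))
  show "fv.independent (b ` I)" by (rule ind(2))
  have "A - I = r ` (f ` A)"
  proof (intro equalityI subsetI)
    fix g assume "g \<in> A - I"
    then show "g \<in> r ` (f ` A)" unfolding I_def by blast
  next
    fix g assume "g \<in> r ` (f ` A)"
    then obtain h where h: "h \<in> A" "g = r (f h)" by blast
    then have "g \<in> A" "f g = f h" using r[OF h(1)] by blast+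
    then show "g \<in> A - I" using h(2) unfolding I_def by simp
  qed
  moreover have "inj_on r (f ` A)"
  proof (rule inj_onI)
    fix y z assume "y \<in> f ` A" "z \<in> f ` A" "r y = r z"
    moreover have "f (r y) = y" if "y \<in> f ` A" for y using that r by blast
    ultimately show "y = z" by metis
  qed
  ultimately have "card (A - I) = card (f ` A)" by (simp add: card_image)
  moreover have "card A = card I + card (A - I)" using fin
    card_Diff_subset[of I A] card_mono[of A I] finite_subset[of I A] by (auto simp: I_def)
  ultimately show "card I + card (f ` A) = card A" by simp
qed

text \<open>This is rank-nullity for summation over the fibres. If all fibre sums of u vanish,
  subtracting the selected point from each delta function in the expansion of u changes nothing,
  because the subtracted terms collect to fibre sums.\<close>

lemma fiber_diffs_iff:
  fixes u :: "'a \<Rightarrow> 'f::field" and f :: "'a \<Rightarrow> 'k"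
  assumes fin: "finite A"
  shows "u \<in> fiber_diffs A f \<longleftrightarrow> (\<forall>x. x \<notin> A \<longrightarrow> u x = 0) \<and> (\<forall>y. (\<Sum>g\<in>{g \<in> A. f g = y}. u g) = 0)"
    (is "_ \<longleftrightarrow> ?P u")
    and "fv.dim (fiber_diffs A f :: ('a \<Rightarrow> 'f) set) + card (f ` A) = card A"
proof -
  let ?S = "{delta g - delta h | g h. g \<in> A \<and> h \<in> A \<and> f g = f h} :: ('a \<Rightarrow> 'f) set"
  define r where "r y = (SOME g. g \<in> A \<and> f g = y)" for y
  have r: "r (f g) \<in> A \<and> f (r (f g)) = f g" if "g \<in> A" for g
    unfolding r_def by (rule someI_ex) (use that in blast)
  define I where "I = {g \<in> A. g \<noteq> r (f g)}"
  define b :: "'a \<Rightarrow> 'a \<Rightarrow> 'f" where "b = (\<lambda>g. delta g - delta (r (f g)))"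
  have sub: "fv.subspace {u. ?P u}"
    by (rule fv.subspaceI) (auto simp: fun_apply sum.distrib sum_distrib_left[symmetric])
  have gen: "?S \<subseteq> {u. ?P u}"
  proof
    fix u assume "u \<in> ?S"
    then obtain g h where gh: "u = delta g - delta h" "g \<in> A" "h \<in> A" "f g = f h" by blast
    have "(\<Sum>x\<in>{x \<in> A. f x = y}. u x) = (if f g = y then 1 else 0) - (if f h = y then 1 else 0)" for y
      unfolding gh(1) using fin gh(2,3) by (simp add: fun_apply sum_subtractf delta_apply)
    then show "u \<in> {u. ?P u}" using gh by (auto simp: delta_apply fun_apply)
  qed
  have 1: "fiber_diffs A f \<subseteq> {u. ?P u}" unfolding fiber_diffs_def using fv.span_minimal[OF gen sub] .
  have bI: "b ` I \<subseteq> fiber_diffs A f" unfolding I_def b_def using r by (auto intro!: fiber_diffsI)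
  have 2: "u \<in> fv.span (b ` I)" if P: "?P u" for u
  proof -
    have "(\<Sum>g\<in>A. fscale (u g) (delta (r (f g)))) = 0"
    proof -
      have "(\<Sum>g\<in>A. fscale (u g) (delta (r (f g)))) =
        (\<Sum>y\<in>f ` A. \<Sum>g\<in>{g \<in> A. f g = y}. fscale (u g) (delta (r (f g))))"
        using fin by (rule sum.image_gen)
      also have "\<dots> = (\<Sum>y\<in>f ` A. fscale (\<Sum>g\<in>{g \<in> A. f g = y}. u g) (delta (r y)))"
        by (intro sum.cong refl) (auto simp: fv.scale_sum_left)
      also have "\<dots> = 0" using P by simp
      finally show ?thesis .
    qed
    then have "u = (\<Sum>g\<in>A. fscale (u g) (b g))"
      using delta_decomposition[OF fin, of u] P
      by (simp add: b_def fv.scale_right_diff_distrib sum_subtractf)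
    also have "\<dots> \<in> fv.span (b ` I)"
    proof (rule fv.span_sum)
      fix g assume "g \<in> A"
      show "fscale (u g) (b g) \<in> fv.span (b ` I)"
      proof (cases "g \<in> I")
        case False
        then have "b g = 0" using \<open>g \<in> A\<close> unfolding I_def b_def by simp
        then show ?thesis by (simp add: fv.span_zero)
      qed (intro fv.span_scale fv.span_base imageI)
    qed
    finally show ?thesis .
  qed
  have span: "fv.span (b ` I) = fiber_diffs A f"
  proof
    show "fv.span (b ` I) \<subseteq> fiber_diffs A f" using fv.span_minimal[OF bI fiber_diffs_subspace] .
    show "fiber_diffs A f \<subseteq> fv.span (b ` I)" using 1 2 by blast
  qed
  show "u \<in> fiber_diffs A f \<longleftrightarrow> ?P u" using 1 2 span by blast
  have "fv.independent (b ` I)"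
    using fiber_diffs_basis(2)[where r = r and f = f, OF fin r] unfolding I_def b_def by simp
  then have "fv.dim (fiber_diffs A f :: ('a \<Rightarrow> 'f) set) = card (b ` I)"
    unfolding span[symmetric] by (rule fv.dim_span_eq_card_independent)
  also have "\<dots> = card I" unfolding I_def b_def
    using card_image[OF fiber_diffs_basis(1)[where r = r and f = f, OF fin r]] by simp
  finally show "fv.dim (fiber_diffs A f :: ('a \<Rightarrow> 'f) set) + card (f ` A) = card A"
    using fiber_diffs_basis(3)[where r = r and f = f, OF fin r] unfolding I_def by simp
qed

text \<open>The sum runs over the whole group rather than the support of the left factor. For finite
  groups this is the same product, and bilinearity becomes immediate.\<close>

definition conv :: "('a, 'b) monoid_scheme \<Rightarrow> ('a \<Rightarrow> 'f::field) \<Rightarrow> ('a \<Rightarrow> 'f) \<Rightarrow> 'a \<Rightarrow> 'f" where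
  "conv G u v = (\<lambda>x. if x \<in> carrier G then \<Sum>y\<in>carrier G. u y * v (inv\<^bsub>G\<^esub> y \<otimes>\<^bsub>G\<^esub> x) else 0)"

definition galg :: "('a, 'b) monoid_scheme \<Rightarrow> ('a \<Rightarrow> 'f::field) set" where
  "galg G = {u. \<forall>x. x \<notin> carrier G \<longrightarrow> u x = 0}"

definition aug :: "('a, 'b) monoid_scheme \<Rightarrow> ('a \<Rightarrow> 'f::field) \<Rightarrow> 'f" where
  "aug G u = (\<Sum>x\<in>carrier G. u x)"

definition sprod :: "('a, 'b) monoid_scheme \<Rightarrow> ('a \<Rightarrow> 'f::field) set \<Rightarrow> ('a \<Rightarrow> 'f) set \<Rightarrow> ('a \<Rightarrow> 'f) set" where
  "sprod G U V = fv.span {conv G u v | u v. u \<in> U \<and> v \<in> V}"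

lemma conv_add_left: "conv G (u + u') v = conv G u v + conv G u' v"
  by (auto simp: conv_def fun_eq_iff fun_apply sum.distrib algebra_simps)
lemma conv_add_right: "conv G u (v + v') = conv G u v + conv G u v'"
  by (auto simp: conv_def fun_eq_iff fun_apply sum.distrib algebra_simps)
lemma conv_diff_left: "conv G (u - u') v = conv G u v - conv G u' v"
  by (auto simp: conv_def fun_eq_iff fun_apply sum_subtractf algebra_simps)
lemma conv_diff_right: "conv G u (v - v') = conv G u v - conv G u v'"
  by (auto simp: conv_def fun_eq_iff fun_apply sum_subtractf algebra_simps)
lemma conv_scale_left: "conv G (fscale c u) v = fscale c (conv G u v)"
  by (auto simp: conv_def fun_eq_iff fun_apply sum_distrib_left algebra_simps)
lemma conv_scale_right: "conv G u (fscale c v) = fscale c (conv G u v)"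
  by (auto simp: conv_def fun_eq_iff fun_apply sum_distrib_left algebra_simps)
lemma conv_zero [simp]: "conv G 0 v = 0" "conv G u 0 = 0"
  by (auto simp: conv_def fun_eq_iff fun_apply)

lemmas conv_linear = conv_add_left conv_add_right conv_diff_left conv_diff_right conv_scale_left conv_scale_right

lemma galg_subspace: "fv.subspace (galg G)"
  by (rule fv.subspaceI) (auto simp: galg_def fun_apply)

lemma conv_in_galg [simp]: "conv G u v \<in> galg G"
  by (simp add: galg_def conv_def)

lemma delta_in_galg [simp]: "g \<in> carrier G \<Longrightarrow> delta g \<in> galg G"
  by (auto simp: galg_def delta_apply)

lemma sprod_subspace: "fv.subspace (sprod G U V)" unfolding sprod_def by simp

lemma sprodI: "u \<in> U \<Longrightarrow> v \<in> V \<Longrightarrow> conv G u v \<in> sprod G U V"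
  unfolding sprod_def by (intro fv.span_base) blast

lemma sprod_minimal:
  assumes "fv.subspace W" "\<And>u v. u \<in> U \<Longrightarrow> v \<in> V \<Longrightarrow> conv G u v \<in> W"
  shows "sprod G U V \<subseteq> W"
  unfolding sprod_def by (rule fv.span_minimal) (use assms in auto)

lemma sprod_in_galg: "sprod G U V \<subseteq> galg G"
  by (rule sprod_minimal[OF galg_subspace]) simp

lemma conv_span_mem:
  assumes W: "fv.subspace W" and u: "u \<in> fv.span S" and v: "v \<in> fv.span T"
    and st: "\<And>s t. s \<in> S \<Longrightarrow> t \<in> T \<Longrightarrow> conv G s t \<in> W"
  shows "conv G u v \<in> W"
proof -
  have "conv G s v \<in> W" if s: "s \<in> S" for s
    using v
  proof (induction v rule: fv.span_induct_alt)
    case base then show ?case using W by (simp add: fv.subspace_0)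
  next
    case (step c x y)
    then show ?case using st[OF s] W by (simp add: conv_linear fv.subspace_add fv.subspace_scale)
  qed
  note sv = this
  show ?thesis using u
  proof (induction u rule: fv.span_induct_alt)
    case base then show ?case using W by (simp add: fv.subspace_0)
  next
    case (step c x y)
    then show ?case using sv W by (simp add: conv_linear fv.subspace_add fv.subspace_scale)
  qed
qed

lemma sprod_span: "sprod G (fv.span S) (fv.span T) = fv.span {conv G s t | s t. s \<in> S \<and> t \<in> T}"
proof
  show "sprod G (fv.span S) (fv.span T) \<subseteq> fv.span {conv G s t | s t. s \<in> S \<and> t \<in> T}"
  proof (rule sprod_minimal[OF fv.subspace_span])
    fix u v assume uv: "u \<in> fv.span S" "v \<in> fv.span T"
    show "conv G u v \<in> fv.span {conv G s t | s t. s \<in> S \<and> t \<in> T}"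
      by (rule conv_span_mem[OF fv.subspace_span uv]) (rule fv.span_base, blast)
  qed
  show "fv.span {conv G s t | s t. s \<in> S \<and> t \<in> T} \<subseteq> sprod G (fv.span S) (fv.span T)"
    by (rule fv.span_minimal[OF _ sprod_subspace]) (use sprodI[OF fv.span_base fv.span_base] in blast)
qed

section \<open>The convolution algebra of a finite group\<close>

context finite_group begin

lemma galg_eq_span: "(galg G :: ('a \<Rightarrow> 'f::field) set) = fv.span (delta ` carrier G)"
proof
  show "(galg G :: ('a \<Rightarrow> 'f) set) \<subseteq> fv.span (delta ` carrier G)"
  proof
    fix u :: "'a \<Rightarrow> 'f" assume "u \<in> galg G"
    then have "u = (\<Sum>g\<in>carrier G. fscale (u g) (delta g))"
      by (intro delta_decomposition[OF finite_carrier]) (auto simp: galg_def)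
    also have "\<dots> \<in> fv.span (delta ` carrier G)"
      by (intro fv.span_sum fv.span_scale fv.span_base imageI)
    finally show "u \<in> fv.span (delta ` carrier G)" .
  qed
  show "fv.span (delta ` carrier G) \<subseteq> (galg G :: ('a \<Rightarrow> 'f) set)"
    by (rule fv.span_minimal[OF _ galg_subspace]) auto
qed

lemma dim_galg: "fv.dim (galg G :: ('a \<Rightarrow> 'f::field) set) = card (carrier G)"
proof -
  have e: "(delta g h :: 'f) = (if g = h then 1 else 0)" for g h :: 'a by (auto simp: delta_apply)
  note I = independent_of_dual_evaluations[where b = "delta :: 'a \<Rightarrow> 'a \<Rightarrow> 'f", OF finite_carrier e]
  show ?thesis unfolding galg_eq_span using fv.dim_span_eq_card_independent[OF I(2)] card_image[OF I(1)] by simp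
qed

lemma galg_induct [consumes 1, case_names delta add scale]:
  assumes "u \<in> galg G" "\<And>g. g \<in> carrier G \<Longrightarrow> P (delta g)"
    "\<And>u v. P u \<Longrightarrow> P v \<Longrightarrow> P (u + v)" "\<And>c u. P u \<Longrightarrow> P (fscale c u)"
  shows "P (u :: 'a \<Rightarrow> 'f::field)"
proof -
  have P0: "P 0" using assms(4)[OF assms(2)[OF one_closed], of 0] by (simp add: fscale_def zero_fun_def)
  have "u \<in> fv.span (delta ` carrier G)" using assms(1) unfolding galg_eq_span .
  then show ?thesis
    by (rule fv.span_induct) (auto intro!: fv.subspaceI P0 assms(2-4))
qed

lemma conv_delta:
  assumes "g \<in> carrier G" "h \<in> carrier G"
  shows "conv G (delta g) (delta h) = (delta (g \<otimes> h) :: 'a \<Rightarrow> 'f::field)"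
proof
  fix x
  have "(\<Sum>y\<in>carrier G. (delta g y :: 'f) * delta h (inv y \<otimes> x)) = (\<Sum>y\<in>carrier G. if y = g then delta h (inv g \<otimes> x) else 0)"
    by (intro sum.cong) (auto simp: delta_apply fun_apply)
  also have "\<dots> = delta h (inv g \<otimes> x)" using assms finite_carrier by simp
  finally have "conv G (delta g) (delta h) x = (if x \<in> carrier G then delta h (inv g \<otimes> x) else (0::'f))"
    by (simp add: conv_def)
  also have "\<dots> = delta (g \<otimes> h) x" using assms by (auto simp: delta_apply inv_solve_left')
  finally show "conv G (delta g) (delta h) x = (delta (g \<otimes> h) x :: 'f)" .
qed

lemma conv_assoc:
  assumes "u \<in> galg G" "v \<in> galg G" "w \<in> galg G"
  shows "conv G (conv G u v) w = conv G u (conv G v w)"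
  using assms(1)
proof (induction u rule: galg_induct)
  case (delta g)
  show ?case using assms(2)
  proof (induction v rule: galg_induct)
    case (delta h)
    show ?case using assms(3)
    proof (induction w rule: galg_induct)
      case (delta k)
      then show ?case using \<open>g \<in> carrier G\<close> \<open>h \<in> carrier G\<close> by (simp add: conv_delta m_assoc)
    qed (simp_all add: conv_linear)
  qed (simp_all add: conv_linear)
qed (simp_all add: conv_linear)

lemma conv_one:
  assumes "u \<in> galg G"
  shows "conv G (delta \<one>) u = u" "conv G u (delta \<one>) = u"
  using assms by (induction u rule: galg_induct) (simp_all add: conv_linear conv_delta)

lemma aug_linear: "aug G (u + v) = aug G u + aug G v" "aug G (fscale c u) = c * aug G u"
  "aug G (u - v) = aug G u - aug G v"
  by (simp_all add: aug_def fun_apply sum.distrib sum_distrib_left sum_subtractf)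

lemma aug_delta: "g \<in> carrier G \<Longrightarrow> aug G (delta g) = 1"
  unfolding aug_def delta_def using finite_carrier by simp

lemma aug_conv:
  assumes "u \<in> galg G" "v \<in> galg G"
  shows "aug G (conv G u v) = aug G u * aug G v"
  using assms(1)
proof (induction u rule: galg_induct)
  case (delta g)
  show ?case using assms(2)
    by (induction v rule: galg_induct)
      (use \<open>g \<in> carrier G\<close> in \<open>simp_all add: conv_delta conv_linear aug_linear aug_delta algebra_simps\<close>)
qed (simp_all add: conv_linear aug_linear algebra_simps)

lemma group_algebra_simps:
  "carrier (group_algebra G) = galg G" "monoid.mult (group_algebra G) = conv G" "one (group_algebra G) = delta \<one>"
  "ring.add (group_algebra G) = (\<lambda>u v. u + v)" "module.smult (group_algebra G) = fscale"
proof -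
  show "carrier (group_algebra G) = galg G"
  proof -
    show ?thesis unfolding group_algebra_def galg_def by (auto intro: finite_subset[OF _ finite_carrier])
  qed
  show "monoid.mult (group_algebra G) = conv G"
    by (auto simp: group_algebra_def conv_def fun_eq_iff intro!: sum.mono_neutral_left finite_carrier)
qed (auto simp: group_algebra_def delta_def fscale_def fun_eq_iff fun_apply)

end

section \<open>Canonical ideals of the group algebra\<close>

text \<open>This and the following sets are built only from product, span and augmentation, so an
  augmentation-preserving isomorphism carries each of them along. Their meaning in terms of
  subgroups is proved separately.\<close>

definition lie_span :: "('a, 'b) monoid_scheme \<Rightarrow> ('a \<Rightarrow> 'f::field) set" where
  "lie_span G = fv.span {conv G u v - conv G v u | u v. u \<in> galg G \<and> v \<in> galg G}"

definition comm_ideal :: "('a, 'b) monoid_scheme \<Rightarrow> ('a \<Rightarrow> 'f::field) set" where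
  "comm_ideal G = sprod G (lie_span G) (galg G)"

definition comm_stab :: "('a, 'b) monoid_scheme \<Rightarrow> ('a \<Rightarrow> 'f::field) set" where
  "comm_stab G = {r \<in> galg G. \<forall>m\<in>comm_ideal G. conv G r m - conv G m r \<in> sprod G (comm_ideal G) (comm_ideal G)}"

definition aug_ideal :: "('a, 'b) monoid_scheme \<Rightarrow> ('a \<Rightarrow> 'f::field) set" where
  "aug_ideal G = {u \<in> galg G. aug G u = 0}"

definition stab_ideal :: "('a, 'b) monoid_scheme \<Rightarrow> ('a \<Rightarrow> 'f::field) set" where
  "stab_ideal G = sprod G (comm_stab G \<inter> aug_ideal G) (galg G)"

primrec stab_ideal_pow :: "('a, 'b) monoid_scheme \<Rightarrow> nat \<Rightarrow> ('a \<Rightarrow> 'f::field) set" where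
  "stab_ideal_pow G 0 = galg G"
| "stab_ideal_pow G (Suc n) = sprod G (stab_ideal_pow G n) (stab_ideal G)"

lemma lie_span_in_galg: "lie_span G \<subseteq> galg G"
  unfolding lie_span_def by (rule fv.span_minimal) (auto intro: galg_subspace fv.subspace_diff[OF galg_subspace])

lemma comm_ideal_in_galg: "comm_ideal G \<subseteq> galg G"
  unfolding comm_ideal_def by (rule sprod_in_galg)

lemma stab_ideal_in_galg: "stab_ideal G \<subseteq> galg G"
  unfolding stab_ideal_def by (rule sprod_in_galg)

lemma stab_ideal_pow_in_galg: "stab_ideal_pow G n \<subseteq> galg G"
  by (cases n) (auto intro: subsetD[OF sprod_in_galg])

lemma stab_ideal_pow_subspace: "fv.subspace (stab_ideal_pow G n)"
  by (cases n) (simp_all add: galg_subspace sprod_subspace)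

text \<open>Linearity is required on all functions, not only on the group algebra, so that results
  on images of spans apply directly.\<close>

locale galg_iso = G: finite_group G + H: finite_group H
  for G :: "('a, 'c) monoid_scheme" and H :: "('b, 'd) monoid_scheme" +
  fixes \<phi> :: "('a \<Rightarrow> 'f::field) \<Rightarrow> 'b \<Rightarrow> 'f"
  assumes lin: "Vector_Spaces.linear fscale fscale \<phi>"
    and image_galg: "\<phi> ` galg G = galg H"
    and inj: "inj_on \<phi> (galg G)"
    and mult: "\<And>u v. u \<in> galg G \<Longrightarrow> v \<in> galg G \<Longrightarrow> \<phi> (conv G u v) = conv H (\<phi> u) (\<phi> v)"
    and aug: "\<And>u. u \<in> galg G \<Longrightarrow> aug H (\<phi> u) = aug G u"
begin

lemma map_diff: "\<phi> (u - v) = \<phi> u - \<phi> v"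
  using fvp.linear_diff[OF lin] .

lemma map_galg: "u \<in> galg G \<Longrightarrow> \<phi> u \<in> galg H" using image_galg by blast

lemma image_span: "\<phi> ` fv.span S = fv.span (\<phi> ` S)"
  using fvp.linear_span_image[OF lin] by simp

lemma image_sprod:
  assumes "U \<subseteq> galg G" "V \<subseteq> galg G"
  shows "\<phi> ` sprod G U V = sprod H (\<phi> ` U) (\<phi> ` V)"
proof -
  have "\<phi> ` {conv G u v | u v. u \<in> U \<and> v \<in> V} = {conv H u v | u v. u \<in> \<phi> ` U \<and> v \<in> \<phi> ` V}" (is "?L = ?R")
  proof (intro equalityI subsetI)
    fix x assume "x \<in> ?L"
    then obtain u v where uv: "x = \<phi> (conv G u v)" "u \<in> U" "v \<in> V" by blast
    then have "x = conv H (\<phi> u) (\<phi> v)" using uv(1) mult[OF subsetD[OF assms(1) uv(2)] subsetD[OF assms(2) uv(3)]] by simp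
    then show "x \<in> ?R" using imageI[OF uv(2), of \<phi>] imageI[OF uv(3), of \<phi>] by blast
  next
    fix x assume "x \<in> ?R"
    then obtain u v where uv: "x = conv H (\<phi> u) (\<phi> v)" "u \<in> U" "v \<in> V" by blast
    then have "x = \<phi> (conv G u v)" using uv(1) mult[OF subsetD[OF assms(1) uv(2)] subsetD[OF assms(2) uv(3)]] by simp
    then show "x \<in> ?L" using uv(2,3) by blast
  qed
  then show ?thesis unfolding sprod_def image_span by simp
qed

lemma image_lie_span: "\<phi> ` lie_span G = lie_span H"
proof -
  have "\<phi> ` {conv G u v - conv G v u | u v. u \<in> galg G \<and> v \<in> galg G} =
    {conv H u v - conv H v u | u v. u \<in> galg H \<and> v \<in> galg H}" (is "?L = ?R")
  proof (intro equalityI subsetI)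
    fix x assume "x \<in> ?L"
    then obtain u v where uv: "x = \<phi> (conv G u v - conv G v u)" "u \<in> galg G" "v \<in> galg G" by blast
    then have "x = conv H (\<phi> u) (\<phi> v) - conv H (\<phi> v) (\<phi> u)" using mult[of u v] mult[of v u] map_diff by simp
    then show "x \<in> ?R" using map_galg[OF uv(2)] map_galg[OF uv(3)] by blast
  next
    fix x assume "x \<in> ?R"
    then obtain u v where uv: "x = conv H (\<phi> u) (\<phi> v) - conv H (\<phi> v) (\<phi> u)" "u \<in> galg G" "v \<in> galg G"
      unfolding image_galg[symmetric] by blast
    then have "x = \<phi> (conv G u v - conv G v u)" using mult[of u v] mult[of v u] map_diff by simp
    then show "x \<in> ?L" using uv by blast
  qed
  then show ?thesis unfolding lie_span_def image_span by simp
qed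

lemma image_comm_ideal: "\<phi> ` comm_ideal G = comm_ideal H"
  unfolding comm_ideal_def using image_sprod[OF lie_span_in_galg order_refl] image_lie_span image_galg by simp

lemma image_mem_iff:
  assumes "S \<subseteq> galg G" "x \<in> galg G"
  shows "\<phi> x \<in> \<phi> ` S \<longleftrightarrow> x \<in> S"
  using inj_on_image_mem_iff[OF inj assms(2,1)] .

lemma image_eq_of_mem_iff:
  assumes "\<And>u. u \<in> galg G \<Longrightarrow> \<phi> u \<in> T \<longleftrightarrow> u \<in> S" "S \<subseteq> galg G" "T \<subseteq> galg H"
  shows "\<phi> ` S = T"
proof (intro equalityI subsetI)
  fix x assume "x \<in> \<phi> ` S"
  then show "x \<in> T" using assms(1,2) by auto
next
  fix x assume x: "x \<in> T"
  then have "x \<in> \<phi> ` galg G" using assms(3) image_galg by auto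
  then obtain u where "u \<in> galg G" "x = \<phi> u" by blast
  then show "x \<in> \<phi> ` S" using assms(1) x by simp
qed

lemma image_comm_stab: "\<phi> ` comm_stab G = comm_stab H"
proof -
  have KK: "\<phi> ` sprod G (comm_ideal G) (comm_ideal G) = sprod H (comm_ideal H) (comm_ideal H)"
    using image_sprod[OF comm_ideal_in_galg comm_ideal_in_galg] image_comm_ideal by simp
  have "\<phi> r \<in> comm_stab H \<longleftrightarrow> r \<in> comm_stab G" if r: "r \<in> galg G" for r
  proof -
    have "conv H (\<phi> r) (\<phi> m) - conv H (\<phi> m) (\<phi> r) \<in> sprod H (comm_ideal H) (comm_ideal H) \<longleftrightarrow>
      conv G r m - conv G m r \<in> sprod G (comm_ideal G) (comm_ideal G)" if "m \<in> comm_ideal G" for m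
    proof -
      have m: "m \<in> galg G" using that comm_ideal_in_galg by blast
      have "conv G r m - conv G m r \<in> galg G" by (rule fv.subspace_diff[OF galg_subspace]) simp_all
      from image_mem_iff[OF sprod_in_galg this] show ?thesis
        unfolding KK[symmetric] using mult[OF r m] mult[OF m r] map_diff by simp
    qed
    then show ?thesis using r map_galg unfolding comm_stab_def image_comm_ideal[symmetric] by auto
  qed
  moreover have "comm_stab G \<subseteq> galg G" "comm_stab H \<subseteq> galg H" unfolding comm_stab_def by blast+
  ultimately show ?thesis using image_eq_of_mem_iff by blast
qed

lemma image_aug_ideal: "\<phi> ` aug_ideal G = aug_ideal H"
proof (rule image_eq_of_mem_iff)
  show "\<phi> u \<in> aug_ideal H \<longleftrightarrow> u \<in> aug_ideal G" if "u \<in> galg G" for u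
    using that aug[OF that] map_galg[OF that] by (simp add: aug_ideal_def)
qed (auto simp: aug_ideal_def)

lemma image_stab_ideal: "\<phi> ` stab_ideal G = stab_ideal H"
proof -
  have sub: "comm_stab G \<subseteq> galg G" "aug_ideal G \<subseteq> galg G" unfolding comm_stab_def aug_ideal_def by blast+
  have "\<phi> ` (comm_stab G \<inter> aug_ideal G) = comm_stab H \<inter> aug_ideal H"
    using inj_on_image_Int[OF inj sub] image_comm_stab image_aug_ideal by simp
  then show ?thesis unfolding stab_ideal_def using image_sprod[of "comm_stab G \<inter> aug_ideal G" "galg G"] sub image_galg
    by auto
qed

lemma image_stab_ideal_pow: "\<phi> ` stab_ideal_pow G n = stab_ideal_pow H n"
proof (induction n)
  case (Suc n)
  then show ?case using image_sprod[OF stab_ideal_pow_in_galg stab_ideal_in_galg] image_stab_ideal by simp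
qed (simp add: image_galg)

lemma dim_image:
  assumes "fv.subspace S" "S \<subseteq> galg G"
  shows "fv.dim (\<phi> ` S) = fv.dim S"
  using fv.dim_image_inj[OF fv.vector_space_axioms lin assms(1) inj_on_subset[OF inj assms(2)]] .

lemma card_eq: "card (carrier G) = card (carrier H)"
  using dim_image[OF galg_subspace order_refl] G.dim_galg[where 'f='f] H.dim_galg[where 'f='f] image_galg by simp

lemma dim_lie_span: "fv.dim (lie_span G :: ('a \<Rightarrow> 'f) set) = fv.dim (lie_span H :: ('b \<Rightarrow> 'f) set)"
  using dim_image[OF _ lie_span_in_galg] image_lie_span by (simp add: lie_span_def)

lemma dim_comm_ideal: "fv.dim (comm_ideal G :: ('a \<Rightarrow> 'f) set) = fv.dim (comm_ideal H :: ('b \<Rightarrow> 'f) set)"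
  using dim_image[OF _ comm_ideal_in_galg] image_comm_ideal by (simp add: comm_ideal_def sprod_subspace)

lemma dim_stab_ideal_pow:
  "fv.dim (stab_ideal_pow G n :: ('a \<Rightarrow> 'f) set) = fv.dim (stab_ideal_pow H n :: ('b \<Rightarrow> 'f) set)"
  using dim_image[OF stab_ideal_pow_subspace stab_ideal_pow_in_galg] image_stab_ideal_pow by metis

lemma dim_stab_ideal: "fv.dim (stab_ideal G :: ('a \<Rightarrow> 'f) set) = fv.dim (stab_ideal H :: ('b \<Rightarrow> 'f) set)"
  using dim_image[OF _ stab_ideal_in_galg] image_stab_ideal by (simp add: stab_ideal_def sprod_subspace)

end

section \<open>From algebra isomorphisms to augmentation-preserving linear maps\<close>

lemma prime_char_pow_eq_one:
  fixes a :: "'f::field"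
  assumes "Factorial_Ring.prime (CHAR('f))" "a ^ (CHAR('f) ^ n) = 1"
  shows "a = 1"
proof -
  have "a ^ (CHAR('f) ^ n) = (1 + (a - 1)) ^ (CHAR('f) ^ n)" by simp
  also have "\<dots> = 1 + (a - 1) ^ (CHAR('f) ^ n)" using freshmans_dream'[OF assms(1), of "CHAR('f) ^ n" n 1 "a - 1"] by simp
  finally show ?thesis using assms(2) by simp
qed

text \<open>An algebra isomorphism preserves the augmentation: composing it with the augmentation of the
  target gives a homomorphism from the \<open>p\<close>-group to the units of \<open>F\<close>, which is trivial.\<close>

lemma galg_iso_of_algebra_isomorphic:
  fixes G :: "('a, 'c) monoid_scheme" and H :: "('b, 'd) monoid_scheme"
  assumes G: "p_group G p" and H: "p_group H p" and char: "CHAR('f::field) = p"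
    and iso: "algebra_isomorphic (group_algebra G :: ('f, 'a \<Rightarrow> 'f) module) (group_algebra H :: ('f, 'b \<Rightarrow> 'f) module)"
  shows "\<exists>\<phi> :: ('a \<Rightarrow> 'f) \<Rightarrow> 'b \<Rightarrow> 'f. galg_iso G H \<phi>"
proof -
  interpret G: p_group G p by fact
  interpret H: p_group H p by fact
  obtain \<psi> where psi: "\<psi> \<in> ring_iso (group_algebra G :: ('f, 'a \<Rightarrow> 'f) module) (group_algebra H :: ('f, 'b \<Rightarrow> 'f) module)"
    "\<forall>c. \<forall>u\<in>carrier (group_algebra G :: ('f, 'a \<Rightarrow> 'f) module).
      \<psi> (c \<odot>\<^bsub>(group_algebra G :: ('f, 'a \<Rightarrow> 'f) module)\<^esub> u) = c \<odot>\<^bsub>(group_algebra H :: ('f, 'b \<Rightarrow> 'f) module)\<^esub> \<psi> u"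
    using iso unfolding algebra_isomorphic_def by blast
  have hom: "\<psi> \<in> ring_hom (group_algebra G :: ('f, 'a \<Rightarrow> 'f) module) (group_algebra H :: ('f, 'b \<Rightarrow> 'f) module)"
    and bij: "bij_betw \<psi> (galg G) (galg H)"
    using psi(1) unfolding ring_iso_def G.group_algebra_simps H.group_algebra_simps by auto
  have add: "\<psi> (u + v) = \<psi> u + \<psi> v" if "u \<in> galg G" "v \<in> galg G" for u v
    using ring_hom_add[OF hom, of u v] that unfolding G.group_algebra_simps H.group_algebra_simps by simp
  have mul: "\<psi> (conv G u v) = conv H (\<psi> u) (\<psi> v)" if "u \<in> galg G" "v \<in> galg G" for u v
    using ring_hom_mult[OF hom, of u v] that unfolding G.group_algebra_simps H.group_algebra_simps by simp
  have one: "\<psi> (delta \<one>\<^bsub>G\<^esub>) = delta \<one>\<^bsub>H\<^esub>"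
    using ring_hom_one[OF hom] unfolding G.group_algebra_simps H.group_algebra_simps by simp
  have sc: "\<psi> (fscale c u) = fscale c (\<psi> u)" if "u \<in> galg G" for c u
    using psi(2) that unfolding G.group_algebra_simps H.group_algebra_simps by simp
  \<comment> \<open>The given isomorphism is controlled on the group algebra only; cutting functions
    off outside the carrier first makes the composite linear everywhere.\<close>
  define res where "res u = (\<lambda>x. if x \<in> carrier G then u x else (0::'f))" for u
  have res: "res u \<in> galg G" for u unfolding res_def galg_def by simp
  have res_id: "u \<in> galg G \<Longrightarrow> res u = u" for u unfolding res_def galg_def by (auto simp: fun_eq_iff)
  define \<phi> where "\<phi> u = \<psi> (res u)" for u
  have phi: "u \<in> galg G \<Longrightarrow> \<phi> u = \<psi> u" for u unfolding \<phi>_def using res_id by simp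
  have lin: "Vector_Spaces.linear fscale fscale \<phi>"
  proof -
    have "res (u + v) = res u + res v" "res (fscale c u) = fscale c (res u)" for u v c
      unfolding res_def by (auto simp: fun_eq_iff fun_apply)
    then have "\<phi> (u + v) = \<phi> u + \<phi> v" "\<phi> (fscale c u) = fscale c (\<phi> u)" for u v c
      unfolding \<phi>_def using add sc res by simp_all
    then show ?thesis
      unfolding Vector_Spaces.linear_def module_hom_def module_hom_axioms_def
      by (auto intro: fv.vector_space_axioms fv.module_axioms)
  qed
  have pim: "\<phi> u \<in> galg H" if "u \<in> galg G" for u using bij phi that by (auto simp: bij_betw_def)
  have m: "\<phi> (conv G u v) = conv H (\<phi> u) (\<phi> v)" if "u \<in> galg G" "v \<in> galg G" for u v
    using mul phi that by simp
  have augd: "aug H (\<phi> (delta g)) = 1" if g: "g \<in> carrier G" for g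
  proof -
    obtain n where n: "\<forall>x\<in>carrier G. x [^]\<^bsub>G\<^esub> (p ^ n) = \<one>\<^bsub>G\<^esub>" using G.exponent by blast
    have "aug H (\<phi> (delta g)) ^ k = aug H (\<phi> (delta (g [^]\<^bsub>G\<^esub> k)))" for k :: nat
    proof (induction k)
      case 0
      then show ?case using one phi[of "delta \<one>\<^bsub>G\<^esub>"] by (simp add: H.aug_delta)
    next
      case (Suc k)
      have "\<phi> (delta (g [^]\<^bsub>G\<^esub> Suc k)) = conv H (\<phi> (delta (g [^]\<^bsub>G\<^esub> k))) (\<phi> (delta g))"
        using m[of "delta (g [^]\<^bsub>G\<^esub> k)" "delta g"] g by (simp add: G.conv_delta)
      then show ?case using Suc H.aug_conv[OF pim pim, of "delta (g [^]\<^bsub>G\<^esub> k)" "delta g"] g by simp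
    qed
    from this[of "p ^ n"] have "aug H (\<phi> (delta g)) ^ (p ^ n) = 1"
      using n g one phi[of "delta \<one>\<^bsub>G\<^esub>"] by (simp add: H.aug_delta)
    then show ?thesis using prime_char_pow_eq_one[of "aug H (\<phi> (delta g))" n] char G.prime_p by simp
  qed
  have "aug H (\<phi> u) = aug G u" if "u \<in> galg G" for u
    using that
  proof (induction u rule: G.galg_induct)
    case (delta g)
    then show ?case using augd G.aug_delta by simp
  next
    case (add u v)
    then show ?case using fvp.linear_add[OF lin] by (simp add: G.aug_linear H.aug_linear)
  next
    case (scale c u)
    then show ?case using fvp.linear_scale[OF lin] by (simp add: G.aug_linear H.aug_linear)
  qed
  moreover have "\<phi> ` galg G = galg H" using bij phi by (auto simp: bij_betw_def image_iff)
  moreover have "inj_on \<phi> (galg G)" using bij phi by (auto simp: bij_betw_def inj_on_def)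
  ultimately have "galg_iso G H \<phi>" using lin m
    by (intro galg_iso.intro galg_iso_axioms.intro) (auto intro: G.finite_group_axioms H.finite_group_axioms)
  then show ?thesis by blast
qed

context finite_group begin

text \<open>The products gh and hg are conjugate. Conversely g and its conjugate by k are the two
  products of k with k^-1 g. By \<open>fiber_diffs_iff\<close> the codimension is therefore the
  number of conjugacy classes.\<close>

lemma lie_span_eq: "lie_span G = (fiber_diffs (carrier G) (\<lambda>g. (\<lambda>h. inv h \<otimes> g \<otimes> h) ` carrier G) :: ('a \<Rightarrow> 'f::field) set)"
proof
  let ?c = "\<lambda>g. (\<lambda>h. inv h \<otimes> g \<otimes> h) ` carrier G"
  have cl: "?c (g \<otimes> h) = ?c (h \<otimes> g)" if gh: "g \<in> carrier G" "h \<in> carrier G" for g h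
  proof -
    have "?c (g \<otimes> h) \<subseteq> ?c (h \<otimes> g)" if "g \<in> carrier G" "h \<in> carrier G" for g h
    proof
      fix x assume "x \<in> ?c (g \<otimes> h)"
      then obtain k where k: "k \<in> carrier G" "x = inv k \<otimes> (g \<otimes> h) \<otimes> k" by blast
      then have "x = inv (inv g \<otimes> k) \<otimes> (h \<otimes> g) \<otimes> (inv g \<otimes> k)" using that by (simp add: m_assoc inv_mult_group)
      then show "x \<in> ?c (h \<otimes> g)" using k that by blast
    qed
    then show ?thesis using gh by blast
  qed
  show "lie_span G \<subseteq> (fiber_diffs (carrier G) ?c :: ('a \<Rightarrow> 'f) set)"
    unfolding lie_span_def
  proof (rule fv.span_minimal[OF _ fiber_diffs_subspace], rule subsetI)
    fix x :: "'a \<Rightarrow> 'f" assume "x \<in> {conv G u v - conv G v u |u v. u \<in> galg G \<and> v \<in> galg G}"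
    then obtain u v where x: "x = conv G u v - conv G v u" "u \<in> galg G" "v \<in> galg G" by blast
    have fd: "fv.subspace (fiber_diffs (carrier G) ?c :: ('a \<Rightarrow> 'f) set)" by (rule fiber_diffs_subspace)
    have e: "(a + b) - (c + d) = (a - c) + (b - d)" for a b c d :: "'a \<Rightarrow> 'f" by (simp add: algebra_simps)
    show "x \<in> fiber_diffs (carrier G) ?c" unfolding x(1) using x(2)
    proof (induction u rule: galg_induct)
      case (delta g)
      show ?case using x(3)
      proof (induction v rule: galg_induct)
        case (delta h)
        note gh = \<open>g \<in> carrier G\<close> delta
        show ?case unfolding conv_delta[OF gh] conv_delta[OF gh(2,1)]
          by (rule fiber_diffsI) (use gh in simp, use gh in simp, rule cl[OF gh])
      qed (auto simp: conv_linear e fv.scale_right_diff_distrib[symmetric] intro: fv.subspace_add[OF fd] fv.subspace_scale[OF fd])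
    qed (auto simp: conv_linear e fv.scale_right_diff_distrib[symmetric] intro: fv.subspace_add[OF fd] fv.subspace_scale[OF fd])
  qed
  show "(fiber_diffs (carrier G) ?c :: ('a \<Rightarrow> 'f) set) \<subseteq> lie_span G"
    unfolding fiber_diffs_def
  proof (rule fv.span_minimal, rule subsetI)
    fix x :: "'a \<Rightarrow> 'f" assume "x \<in> {delta g - delta h |g h. g \<in> carrier G \<and> h \<in> carrier G \<and> ?c g = ?c h}"
    then obtain g h where x: "x = delta g - delta h" "g \<in> carrier G" "h \<in> carrier G" "?c g = ?c h" by blast
    have "h \<in> ?c h" using x(3) by (intro image_eqI[of _ _ \<one>]) auto
    then obtain k where k: "k \<in> carrier G" "h = inv k \<otimes> g \<otimes> k" using x(4) by blast
    let ?u = "delta k :: 'a \<Rightarrow> 'f" and ?v = "delta (inv k \<otimes> g) :: 'a \<Rightarrow> 'f"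
    have "x = conv G ?u ?v - conv G ?v ?u"
      unfolding x(1) using k x(2) by (simp add: conv_delta)
    moreover have "?u \<in> galg G" "?v \<in> galg G" using k x(2) by simp_all
    ultimately show "x \<in> lie_span G" unfolding lie_span_def by (intro fv.span_base) blast
  qed (simp add: lie_span_def)
qed

text \<open>Over one conjugacy class the orders of the centralizers add up to |G|.\<close>

lemma commuting_pairs_eq:
  "commuting_pairs G = card ((\<lambda>g. (\<lambda>h. inv h \<otimes> g \<otimes> h) ` carrier G) ` carrier G) * card (carrier G)"
proof -
  let ?c = "\<lambda>g. (\<lambda>h. inv h \<otimes> g \<otimes> h) ` carrier G"
  have one_mem: "g \<in> ?c g" if "g \<in> carrier G" for g using that by (intro image_eqI[of _ _ \<one>]) auto
  have fiber: "{y \<in> carrier G. ?c y = ?c x} = ?c x" if x: "x \<in> carrier G" for x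
  proof (intro equalityI subsetI)
    fix y assume "y \<in> {y \<in> carrier G. ?c y = ?c x}"
    then show "y \<in> ?c x" using one_mem by blast
  next
    fix y assume "y \<in> ?c x"
    then obtain k where k: "k \<in> carrier G" "y = inv k \<otimes> x \<otimes> k" by blast
    have yG: "y \<in> carrier G" using k x by simp
    have "inv h \<otimes> y \<otimes> h = inv (k \<otimes> h) \<otimes> x \<otimes> (k \<otimes> h)" "inv h \<otimes> x \<otimes> h = inv (inv k \<otimes> h) \<otimes> y \<otimes> (inv k \<otimes> h)"
      if "h \<in> carrier G" for h using k x that by (simp_all add: m_assoc inv_mult_group)
    note conj = this
    have "inv h \<otimes> y \<otimes> h \<in> ?c x" if h: "h \<in> carrier G" for h
      by (subst conj(1)[OF h]) (rule imageI, use k(1) h in simp)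
    moreover have "inv h \<otimes> x \<otimes> h \<in> ?c y" if h: "h \<in> carrier G" for h
      by (subst conj(2)[OF h]) (rule imageI, use k(1) h in simp)
    ultimately have "?c y = ?c x" by blast
    then show "y \<in> {y \<in> carrier G. ?c y = ?c x}" using yG by simp
  qed
  have orb: "card (?c x) * card {y \<in> carrier G. y \<otimes> x = x \<otimes> y} = card (carrier G)" if x: "x \<in> carrier G" for x
    using orbit_card[OF centralizer_subgroup[OF x subgroup_self], of "\<lambda>h. inv h \<otimes> x \<otimes> h"] conj_eq_iff[OF _ x] x
    by (simp add: Coset.order_def)
  have "commuting_pairs G = (\<Sum>C\<in>?c ` carrier G. \<Sum>x\<in>{x \<in> carrier G. ?c x = C}. card {y \<in> carrier G. y \<otimes> x = x \<otimes> y})"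
    unfolding commuting_pairs_def using finite_carrier by (rule sum.image_gen)
  also have "\<dots> = (\<Sum>C\<in>?c ` carrier G. card (carrier G))"
  proof (rule sum.cong[OF refl])
    fix C assume "C \<in> ?c ` carrier G"
    then obtain x0 where x0: "x0 \<in> carrier G" "C = ?c x0" by blast
    have C: "{x \<in> carrier G. ?c x = C} = C" unfolding x0(2) using fiber[OF x0(1)] .
    have cC: "card C * card {y \<in> carrier G. y \<otimes> x = x \<otimes> y} = card (carrier G)" if "x \<in> C" for x
    proof -
      have "x \<in> carrier G" "?c x = C" using that C by blast+
      then show ?thesis using orb[of x] by simp
    qed
    have C0: "card C > 0" using x0 one_mem[OF x0(1)] finite_carrier by (auto simp: card_gt_0_iff)
    have "card {y \<in> carrier G. y \<otimes> x = x \<otimes> y} = card (carrier G) div card C" if "x \<in> C" for x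
      unfolding cC[OF that, symmetric] using C0 by simp
    then have "(\<Sum>x\<in>C. card {y \<in> carrier G. y \<otimes> x = x \<otimes> y}) = card C * (card (carrier G) div card C)" by simp
    also have "\<dots> = card (carrier G)" unfolding orb[OF x0(1), symmetric] x0(2)[symmetric] using C0 by simp
    finally show "(\<Sum>x\<in>{x \<in> carrier G. ?c x = C}. card {y \<in> carrier G. y \<otimes> x = x \<otimes> y}) = card (carrier G)"
      unfolding C .
  qed
  finally show ?thesis by simp
qed

text \<open>The kernel of the map to functions on the right cosets of \<open>M\<close>. For normal
  \<open>M\<close> it is the ideal generated by the augmentation ideal of the group algebra of
  \<open>M\<close>.\<close>

definition nideal :: "'a set \<Rightarrow> ('a \<Rightarrow> 'f::field) set" where
  "nideal M = fiber_diffs (carrier G) (\<lambda>g. M #> g)"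

lemma nideal_subspace: "fv.subspace (nideal M)"
  unfolding nideal_def by (rule fiber_diffs_subspace)

lemma nideal_eq_span:
  assumes M: "subgroup M G"
  shows "(nideal M :: ('a \<Rightarrow> 'f::field) set) = fv.span {delta (c \<otimes> g) - delta g | c g. c \<in> M \<and> g \<in> carrier G}"
proof -
  have MG: "c \<in> M \<Longrightarrow> c \<in> carrier G" for c using subgroup.subset[OF M] by blast
  have "{delta g - delta h | g h. g \<in> carrier G \<and> h \<in> carrier G \<and> M #> g = M #> h} =
    ({delta (c \<otimes> g) - delta g | c g. c \<in> M \<and> g \<in> carrier G} :: ('a \<Rightarrow> 'f) set)" (is "?L = ?R")
  proof (intro equalityI subsetI)
    fix x assume "x \<in> ?L"
    then obtain g h where gh: "x = delta g - delta h" "g \<in> carrier G" "h \<in> carrier G" "M #> g = M #> h" by blast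
    have m: "g \<otimes> inv h \<in> M" using gh(4) subgroup.rcos_module_imp[OF M is_group gh(3)] rcos_self[OF gh(2) M] by simp
    have "x = delta ((g \<otimes> inv h) \<otimes> h) - delta h" unfolding gh(1) using gh(2,3) by (simp add: m_assoc)
    then show "x \<in> ?R" using m gh(3) by blast
  next
    fix x assume "x \<in> ?R"
    then obtain c g where cg: "x = delta (c \<otimes> g) - delta g" "c \<in> M" "g \<in> carrier G" by blast
    have "M #> (c \<otimes> g) = M #> g"
      using coset_mult_assoc[OF subgroup.subset[OF M] MG[OF cg(2)] cg(3)] subgroup.rcos_const[OF M is_group cg(2)] by simp
    then show "x \<in> ?L" using cg MG by blast
  qed
  then show ?thesis unfolding nideal_def fiber_diffs_def by simp
qed

lemma nideal_in_galg: "nideal M \<subseteq> (galg G :: ('a \<Rightarrow> 'f::field) set)"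
  unfolding nideal_def fiber_diffs_def
  by (rule fv.span_minimal[OF _ galg_subspace]) (auto intro!: fv.subspace_diff[OF galg_subspace])

lemma dim_nideal: "fv.dim (nideal M :: ('a \<Rightarrow> 'f::field) set) + card (rcosets M) = card (carrier G)"
proof -
  have "(\<lambda>g. M #> g) ` carrier G = rcosets M" by (auto simp: RCOSETS_def)
  then show ?thesis using fiber_diffs_iff(2)[OF finite_carrier, of "\<lambda>g. M #> g", where 'f='f] unfolding nideal_def by simp
qed

lemma nidealI: "subgroup M G \<Longrightarrow> c \<in> M \<Longrightarrow> g \<in> carrier G \<Longrightarrow> delta (c \<otimes> g) - delta g \<in> nideal M"
  by (simp only: nideal_eq_span, rule fv.span_base) blast

lemma nidealI_one: "subgroup M G \<Longrightarrow> c \<in> M \<Longrightarrow> delta c - delta \<one> \<in> nideal M"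
  by (rule nidealI[of M c \<one>, simplified r_one[OF subsetD[OF subgroup.subset]]]) auto

lemma nideal_ideal:
  fixes u v :: "'a \<Rightarrow> 'f::field"
  assumes M: "M \<lhd> G" and u: "u \<in> nideal M" and v: "v \<in> galg G"
  shows "conv G u v \<in> nideal M" "conv G v u \<in> nideal M"
proof -
  interpret M: normal M G by fact
  have u': "u \<in> fv.span {delta (c \<otimes> g) - delta g | c g. c \<in> M \<and> g \<in> carrier G}"
    using u by (simp add: nideal_eq_span[OF M.is_subgroup])
  have v': "v \<in> fv.span (delta ` carrier G)" using v unfolding galg_eq_span .
  show "conv G u v \<in> nideal M"
  proof (rule conv_span_mem[OF nideal_subspace u' v'])
    fix s t :: "'a \<Rightarrow> 'f" assume "s \<in> {delta (c \<otimes> g) - delta g | c g. c \<in> M \<and> g \<in> carrier G}" "t \<in> delta ` carrier G"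
    then obtain c g h where st: "s = delta (c \<otimes> g) - delta g" "c \<in> M" "g \<in> carrier G" "t = delta h" "h \<in> carrier G" by blast
    have e: "conv G s t = delta (c \<otimes> (g \<otimes> h)) - delta (g \<otimes> h)"
      unfolding st using st by (simp add: conv_linear conv_delta m_assoc)
    show "conv G s t \<in> nideal M" unfolding e by (rule nidealI[OF M.is_subgroup st(2)]) (use st in simp)
  qed
  show "conv G v u \<in> nideal M"
  proof (rule conv_span_mem[OF nideal_subspace v' u'])
    fix t s :: "'a \<Rightarrow> 'f" assume "s \<in> {delta (c \<otimes> g) - delta g | c g. c \<in> M \<and> g \<in> carrier G}" "t \<in> delta ` carrier G"
    then obtain c g h where st: "s = delta (c \<otimes> g) - delta g" "c \<in> M" "g \<in> carrier G" "t = delta h" "h \<in> carrier G" by blast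
    have e: "conv G t s = delta ((h \<otimes> c \<otimes> inv h) \<otimes> (h \<otimes> g)) - delta (h \<otimes> g)"
      unfolding st using st by (simp add: conv_linear conv_delta m_assoc)
    show "conv G t s \<in> nideal M" unfolding e
      by (rule nidealI[OF M.is_subgroup M.inv_op_closed2[OF st(5,2)]]) (use st in simp)
  qed
qed

text \<open>Conjugate elements differ by a factor in D, which gives one inclusion. For the other,
  (a^-1 b^-1 - b^-1 a^-1) a b g equals \<open>[a, b] g - g\<close>, so every commutator acts
  trivially modulo the ideal.\<close>

lemma comm_ideal_eq: "comm_ideal G = (nideal (commutator_subgroup G) :: ('a \<Rightarrow> 'f::field) set)"
proof
  let ?D = "commutator_subgroup G"
  interpret D: normal ?D G by (rule derived_self_is_normal)
  have sub: "lie_span G \<subseteq> (nideal ?D :: ('a \<Rightarrow> 'f) set)"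
    unfolding lie_span_eq fiber_diffs_def
  proof (rule fv.span_minimal[OF _ nideal_subspace], rule subsetI)
    let ?c = "\<lambda>g. (\<lambda>h. inv h \<otimes> g \<otimes> h) ` carrier G"
    fix x :: "'a \<Rightarrow> 'f" assume "x \<in> {delta g - delta h |g h. g \<in> carrier G \<and> h \<in> carrier G \<and> ?c g = ?c h}"
    then obtain g h where x: "x = delta g - delta h" "g \<in> carrier G" "h \<in> carrier G" "?c g = ?c h" by blast
    have "g \<in> ?c g" using x(2) by (intro image_eqI[of _ _ \<one>]) auto
    then obtain k where k: "k \<in> carrier G" "g = inv k \<otimes> h \<otimes> k" using x(4) by blast
    have g: "g = gcomm G k (inv h) \<otimes> h" unfolding k(2) gcomm_def using k(1) x(3) by (simp add: m_assoc)
    show "x \<in> nideal ?D" unfolding x(1)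
      by (subst g) (rule nidealI[OF D.is_subgroup gcomm_in_derived[OF k(1) inv_closed[OF x(3)]] x(3)])
  qed
  show "comm_ideal G \<subseteq> (nideal ?D :: ('a \<Rightarrow> 'f) set)"
    unfolding comm_ideal_def
    by (rule sprod_minimal[OF nideal_subspace]) (use sub nideal_ideal(1)[OF derived_self_is_normal] in blast)
  \<comment> \<open>The elements acting trivially from the left modulo the ideal; as a subgroup
    containing all commutators, \<open>C\<close> contains D.\<close>
  define C where "C = {c \<in> carrier G. \<forall>g\<in>carrier G. delta (c \<otimes> g) - delta g \<in> (comm_ideal G :: ('a \<Rightarrow> 'f) set)}"
  have K: "fv.subspace (comm_ideal G :: ('a \<Rightarrow> 'f) set)" unfolding comm_ideal_def by (rule sprod_subspace)
  have CS: "subgroup C G"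
  proof (rule subgroupI)
    show "C \<subseteq> carrier G" unfolding C_def by blast
    have "\<one> \<in> C" unfolding C_def using fv.subspace_0[OF K] by simp
    then show "C \<noteq> {}" by blast
    fix a assume a: "a \<in> C"
    then have aG: "a \<in> carrier G" unfolding C_def by simp
    have "delta (inv a \<otimes> g) - delta g \<in> (comm_ideal G :: ('a \<Rightarrow> 'f) set)" if g: "g \<in> carrier G" for g
    proof -
      have "delta (a \<otimes> (inv a \<otimes> g)) - delta (inv a \<otimes> g) \<in> (comm_ideal G :: ('a \<Rightarrow> 'f) set)"
        using a aG g unfolding C_def by blast
      from fv.subspace_neg[OF K this] show ?thesis using aG g by simp
    qed
    then show "inv a \<in> C" using aG unfolding C_def by simp
    fix b assume b: "b \<in> C"
    then have bG: "b \<in> carrier G" unfolding C_def by simp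
    have "delta (a \<otimes> b \<otimes> g) - delta g \<in> (comm_ideal G :: ('a \<Rightarrow> 'f) set)" if g: "g \<in> carrier G" for g
    proof -
      have "delta (a \<otimes> (b \<otimes> g)) - delta (b \<otimes> g) \<in> (comm_ideal G :: ('a \<Rightarrow> 'f) set)"
        "delta (b \<otimes> g) - delta g \<in> (comm_ideal G :: ('a \<Rightarrow> 'f) set)"
        using a b bG g unfolding C_def by blast+
      from fv.subspace_add[OF K this] show ?thesis using aG bG g by (simp add: m_assoc)
    qed
    then show "a \<otimes> b \<in> C" using aG bG unfolding C_def by simp
  qed
  have "gcomm G a b \<in> C" if ab: "a \<in> carrier G" "b \<in> carrier G" for a b
  proof -
    have "delta (gcomm G a b \<otimes> g) - delta g \<in> (comm_ideal G :: ('a \<Rightarrow> 'f) set)" if g: "g \<in> carrier G" for g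
    proof -
      let ?u = "delta (inv a) :: 'a \<Rightarrow> 'f" and ?v = "delta (inv b) :: 'a \<Rightarrow> 'f" and ?w = "delta (a \<otimes> b \<otimes> g) :: 'a \<Rightarrow> 'f"
      have "conv G ?u ?v - conv G ?v ?u \<in> lie_span G"
        unfolding lie_span_def
        by (intro fv.span_base CollectI exI[of _ ?u] exI[of _ ?v] conjI refl delta_in_galg inv_closed ab)
      then have "conv G (conv G ?u ?v - conv G ?v ?u) ?w \<in> comm_ideal G"
        unfolding comm_ideal_def using ab g by (intro sprodI) auto
      moreover have "conv G (conv G ?u ?v - conv G ?v ?u) ?w = delta (gcomm G a b \<otimes> g) - delta g"
        using ab g by (simp add: conv_linear conv_delta gcomm_def m_assoc)
      ultimately show ?thesis by simp
    qed
    then show ?thesis using ab unfolding C_def by simp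
  qed
  then have DC: "?D \<subseteq> C" by (rule derived_least[OF CS])
  show "(nideal ?D :: ('a \<Rightarrow> 'f) set) \<subseteq> comm_ideal G"
    unfolding nideal_eq_span[OF D.is_subgroup]
    by (rule fv.span_minimal[OF _ K]) (use DC in \<open>auto simp: C_def\<close>)
qed

end

primrec cpow :: "('a, 'b) monoid_scheme \<Rightarrow> ('a \<Rightarrow> 'f::field) \<Rightarrow> nat \<Rightarrow> 'a \<Rightarrow> 'f" where
  "cpow G u 0 = delta \<one>\<^bsub>G\<^esub>"
| "cpow G u (Suc n) = conv G u (cpow G u n)"

section \<open>Powers of s - 1, and generators of the augmentation ideal modulo its square\<close>

context finite_group begin

lemma cpow_in_galg [simp]: "cpow G u n \<in> galg G"
  by (cases n) auto

text \<open>Evaluation of polynomials at a group element transports the freshman's dream to the group algebra.\<close>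

lemma cpow_delta_diff:
  assumes s: "s \<in> carrier G" and p: "Factorial_Ring.prime (CHAR('f::field))"
  shows "cpow G (delta s - delta \<one>) (CHAR('f) ^ e) = (delta (s [^] (CHAR('f) ^ e)) - delta \<one> :: 'a \<Rightarrow> 'f)"
proof -
  \<comment> \<open>Horner evaluation at \<open>delta s\<close>. Only its additivity and its
    behaviour under multiplication by X and X - 1 are established.\<close>
  define ev :: "'f poly \<Rightarrow> 'a \<Rightarrow> 'f"
    where "ev q = fold_coeffs (\<lambda>a u. fscale a (delta \<one>) + conv G (delta s) u) q 0" for q
  have ev0: "ev 0 = 0" unfolding ev_def by simp
  have evp: "ev (pCons a q) = fscale a (delta \<one>) + conv G (delta s) (ev q)" for a q
    unfolding ev_def by (cases "q = 0 \<and> a = 0") (auto simp: fold_coeffs_pCons_eq)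
  have evg: "ev q \<in> galg G" for q
    by (induction q) (auto simp: ev0 evp galg_subspace fv.subspace_0
      intro!: fv.subspace_add[OF galg_subspace] fv.subspace_scale[OF galg_subspace])
  have eva: "ev (q + r) = ev q + ev r" for q r
    by (induction q r rule: poly_induct2)
      (simp_all add: ev0 evp conv_linear fv.scale_left_distrib algebra_simps)
  have evd: "ev (q - r) = ev q - ev r" for q r
    using eva[of "q - r" r] by (simp add: algebra_simps)
  have evX: "ev ([:-1, 1:] * q) = conv G (delta s - delta \<one>) (ev q)" for q
  proof -
    have "[:-1, 1:] * q = pCons 0 q - q" by simp
    then show ?thesis using conv_one(1)[OF evg] by (simp only: evd evp) (simp add: conv_linear)
  qed
  have 1: "ev ([:-1, 1:] ^ n) = cpow G (delta s - delta \<one>) n" for n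
  proof (induction n)
    case 0
    show ?case using evp[of 1 0] by (simp add: ev0 one_pCons)
  next
    case (Suc n)
    then show ?case using evX[of "[:-1, 1:] ^ n"] by simp
  qed
  have 2: "ev (monom 1 n) = delta (s [^] n)" for n
  proof (induction n)
    case 0
    show ?case using evp[of 1 0] by (simp add: ev0 monom_0)
  next
    case (Suc n)
    have "ev (monom 1 (Suc n)) = conv G (delta s) (ev (monom 1 n))" by (simp add: monom_Suc evp)
    also have "\<dots> = delta (s [^] Suc n)"
      unfolding Suc using s conv_delta[of s "s [^] n"] nat_pow_Suc2[OF s] by simp
    finally show ?case .
  qed
  have "Factorial_Ring.prime (CHAR('f poly))" using p by simp
  then have "([:-1, 1:] + 1) ^ (CHAR('f) ^ e) = [:-1, 1:] ^ (CHAR('f) ^ e) + (1 :: 'f poly)"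
    using freshmans_dream'[of "CHAR('f) ^ e" e "[:-1, 1:]" "1 :: 'f poly"] by simp
  moreover have "[:-1, 1:] + 1 = (monom 1 1 :: 'f poly)" by (simp add: monom_Suc monom_0 one_pCons)
  moreover have "monom 1 1 ^ n = (monom 1 n :: 'f poly)" for n by (simp add: monom_power)
  ultimately have "[:-1, 1:] ^ (CHAR('f) ^ e) = monom 1 (CHAR('f) ^ e) - (1 :: 'f poly)" by (simp add: algebra_simps)
  then have "cpow G (delta s - delta \<one>) (CHAR('f) ^ e) = ev (monom 1 (CHAR('f) ^ e)) - ev (monom 1 0)"
    unfolding 1[symmetric] evd[symmetric] by simp
  then show ?thesis unfolding 2 by simp
qed

lemma aug_ideal_eq: "aug_ideal G = (nideal (carrier G) :: ('a \<Rightarrow> 'f::field) set)"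
proof -
  have c: "carrier G #> g = carrier G" if "g \<in> carrier G" for g
    using coset_join2[OF that subgroup_self that] .
  have "u \<in> nideal (carrier G) \<longleftrightarrow> u \<in> aug_ideal G" for u :: "'a \<Rightarrow> 'f"
  proof -
    have "(\<Sum>g\<in>{g \<in> carrier G. carrier G #> g = y}. u g) = (if y = carrier G then aug G u else 0)" for y
    proof (cases "y = carrier G")
      case True
      then have "{g \<in> carrier G. carrier G #> g = y} = carrier G" using c by auto
      then show ?thesis using True by (simp add: aug_def)
    next
      case False
      then have "{g \<in> carrier G. carrier G #> g = y} = {}" using c by auto
      then show ?thesis using False by (simp only: sum.empty if_False)
    qed
    then show ?thesis unfolding nideal_def fiber_diffs_iff(1)[OF finite_carrier] aug_ideal_def galg_def by auto
  qed
  then show ?thesis by blast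
qed

text \<open>An additive f extends linearly to a functional that vanishes on the square of the
  augmentation ideal. On the ideal itself it is therefore determined by its values at u and v, and
  three vectors of two values are dependent.\<close>

lemma dependent_homs_of_aug_generators:
  fixes u v :: "'a \<Rightarrow> 'f::field"
  assumes gen: "aug_ideal G \<subseteq> fv.span ({u, v} \<union> sprod G (aug_ideal G) (aug_ideal G))"
  shows "dependent_homs G TYPE('f)"
  unfolding dependent_homs_def
proof (intro allI impI)
  fix f1 f2 f3 :: "'a \<Rightarrow> 'f"
  assume add: "\<forall>f\<in>{f1, f2, f3}. \<forall>x\<in>carrier G. \<forall>y\<in>carrier G. f (x \<otimes> y) = f x + f y"
  define L where "L f w = (\<Sum>x\<in>carrier G. w x * f x)" for f w :: "'a \<Rightarrow> 'f"
  define a where "a f = L f u" for f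
  define b where "b f = L f v" for f
  have "\<exists>c1 c2 c3. (c1, c2, c3) \<noteq> (0, 0, 0) \<and> c1 * a f1 + c2 * a f2 + c3 * a f3 = 0 \<and>
    c1 * b f1 + c2 * b f2 + c3 * b f3 = 0"
  proof -
    \<comment> \<open>The coefficients are the cross product of the two rows of values. If it is
      zero the rows are proportional, and a relation is read off a row that is nonzero in its first
      two entries; if there is none, \<open>f1\<close> alone has both values zero.\<close>
    let ?x = "a f2 * b f3 - a f3 * b f2" and ?y = "a f3 * b f1 - a f1 * b f3" and ?z = "a f1 * b f2 - a f2 * b f1"
    have main: ?thesis if "(c1, c2, c3) \<noteq> (0, 0, 0)" "c1 * a f1 + c2 * a f2 + c3 * a f3 = 0"
      "c1 * b f1 + c2 * b f2 + c3 * b f3 = 0" for c1 c2 c3 using that by blast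
    show ?thesis
    proof (cases "(?x, ?y, ?z) = (0, 0, 0)")
      case False
      then show ?thesis by (rule main[of ?x ?y ?z]) (simp_all add: algebra_simps)
    next
      case True
      then have m: "a f2 * b f3 = a f3 * b f2" "a f3 * b f1 = a f1 * b f3" "a f1 * b f2 = a f2 * b f1" by simp_all
      consider "a f1 \<noteq> 0 \<or> a f2 \<noteq> 0" | "b f1 \<noteq> 0 \<or> b f2 \<noteq> 0" | "a f1 = 0" "a f2 = 0" "b f1 = 0" "b f2 = 0" by blast
      then show ?thesis
      proof cases
        case 1
        then show ?thesis by (intro main[of "- a f2" "a f1" 0]) (auto simp: m algebra_simps)
      next
        case 2
        then show ?thesis by (intro main[of "- b f2" "b f1" 0]) (auto simp: m algebra_simps)
      next
        case 3
        then show ?thesis by (intro main[of 1 0 0]) simp_all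
      qed
    qed
  qed
  then obtain c1 c2 c3 where c: "(c1, c2, c3) \<noteq> (0, 0, 0)" "c1 * a f1 + c2 * a f2 + c3 * a f3 = 0"
    "c1 * b f1 + c2 * b f2 + c3 * b f3 = 0" by blast
  define f where "f x = c1 * f1 x + c2 * f2 x + c3 * f3 x" for x
  have fadd: "f (x \<otimes> y) = f x + f y" if "x \<in> carrier G" "y \<in> carrier G" for x y
    unfolding f_def using add that by (simp add: algebra_simps)
  have f1: "f \<one> = 0" using fadd[of \<one> \<one>] by (metis add_cancel_right_right one_closed r_one)
  have Lf: "L f w = c1 * L f1 w + c2 * L f2 w + c3 * L f3 w" for w
    unfolding L_def f_def by (simp add: algebra_simps sum.distrib sum_distrib_left)
  have Lsub: "fv.subspace {w. L f w = 0}"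
    by (rule fv.subspaceI) (auto simp: L_def fun_apply algebra_simps sum.distrib sum_distrib_left[symmetric])
  have Ld: "L f (delta x) = f x" if "x \<in> carrier G" for x
  proof -
    have "L f (delta x) = (\<Sum>y\<in>carrier G. if y = x then f x else 0)"
      unfolding L_def by (intro sum.cong) (auto simp: delta_apply)
    then show ?thesis using that finite_carrier by simp
  qed
  have Ldiff: "L f (w - w') = L f w - L f w'" for w w'
    unfolding L_def by (simp add: fun_apply algebra_simps sum_subtractf)
  have "sprod G (aug_ideal G) (aug_ideal G) \<subseteq> {w. L f w = 0}"
    unfolding aug_ideal_eq nideal_eq_span[OF subgroup_self] sprod_span
  proof (rule fv.span_minimal[OF _ Lsub], rule subsetI)
    fix x :: "'a \<Rightarrow> 'f"
    let ?S = "{delta (c \<otimes> g) - delta g |c g. c \<in> carrier G \<and> g \<in> carrier G} :: ('a \<Rightarrow> 'f) set"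
    assume "x \<in> {conv G s t |s t. s \<in> ?S \<and> t \<in> ?S}"
    then obtain s t where st: "x = conv G s t" "s \<in> ?S" "t \<in> ?S" by blast
    obtain c g where cg: "s = delta (c \<otimes> g) - delta g" "c \<in> carrier G" "g \<in> carrier G" using st(2) by blast
    obtain d h where dh: "t = delta (d \<otimes> h) - delta h" "d \<in> carrier G" "h \<in> carrier G" using st(3) by blast
    have "L f x = 0" unfolding st(1) cg(1) dh(1) using cg(2,3) dh(2,3)
      by (simp add: conv_linear conv_delta Ldiff Ld fadd)
    then show "x \<in> {w. L f w = 0}" by simp
  qed
  moreover have "L f u = 0" "L f v = 0" using c unfolding a_def b_def Lf by simp_all
  ultimately have all: "aug_ideal G \<subseteq> {w. L f w = 0}"
    using fv.span_minimal[OF _ Lsub, of "{u, v} \<union> sprod G (aug_ideal G) (aug_ideal G)"] gen by blast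
  have "f x = 0" if x: "x \<in> carrier G" for x
  proof -
    have "(delta x - delta \<one> :: 'a \<Rightarrow> 'f) \<in> aug_ideal G"
      unfolding aug_ideal_eq by (rule nidealI_one[OF subgroup_self x])
    then have "L f (delta x - delta \<one>) = 0" using all by blast
    then show ?thesis using x f1 by (simp add: Ldiff Ld)
  qed
  then show "\<exists>c1 c2 c3. (c1, c2, c3) \<noteq> (0, 0, 0) \<and> (\<forall>x\<in>carrier G. c1 * f1 x + c2 * f2 x + c3 * f3 x = 0)"
    using c(1) unfolding f_def by blast
qed

text \<open>From xy - 1 = (x-1) + (y-1) + (x-1)(y-1) it follows that the x with x - 1 in the span
  form a subgroup, and it contains the generators.\<close>

lemma two_generated_aug_ideal:
  assumes "two_generated G"
  shows "\<exists>u v :: 'a \<Rightarrow> 'f::field. u \<in> galg G \<and> v \<in> galg G \<and>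
    aug_ideal G \<subseteq> fv.span ({u, v} \<union> sprod G (aug_ideal G) (aug_ideal G))"
proof -
  obtain a b where ab: "a \<in> carrier G" "b \<in> carrier G" "generate G {a, b} = carrier G"
    using assms unfolding two_generated_def by blast
  let ?A = "aug_ideal G :: ('a \<Rightarrow> 'f) set"
  define u where "u = (delta a - delta \<one> :: 'a \<Rightarrow> 'f)"
  define v where "v = (delta b - delta \<one> :: 'a \<Rightarrow> 'f)"
  define S where "S = fv.span ({u, v} \<union> sprod G ?A ?A)"
  have S: "fv.subspace S" unfolding S_def by simp
  have AA: "sprod G ?A ?A \<subseteq> S" unfolding S_def using fv.span_superset by blast
  have dA: "(delta x - delta \<one> :: 'a \<Rightarrow> 'f) \<in> ?A" if "x \<in> carrier G" for x
    unfolding aug_ideal_eq by (rule nidealI_one[OF subgroup_self that])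
  define C where "C = {x \<in> carrier G. (delta x - delta \<one> :: 'a \<Rightarrow> 'f) \<in> S}"
  have mult: "(delta (x \<otimes> y) - delta \<one> :: 'a \<Rightarrow> 'f) - (delta x - delta \<one>) - (delta y - delta \<one>) \<in> S"
    if "x \<in> carrier G" "y \<in> carrier G" for x y
  proof -
    have "(delta (x \<otimes> y) - delta \<one> :: 'a \<Rightarrow> 'f) - (delta x - delta \<one>) - (delta y - delta \<one>) =
      conv G (delta x - delta \<one>) (delta y - delta \<one>)"
      using that by (simp add: conv_linear conv_delta algebra_simps)
    then show ?thesis using AA sprodI[OF dA[OF that(1)] dA[OF that(2)]] by auto
  qed
  have "subgroup C G"
  proof (rule subgroupI)
    show "C \<subseteq> carrier G" unfolding C_def by blast
    have "\<one> \<in> C" unfolding C_def using fv.subspace_0[OF S] by simp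
    then show "C \<noteq> {}" by blast
    fix x assume x: "x \<in> C"
    then have xG: "x \<in> carrier G" "(delta x - delta \<one> :: 'a \<Rightarrow> 'f) \<in> S" unfolding C_def by auto
    have "fscale (-1) ((delta (x \<otimes> inv x) - delta \<one> :: 'a \<Rightarrow> 'f) - (delta x - delta \<one>) - (delta (inv x) - delta \<one>)) - (delta x - delta \<one>) \<in> S"
      by (rule fv.subspace_diff[OF S fv.subspace_scale[OF S mult] xG(2)]) (use xG in simp_all)
    moreover have "fscale (-1) ((delta (x \<otimes> inv x) - delta \<one> :: 'a \<Rightarrow> 'f) - (delta x - delta \<one>) - (delta (inv x) - delta \<one>)) - (delta x - delta \<one>)
      = delta (inv x) - delta \<one>" using xG by (simp add: fun_eq_iff fun_apply)
    ultimately show "inv x \<in> C" unfolding C_def using xG by simp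
    fix y assume y: "y \<in> C"
    then have yG: "y \<in> carrier G" "(delta y - delta \<one> :: 'a \<Rightarrow> 'f) \<in> S" unfolding C_def by auto
    have "((delta (x \<otimes> y) - delta \<one> :: 'a \<Rightarrow> 'f) - (delta x - delta \<one>) - (delta y - delta \<one>)) + (delta x - delta \<one>) + (delta y - delta \<one>) \<in> S"
      by (rule fv.subspace_add[OF S fv.subspace_add[OF S mult xG(2)] yG(2)]) (use xG yG in simp_all)
    moreover have "((delta (x \<otimes> y) - delta \<one> :: 'a \<Rightarrow> 'f) - (delta x - delta \<one>) - (delta y - delta \<one>)) + (delta x - delta \<one>) + (delta y - delta \<one>)
      = delta (x \<otimes> y) - delta \<one>" by (simp add: fun_eq_iff fun_apply)
    ultimately show "x \<otimes> y \<in> C" unfolding C_def using xG yG by simp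
  qed
  moreover have "{a, b} \<subseteq> C" unfolding C_def S_def u_def v_def using ab by (auto intro!: fv.span_base)
  ultimately have C: "carrier G \<subseteq> C" using generate_subgroup_incl ab(3) by blast
  have "?A \<subseteq> S" unfolding aug_ideal_eq nideal_def fiber_diffs_def
  proof (rule fv.span_minimal[OF _ S], rule subsetI)
    fix x :: "'a \<Rightarrow> 'f" assume "x \<in> {delta g - delta h |g h. g \<in> carrier G \<and> h \<in> carrier G \<and> carrier G #> g = carrier G #> h}"
    then obtain g h where x: "x = delta g - delta h" "g \<in> carrier G" "h \<in> carrier G" by blast
    have dS: "(delta g - delta \<one> :: 'a \<Rightarrow> 'f) \<in> S" if "g \<in> carrier G" for g
      using subsetD[OF C that] unfolding C_def by simp
    have "(delta g - delta \<one>) - (delta h - delta \<one>) \<in> S"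
      by (rule fv.subspace_diff[OF S dS[OF x(2)] dS[OF x(3)]])
    then show "x \<in> S" unfolding x(1) by simp
  qed
  moreover have "u \<in> galg G" "v \<in> galg G" unfolding u_def v_def using ab
    by (auto intro!: fv.subspace_diff[OF galg_subspace])
  ultimately show ?thesis unfolding S_def by blast
qed

end

text \<open>Generators of the group need not be mapped to group elements, but two generators of the
  augmentation ideal modulo its square are mapped to such generators.\<close>

lemma (in galg_iso) dependent_homs_transfer:
  assumes "two_generated G"
  shows "dependent_homs G TYPE('f)" "dependent_homs H TYPE('f)"
proof -
  obtain u v :: "'a \<Rightarrow> 'f" where uv: "u \<in> galg G" "v \<in> galg G"
    "aug_ideal G \<subseteq> fv.span ({u, v} \<union> sprod G (aug_ideal G) (aug_ideal G))"
    using G.two_generated_aug_ideal[OF assms] by blast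
  then show "dependent_homs G TYPE('f)" by (intro G.dependent_homs_of_aug_generators)
  have A: "aug_ideal G \<subseteq> galg G" unfolding aug_ideal_def by blast
  have "aug_ideal H \<subseteq> \<phi> ` fv.span ({u, v} \<union> sprod G (aug_ideal G) (aug_ideal G))"
    unfolding image_aug_ideal[symmetric] using uv(3) by (rule image_mono)
  also have "\<dots> = fv.span ({\<phi> u, \<phi> v} \<union> sprod H (aug_ideal H) (aug_ideal H))"
    unfolding image_span image_Un image_sprod[OF A A] image_aug_ideal by simp
  finally show "dependent_homs H TYPE('f)" by (rule H.dependent_homs_of_aug_generators)
qed

section \<open>The section centralizer in the group algebra\<close>

lemma commutator_subspace:
  assumes "fv.subspace W"
  shows "fv.subspace {m. conv G u m - conv G m u \<in> W}"
proof (rule fv.subspaceI)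
  show "0 \<in> {m. conv G u m - conv G m u \<in> W}" using fv.subspace_0[OF assms] by simp
  fix x y assume xy: "x \<in> {m. conv G u m - conv G m u \<in> W}" "y \<in> {m. conv G u m - conv G m u \<in> W}"
  have "conv G u (x + y) - conv G (x + y) u = (conv G u x - conv G x u) + (conv G u y - conv G y u)"
    by (simp add: conv_linear algebra_simps)
  then show "x + y \<in> {m. conv G u m - conv G m u \<in> W}" using xy fv.subspace_add[OF assms] by simp
next
  fix c x assume x: "x \<in> {m. conv G u m - conv G m u \<in> W}"
  have "conv G u (fscale c x) - conv G (fscale c x) u = fscale c (conv G u x - conv G x u)"
    by (simp add: conv_linear fv.scale_right_diff_distrib)
  then show "fscale c x \<in> {m. conv G u m - conv G m u \<in> W}" using x fv.subspace_scale[OF assms] by simp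
qed

lemma (in finite_group) r_coset_mem_iff:
  assumes "subgroup M G" "g \<in> carrier G" "t \<in> carrier G"
  shows "M #> g = M #> t \<longleftrightarrow> g \<in> M #> t"
  using assms repr_independence repr_independenceD rcos_self by metis

lemma (in finite_group) sum_r_coset:
  assumes M: "subgroup M G" and t: "t \<in> carrier G"
  shows "(\<Sum>g\<in>{g \<in> carrier G. M #> g = M #> t}. u g) = (\<Sum>h\<in>M. u (h \<otimes> t) :: 'f::field)"
proof -
  have MG: "M \<subseteq> carrier G" using subgroup.subset[OF M] .
  have "{g \<in> carrier G. M #> g = M #> t} = M #> t"
    using r_coset_mem_iff[OF M _ t] r_coset_subset_G[OF MG t] by auto
  also have "\<dots> = (\<lambda>h. h \<otimes> t) ` M" by (auto simp: r_coset_def)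
  finally have e: "{g \<in> carrier G. M #> g = M #> t} = (\<lambda>h. h \<otimes> t) ` M" .
  have "inj_on (\<lambda>h. h \<otimes> t) M" using MG t by (auto intro!: inj_onI simp: subset_iff)
  then show ?thesis unfolding e by (simp add: sum.reindex)
qed

text \<open>A product (cg - g)(dh - h) has four terms whose positions in the coset Dt are cd'k, d'k,
  ck and k, with d' the conjugate of d by g. If k is in D, additivity of \<open>f\<close> cancels
  them; otherwise none of them meets the coset. Such functionals detect elements outside the square
  of the ideal.\<close>

lemma (in finite_group) additive_functional_vanishes:
  fixes f :: "'a \<Rightarrow> 'f::field"
  assumes D: "D \<lhd> G" and f: "\<And>x y. x \<in> D \<Longrightarrow> y \<in> D \<Longrightarrow> f (x \<otimes> y) = f x + f y" and t: "t \<in> carrier G"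
    and w: "w \<in> sprod G (nideal D) (nideal D)"
  shows "(\<Sum>h\<in>D. w (h \<otimes> t) * f h) = 0"
proof -
  interpret D: normal D G by fact
  have finD: "finite D" using finite_subset[OF D.subset finite_carrier] .
  define L where "L w = (\<Sum>h\<in>D. w (h \<otimes> t) * f h)" for w :: "'a \<Rightarrow> 'f"
  have f1: "f \<one> = 0" using f[of \<one> \<one>] by (metis D.one_closed add_cancel_right_right one_closed r_one)
  have Lsub: "fv.subspace {w. L w = 0}"
    by (rule fv.subspaceI) (auto simp: L_def fun_apply algebra_simps sum.distrib sum_distrib_left[symmetric])
  have Ldiff: "L (w - w') = L w - L w'" for w w'
    unfolding L_def by (simp add: fun_apply algebra_simps sum_subtractf)
  have Ld: "L (delta x) = (if x \<otimes> inv t \<in> D then f (x \<otimes> inv t) else 0)" if x: "x \<in> carrier G" for x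
  proof -
    have "h \<otimes> t = x \<longleftrightarrow> h = x \<otimes> inv t" if "h \<in> D" for h
      using that x t by (auto simp: m_assoc)
    then have "L (delta x) = (\<Sum>h\<in>D. if h = x \<otimes> inv t then f (x \<otimes> inv t) else 0)"
      unfolding L_def by (intro sum.cong) (auto simp: delta_apply)
    then show ?thesis using finD by simp
  qed
  have "sprod G (nideal D) (nideal D) \<subseteq> {w. L w = 0}"
    unfolding nideal_eq_span[OF D.is_subgroup] sprod_span
  proof (rule fv.span_minimal[OF _ Lsub], rule subsetI)
    let ?S = "{delta (c \<otimes> g) - delta g |c g. c \<in> D \<and> g \<in> carrier G} :: ('a \<Rightarrow> 'f) set"
    fix x assume "x \<in> {conv G s t |s t. s \<in> ?S \<and> t \<in> ?S}"
    then obtain s s' where st: "x = conv G s s'" "s \<in> ?S" "s' \<in> ?S" by blast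
    obtain c g where cg: "s = delta (c \<otimes> g) - delta g" "c \<in> D" "g \<in> carrier G" using st(2) by blast
    obtain d h where dh: "s' = delta (d \<otimes> h) - delta h" "d \<in> D" "h \<in> carrier G" using st(3) by blast
    define d' where "d' = g \<otimes> d \<otimes> inv g"
    define k where "k = g \<otimes> h \<otimes> inv t"
    have d': "d' \<in> D" unfolding d'_def using D.inv_op_closed2[OF cg(3) dh(2)] .
    have kG: "k \<in> carrier G" unfolding k_def using cg dh t by simp
    have x: "x = (delta (c \<otimes> d' \<otimes> k \<otimes> t) - delta (d' \<otimes> k \<otimes> t)) - (delta (c \<otimes> k \<otimes> t) - delta (k \<otimes> t))"
      unfolding st(1) cg(1) dh(1) d'_def k_def using cg(2,3) dh(2,3) t
      by (simp add: conv_linear conv_delta m_assoc algebra_simps)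
    have cG: "c \<in> carrier G" and d'G: "d' \<in> carrier G" using cg(2) d' by auto
    have cancel: "y \<otimes> t \<otimes> inv t = y" if "y \<in> carrier G" for y using that t by (simp add: m_assoc)
    have mem: "y \<otimes> k \<in> D \<longleftrightarrow> k \<in> D" if "y \<in> D" for y
    proof
      assume "y \<otimes> k \<in> D"
      then have "inv y \<otimes> (y \<otimes> k) \<in> D" by (rule D.m_closed[OF D.m_inv_closed[OF that]])
      then show "k \<in> D" using that kG by simp
    qed (use that in auto)
    have cd: "c \<otimes> d' \<in> D" using cg(2) d' by simp
    have "L x = 0"
    proof (cases "k \<in> D")
      case True
      then show ?thesis unfolding x Ldiff
        using cG d'G kG t cg(2) d' by (simp add: Ld cancel f m_assoc)
    next
      case False
      then show ?thesis unfolding x Ldiff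
        using cG d'G kG t mem[OF cg(2)] mem[OF d'] mem[OF cd] by (simp add: Ld cancel)
    qed
    then show "x \<in> {w. L w = 0}" by simp
  qed
  then show ?thesis using w unfolding L_def by blast
qed

lemma (in finite_group) conv_comm_ideal_square:
  fixes s v :: "'a \<Rightarrow> 'f::field"
  assumes s: "s \<in> sprod G (comm_ideal G) (comm_ideal G)" and v: "v \<in> galg G"
  shows "conv G s v \<in> sprod G (comm_ideal G) (comm_ideal G)"
proof (rule conv_span_mem[OF sprod_subspace s[unfolded sprod_def] fv.span_base[of v "{v}"]])
  fix a b :: "'a \<Rightarrow> 'f" assume ab: "a \<in> {conv G u v |u v. u \<in> comm_ideal G \<and> v \<in> comm_ideal G}" "b \<in> {v}"
  then obtain u u' where u: "a = conv G u u'" "u \<in> comm_ideal G" "u' \<in> comm_ideal G" by blast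
  have "conv G a b = conv G u (conv G u' v)"
    using conv_assoc[of u u' v] u ab(2) v subsetD[OF comm_ideal_in_galg] by auto
  moreover have "conv G u' v \<in> comm_ideal G" using nideal_ideal(1)[OF derived_self_is_normal _ v] u(3)
    unfolding comm_ideal_eq by blast
  ultimately show "conv G a b \<in> sprod G (comm_ideal G) (comm_ideal G)" using sprodI[OF u(2)] by simp
qed simp

context p_group begin

text \<open>The c in D with c - 1 in the square form a subgroup. It contains p-th powers, since x^p
  - 1 = (x-1)^p with p at least 2, and commutators, since \<open>[x, y] - 1\<close> is the additive
  commutator of x^-1 - 1 and y^-1 - 1 times xy.\<close>

lemma frattini_derived_in_square:
  assumes char: "CHAR('f::field) = p" and w: "w \<in> frattini (G\<lparr>carrier := commutator_subgroup G\<rparr>)"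
  shows "(delta w - delta \<one> :: 'a \<Rightarrow> 'f) \<in> sprod G (comm_ideal G) (comm_ideal G)"
proof -
  let ?D = "commutator_subgroup G"
  let ?K = "comm_ideal G :: ('a \<Rightarrow> 'f) set"
  let ?S = "sprod G ?K ?K"
  interpret D: normal ?D G by (rule derived_self_is_normal)
  have S: "fv.subspace ?S" by (rule sprod_subspace)
  have dK: "(delta c - delta \<one> :: 'a \<Rightarrow> 'f) \<in> ?K" if "c \<in> ?D" for c
    unfolding comm_ideal_eq using nidealI_one[OF D.is_subgroup that] .
  note Sr = conv_comm_ideal_square
  define C where "C = {c \<in> ?D. (delta c - delta \<one> :: 'a \<Rightarrow> 'f) \<in> ?S}"
  have sqS: "conv G (delta x - delta \<one>) (delta y - delta \<one>) \<in> ?S" if "x \<in> ?D" "y \<in> ?D" for x y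
    by (rule sprodI[OF dK[OF that(1)] dK[OF that(2)]])
  have "subgroup C G"
  proof (rule subgroupI)
    show "C \<subseteq> carrier G" unfolding C_def using D.subset by blast
    have "\<one> \<in> C" unfolding C_def using fv.subspace_0[OF S] by simp
    then show "C \<noteq> {}" by blast
    fix a assume a: "a \<in> C"
    then have aD: "a \<in> ?D" "(delta a - delta \<one> :: 'a \<Rightarrow> 'f) \<in> ?S" unfolding C_def by auto
    have "conv G (fscale (-1) (delta a - delta \<one>)) (delta (inv a)) \<in> ?S"
      by (rule Sr[OF fv.subspace_scale[OF S aD(2)]]) (use aD in simp)
    moreover have "conv G (fscale (-1) (delta a - delta \<one>)) (delta (inv a)) = (delta (inv a) - delta \<one> :: 'a \<Rightarrow> 'f)"
      using aD(1) by (simp add: conv_linear conv_delta fun_eq_iff fun_apply)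
    ultimately show "inv a \<in> C" unfolding C_def using aD(1) by simp
    fix b assume b: "b \<in> C"
    then have bD: "b \<in> ?D" "(delta b - delta \<one> :: 'a \<Rightarrow> 'f) \<in> ?S" unfolding C_def by auto
    have "conv G (delta a - delta \<one>) (delta b) + (delta b - delta \<one>) \<in> ?S"
      by (rule fv.subspace_add[OF S Sr[OF aD(2)] bD(2)]) (use bD in simp)
    moreover have "conv G (delta a - delta \<one>) (delta b) + (delta b - delta \<one>) = (delta (a \<otimes> b) - delta \<one> :: 'a \<Rightarrow> 'f)"
      using aD(1) bD(1) by (simp add: conv_linear conv_delta)
    ultimately show "a \<otimes> b \<in> C" unfolding C_def using aD(1) bD(1) by simp
  qed
  moreover have "C \<subseteq> ?D" unfolding C_def by blast
  moreover have "x [^] p \<in> C" if x: "x \<in> ?D" for x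
  proof -
    let ?u = "delta x - delta \<one> :: 'a \<Rightarrow> 'f"
    obtain q where q: "p = Suc (Suc q)" using prime_ge_2_nat[OF prime_p] by (metis add_2_eq_Suc le_Suc_ex)
    have uK: "?u \<in> ?K" using dK[OF x] .
    then have uG: "?u \<in> galg G" using comm_ideal_in_galg by blast
    have "conv G (conv G ?u ?u) (cpow G ?u q) \<in> ?S" using Sr[OF sprodI[OF uK uK]] by simp
    then have "cpow G ?u p \<in> ?S" unfolding q using conv_assoc[OF uG uG] by simp
    moreover have "cpow G ?u p = delta (x [^] p) - delta \<one>"
      using cpow_delta_diff[of x 1, where 'f='f] x char prime_p by simp
    ultimately show ?thesis unfolding C_def using subgroup_int_pow_closed[OF D.is_subgroup x, of "int p"] by (simp add: int_pow_int)
  qed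
  moreover have "gcomm G x y \<in> C" if x: "x \<in> ?D" and y: "y \<in> ?D" for x y
  proof -
    let ?u = "delta (inv x) - delta \<one> :: 'a \<Rightarrow> 'f" and ?v = "delta (inv y) - delta \<one> :: 'a \<Rightarrow> 'f"
    have "conv G (conv G ?u ?v - conv G ?v ?u) (delta (x \<otimes> y)) \<in> ?S"
      by (rule Sr[OF fv.subspace_diff[OF S sqS sqS]]) (use x y in simp_all)
    moreover have "conv G (conv G ?u ?v - conv G ?v ?u) (delta (x \<otimes> y)) = (delta (gcomm G x y) - delta \<one> :: 'a \<Rightarrow> 'f)"
    proof -
      have xG: "x \<in> carrier G" and yG: "y \<in> carrier G" using x y by auto
      have "inv y \<otimes> (inv x \<otimes> (x \<otimes> y)) = \<one>" using xG yG by simp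
      then show ?thesis using xG yG by (simp add: conv_linear conv_delta gcomm_def m_assoc)
    qed
    moreover have "gcomm G x y \<in> ?D" using gcomm_in_derived x y by simp
    ultimately show ?thesis unfolding C_def by simp
  qed
  ultimately have "frattini (G\<lparr>carrier := ?D\<rparr>) \<subseteq> C" by (rule subgroup_frattini(5)[OF D.is_subgroup])
  then show ?thesis using w unfolding C_def by blast
qed

text \<open>Conjugation by n changes an element c of D only by a factor z from the Frattini subgroup
  of D, and z - 1 lies in the square of the ideal.\<close>

lemma delta_in_comm_stab:
  assumes char: "CHAR('f::field) = p" and n: "n \<in> section_centralizer G"
  shows "(delta n :: 'a \<Rightarrow> 'f) \<in> comm_stab G"
proof -
  let ?D = "commutator_subgroup G"
  let ?K = "comm_ideal G :: ('a \<Rightarrow> 'f) set"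
  let ?S = "sprod G ?K ?K"
  interpret D: normal ?D G by (rule derived_self_is_normal)
  interpret N: normal "section_centralizer G" G by (rule section_centralizer_normal)
  have nG: "n \<in> carrier G" using n by simp
  have S: "fv.subspace ?S" by (rule sprod_subspace)
  have dK: "(delta c - delta \<one> :: 'a \<Rightarrow> 'f) \<in> ?K" if "c \<in> ?D" for c
    unfolding comm_ideal_eq using nidealI_one[OF D.is_subgroup that] .
  have K: "fv.subspace ?K" unfolding comm_ideal_def by (rule sprod_subspace)
  note Sr = conv_comm_ideal_square[OF _ delta_in_galg]
  have "?K \<subseteq> {m. conv G (delta n) m - conv G m (delta n) \<in> ?S}"
    unfolding comm_ideal_eq nideal_eq_span[OF D.is_subgroup]
  proof (rule fv.span_minimal, rule subsetI)
    fix m :: "'a \<Rightarrow> 'f" assume "m \<in> {delta (c \<otimes> g) - delta g |c g. c \<in> ?D \<and> g \<in> carrier G}"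
    then obtain c g where m: "m = delta (c \<otimes> g) - delta g" "c \<in> ?D" "g \<in> carrier G" by blast
    have cG: "c \<in> carrier G" using m(2) by simp
    define c' where "c' = n \<otimes> c \<otimes> inv n"
    have c': "c' \<in> ?D" unfolding c'_def using D.inv_op_closed2[OF nG m(2)] .
    have c'G: "c' \<in> carrier G" using c' by simp
    define z where "z = gcomm G (inv n) (inv c)"
    have z: "z = c' \<otimes> inv c" unfolding z_def gcomm_def c'_def using nG cG by simp
    have "z \<in> frattini (G\<lparr>carrier := ?D\<rparr>)"
      using N.m_inv_closed[OF n] D.m_inv_closed[OF m(2)] unfolding section_centralizer_alt z_def by blast
    then have zS: "(delta z - delta \<one> :: 'a \<Rightarrow> 'f) \<in> ?S" by (rule frattini_derived_in_square[OF char])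
    have "(delta (n \<otimes> g) - delta (g \<otimes> n) :: 'a \<Rightarrow> 'f) \<in> ?K"
    proof -
      have "n \<otimes> g = gcomm G (inv n) (inv g) \<otimes> (g \<otimes> n)" using nG m(3) by (simp add: gcomm_def m_assoc)
      then show ?thesis using nidealI[OF D.is_subgroup gcomm_in_derived, of "inv n" "inv g" "g \<otimes> n", where 'c='f] nG m(3)
        unfolding comm_ideal_eq by simp
    qed
    \<comment> \<open>With c' = n c n^-1 and z = c' c^-1, the commutator of n with cg - g is (c' -
      1)(ng - gn) + (z - 1) cgn. The first summand is a product of two elements of the
      ideal.\<close>
    then have "conv G (delta c' - delta \<one>) (delta (n \<otimes> g) - delta (g \<otimes> n)) +
        conv G (delta z - delta \<one>) (delta (c \<otimes> g \<otimes> n)) \<in> ?S"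
      by (intro fv.subspace_add[OF S] sprodI[OF dK[OF c']] Sr[OF zS]) (use cG nG m(3) in simp_all)
    moreover have "conv G (delta c' - delta \<one>) (delta (n \<otimes> g) - delta (g \<otimes> n)) +
        conv G (delta z - delta \<one>) (delta (c \<otimes> g \<otimes> n)) = conv G (delta n) m - conv G m (delta n)"
      unfolding m(1) z c'_def using cG nG m(3)
      by (simp add: conv_linear conv_delta m_assoc algebra_simps)
    ultimately show "m \<in> {m. conv G (delta n) m - conv G m (delta n) \<in> sprod G
        (fv.span {delta (c \<otimes> g) - delta g |c g. c \<in> ?D \<and> g \<in> carrier G})
        (fv.span {delta (c \<otimes> g) - delta g |c g. c \<in> ?D \<and> g \<in> carrier G})}"
      unfolding comm_ideal_eq nideal_eq_span[OF D.is_subgroup] by simp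
  next
    show "fv.subspace {m. conv G (delta n) m - conv G m (delta n) \<in> sprod G
        (fv.span {delta (c \<otimes> g) - delta g |c g. c \<in> ?D \<and> g \<in> carrier G})
        (fv.span {delta (c \<otimes> g) - delta g |c g. c \<in> ?D \<and> g \<in> carrier G})}"
      by (rule commutator_subspace[OF sprod_subspace])
  qed
  then show ?thesis unfolding comm_stab_def using nG by auto
qed

text \<open>As t is not in N, some c in D and its conjugate c' = t c t^-1 are separated by an
  additive f on D. The functional attached to f and Dt vanishes on rc - cr; after a shift of the
  summation index, its value is f c' - f c times the sum of r over Dt.\<close>

lemma comm_stab_coset_sum:
  fixes r :: "'a \<Rightarrow> 'f::field"
  assumes char: "CHAR('f) = p" and r: "r \<in> comm_stab G" and t: "t \<in> carrier G - section_centralizer G"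
  shows "(\<Sum>h\<in>commutator_subgroup G. r (h \<otimes> t)) = 0"
proof -
  let ?D = "commutator_subgroup G"
  let ?W = "frattini (G\<lparr>carrier := ?D\<rparr>)"
  interpret D: normal ?D G by (rule derived_self_is_normal)
  interpret N: normal "section_centralizer G" G by (rule section_centralizer_normal)
  interpret DP: p_group "G\<lparr>carrier := ?D\<rparr>" p using subgroup_p_group[OF D.is_subgroup] .
  have tG: "t \<in> carrier G" using t by simp
  have rG: "r \<in> galg G" using r unfolding comm_stab_def by blast
  have "inv t \<notin> section_centralizer G"
  proof
    assume "inv t \<in> section_centralizer G"
    from N.m_inv_closed[OF this] have "t \<in> section_centralizer G" unfolding inv_inv[OF tG] .
    then show False using t by blast
  qed
  \<comment> \<open>The inverse of t is used because its commutator with c is the inverse of t c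
    t^-1, times c.\<close>
  then obtain c where c: "c \<in> ?D" "gcomm G (inv t) c \<notin> ?W"
    using tG unfolding section_centralizer_alt by auto
  have cG: "c \<in> carrier G" using c by simp
  have gD: "gcomm G (inv t) c \<in> ?D" using gcomm_in_derived tG cG by simp
  then obtain M where M: "maximal_subgroup M (G\<lparr>carrier := ?D\<rparr>)" "gcomm G (inv t) c \<notin> M"
    using c(2) unfolding frattini_def by auto
  obtain f :: "'a \<Rightarrow> 'f" where f: "\<forall>x\<in>?D. \<forall>y\<in>?D. f (x \<otimes> y) = f x + f y" "\<forall>x\<in>?D. f x = 0 \<longleftrightarrow> x \<in> M"
    using DP.ex_additive_hom[OF M(1) char] by auto
  define c' where "c' = t \<otimes> c \<otimes> inv t"
  have c': "c' \<in> ?D" unfolding c'_def using D.inv_op_closed2[OF tG c(1)] .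
  have c'G: "c' \<in> carrier G" using c' by simp
  have "gcomm G (inv t) c \<otimes> inv c = inv c'"
    unfolding gcomm_def c'_def using tG cG by (simp add: m_assoc inv_mult_group)
  then have "gcomm G (inv t) c = inv c' \<otimes> c" using tG cG c'G by (metis gcomm_closed inv_closed inv_inv inv_solve_right m_closed)
  then have "c' \<otimes> gcomm G (inv t) c = c" using cG c'G by simp
  then have "f c = f c' + f (gcomm G (inv t) c)" using f(1) c' gD by metis
  moreover have "f (gcomm G (inv t) c) \<noteq> 0" using f(2) gD M(2) by blast
  ultimately have fne: "f c' - f c \<noteq> 0" by simp
  have "(delta c - delta \<one> :: 'a \<Rightarrow> 'f) \<in> comm_ideal G"
    unfolding comm_ideal_eq using nidealI_one[OF D.is_subgroup c(1)] .
  then have "conv G r (delta c - delta \<one>) - conv G (delta c - delta \<one>) r \<in> sprod G (comm_ideal G) (comm_ideal G)"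
    using r unfolding comm_stab_def by blast
  moreover have "conv G r (delta c - delta \<one>) - conv G (delta c - delta \<one>) r = conv G r (delta c) - conv G (delta c) r"
    using conv_one[OF rG] by (simp add: conv_linear)
  ultimately have "conv G r (delta c) - conv G (delta c) r \<in> sprod G (nideal ?D) (nideal ?D)"
    unfolding comm_ideal_eq by simp
  from additive_functional_vanishes[OF derived_self_is_normal _ tG this, of f] f(1)
  have 0: "(\<Sum>h\<in>?D. (conv G r (delta c) - conv G (delta c) r) (h \<otimes> t) * f h) = 0" by simp
  have right: "conv G r (delta c) x = r (x \<otimes> inv c)" if x: "x \<in> carrier G" for x
  proof -
    have "inv y \<otimes> x = c \<longleftrightarrow> y = x \<otimes> inv c" if "y \<in> carrier G" for y
      using that x cG by (metis inv_closed inv_comp_cancel(1) inv_equality inv_inv inv_mult_group m_assoc m_closed r_inv r_one)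
    then have "(\<Sum>y\<in>carrier G. r y * delta c (inv y \<otimes> x)) = (\<Sum>y\<in>carrier G. if y = x \<otimes> inv c then r (x \<otimes> inv c) else 0)"
      by (intro sum.cong) (auto simp: delta_apply)
    then show ?thesis using x cG finite_carrier by (simp add: conv_def)
  qed
  have left: "conv G (delta c) r x = r (inv c \<otimes> x)" if x: "x \<in> carrier G" for x
  proof -
    have "(\<Sum>y\<in>carrier G. delta c y * r (inv y \<otimes> x)) = (\<Sum>y\<in>carrier G. if y = c then r (inv c \<otimes> x) else 0)"
      by (intro sum.cong) (auto simp: delta_apply)
    then show ?thesis using x cG finite_carrier by (simp add: conv_def)
  qed
  \<comment> \<open>Shifting by c' on the right, respectively by c on the left, turns the argument
    of r into h t in both sums, since c' t c^-1 = t.\<close>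
  have bR: "bij_betw (\<lambda>h. h \<otimes> c') ?D ?D"
    by (rule bij_betw_byWitness[where f' = "\<lambda>h. h \<otimes> inv c'"]) (use c' in \<open>auto simp: m_assoc\<close>)
  have bL: "bij_betw (\<lambda>h. c \<otimes> h) ?D ?D"
    by (rule bij_betw_byWitness[where f' = "\<lambda>h. inv c \<otimes> h"]) (use c(1) in \<open>auto\<close>)
  have "(\<Sum>h\<in>?D. conv G r (delta c) (h \<otimes> t) * f h) = (\<Sum>h\<in>?D. conv G r (delta c) (h \<otimes> c' \<otimes> t) * f (h \<otimes> c'))"
    using sum.reindex_bij_betw[OF bR, of "\<lambda>h. conv G r (delta c) (h \<otimes> t) * f h"] by simp
  also have "\<dots> = (\<Sum>h\<in>?D. r (h \<otimes> t) * (f h + f c'))"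
  proof (rule sum.cong[OF refl])
    fix h assume h: "h \<in> ?D"
    then have hG: "h \<in> carrier G" by simp
    have "h \<otimes> c' \<otimes> t \<otimes> inv c = h \<otimes> t" unfolding c'_def using hG tG cG by (simp add: m_assoc)
    then show "conv G r (delta c) (h \<otimes> c' \<otimes> t) * f (h \<otimes> c') = r (h \<otimes> t) * (f h + f c')"
      using right[of "h \<otimes> c' \<otimes> t"] hG c'G tG f(1) h c' by simp
  qed
  finally have 1: "(\<Sum>h\<in>?D. conv G r (delta c) (h \<otimes> t) * f h) = (\<Sum>h\<in>?D. r (h \<otimes> t) * (f h + f c'))" .
  have "(\<Sum>h\<in>?D. conv G (delta c) r (h \<otimes> t) * f h) = (\<Sum>h\<in>?D. conv G (delta c) r (c \<otimes> h \<otimes> t) * f (c \<otimes> h))"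
    using sum.reindex_bij_betw[OF bL, of "\<lambda>h. conv G (delta c) r (h \<otimes> t) * f h"] by simp
  also have "\<dots> = (\<Sum>h\<in>?D. r (h \<otimes> t) * (f c + f h))"
  proof (rule sum.cong[OF refl])
    fix h assume h: "h \<in> ?D"
    then have hG: "h \<in> carrier G" by simp
    show "conv G (delta c) r (c \<otimes> h \<otimes> t) * f (c \<otimes> h) = r (h \<otimes> t) * (f c + f h)"
      using left[of "c \<otimes> h \<otimes> t"] hG cG tG f(1) h c(1) by (simp add: m_assoc)
  qed
  finally have 2: "(\<Sum>h\<in>?D. conv G (delta c) r (h \<otimes> t) * f h) = (\<Sum>h\<in>?D. r (h \<otimes> t) * (f c + f h))" .
  have "0 = (\<Sum>h\<in>?D. r (h \<otimes> t) * (f h + f c')) - (\<Sum>h\<in>?D. r (h \<otimes> t) * (f c + f h))"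
    using 0 1 2 by (simp add: fun_apply left_diff_distrib sum_subtractf)
  also have "\<dots> = (\<Sum>h\<in>?D. r (h \<otimes> t)) * (f c' - f c)"
    unfolding sum_subtractf[symmetric] sum_distrib_right by (intro sum.cong) (auto simp: algebra_simps)
  finally show ?thesis using fne by simp
qed

text \<open>Elements of the stabilizer have sum zero over every D-coset outside N, hence over every
  other N-coset, and augmentation zero settles N itself. Conversely c - 1 lies in the stabilizer for
  c in N.\<close>

lemma stab_ideal_eq:
  assumes char: "CHAR('f::field) = p"
  shows "stab_ideal G = (nideal (section_centralizer G) :: ('a \<Rightarrow> 'f) set)"
proof
  let ?D = "commutator_subgroup G" and ?N = "section_centralizer G"
  interpret D: normal ?D G by (rule derived_self_is_normal)
  interpret N: normal ?N G by (rule section_centralizer_normal)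
  have DN: "?D \<subseteq> ?N" by (rule section_centralizer_normal)
  have "r \<in> (nideal ?N :: ('a \<Rightarrow> 'f) set)" if r: "r \<in> comm_stab G" "r \<in> aug_ideal G" for r
  proof -
    have rG: "\<forall>x. x \<notin> carrier G \<longrightarrow> r x = 0" using r(1) unfolding comm_stab_def galg_def by blast
    have out: "(\<Sum>g\<in>{g \<in> carrier G. ?N #> g = y}. r g) = 0" if y: "y \<noteq> ?N" for y
    proof -
      let ?A = "{g \<in> carrier G. ?N #> g = y}"
      \<comment> \<open>An N-coset is a union of D-cosets because D is contained in N.\<close>
      have "(\<Sum>g\<in>?A. r g) = (\<Sum>z\<in>(\<lambda>g. ?D #> g) ` ?A. \<Sum>g\<in>{g \<in> ?A. ?D #> g = z}. r g)"
        using finite_carrier by (intro sum.image_gen) simp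
      also have "\<dots> = 0"
      proof (rule sum.neutral, rule ballI)
        fix z assume "z \<in> (\<lambda>g. ?D #> g) ` ?A"
        then obtain t where t: "t \<in> carrier G" "?N #> t = y" "z = ?D #> t" by blast
        have tN: "t \<notin> ?N" using y t(2) N.rcos_const[OF is_group] by auto
        have "?N #> g = y" if g: "g \<in> carrier G" "?D #> g = z" for g
        proof -
          have "g \<in> ?D #> t" using r_coset_mem_iff[OF D.is_subgroup g(1) t(1)] g(2) t(3) by simp
          then have "g \<in> ?N #> t" using DN unfolding r_coset_def by blast
          then show ?thesis using r_coset_mem_iff[OF N.is_subgroup g(1) t(1)] t(2) by simp
        qed
        then have "{g \<in> ?A. ?D #> g = z} = {g \<in> carrier G. ?D #> g = ?D #> t}" using t(3) by blast
        then show "(\<Sum>g\<in>{g \<in> ?A. ?D #> g = z}. r g) = 0"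
          using sum_r_coset[OF D.is_subgroup t(1), of r] comm_stab_coset_sum[OF char r(1), of t] t(1) tN by simp
      qed
      finally show ?thesis .
    qed
    have "(\<Sum>g\<in>carrier G. r g) = (\<Sum>z\<in>(\<lambda>g. ?N #> g) ` carrier G. \<Sum>g\<in>{g \<in> carrier G. ?N #> g = z}. r g)"
      using finite_carrier by (rule sum.image_gen)
    also have "\<dots> = (\<Sum>z\<in>(\<lambda>g. ?N #> g) ` carrier G. if z = ?N then \<Sum>g\<in>{g \<in> carrier G. ?N #> g = ?N}. r g else 0)"
      using out by (intro sum.cong) auto
    also have "\<dots> = (\<Sum>g\<in>{g \<in> carrier G. ?N #> g = ?N}. r g)"
    proof -
      have "?N \<in> (\<lambda>g. ?N #> g) ` carrier G" using N.subset by (intro image_eqI[of _ _ \<one>]) auto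
      then show ?thesis using finite_carrier by simp
    qed
    finally have "(\<Sum>g\<in>{g \<in> carrier G. ?N #> g = ?N}. r g) = 0"
      using r(2) unfolding aug_ideal_def aug_def by simp
    then have "(\<Sum>g\<in>{g \<in> carrier G. ?N #> g = y}. r g) = 0" for y using out by (cases "y = ?N") simp_all
    then show ?thesis unfolding nideal_def fiber_diffs_iff(1)[OF finite_carrier] using rG by blast
  qed
  then show "stab_ideal G \<subseteq> (nideal ?N :: ('a \<Rightarrow> 'f) set)"
    unfolding stab_ideal_def
    by (intro sprod_minimal[OF nideal_subspace] nideal_ideal(1)[OF N.normal_axioms]) auto
  show "(nideal ?N :: ('a \<Rightarrow> 'f) set) \<subseteq> stab_ideal G"
    unfolding nideal_eq_span[OF N.is_subgroup]
  proof (rule fv.span_minimal, rule subsetI)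
    fix x :: "'a \<Rightarrow> 'f" assume "x \<in> {delta (c \<otimes> g) - delta g |c g. c \<in> ?N \<and> g \<in> carrier G}"
    then obtain c g where x: "x = delta (c \<otimes> g) - delta g" "c \<in> ?N" "g \<in> carrier G" by blast
    have cs: "fv.subspace (comm_stab G :: ('a \<Rightarrow> 'f) set)"
    proof (rule fv.subspaceI)
      have e: "(a + b) - (c + d) = (a - c) + (b - d)" for a b c d :: "'a \<Rightarrow> 'f" by (simp add: algebra_simps)
      show "0 \<in> (comm_stab G :: ('a \<Rightarrow> 'f) set)"
        by (simp add: comm_stab_def fv.subspace_0 galg_subspace sprod_subspace)
      show "u + v \<in> comm_stab G" if "u \<in> comm_stab G" "v \<in> comm_stab G" for u v :: "'a \<Rightarrow> 'f"
        using that by (auto simp: comm_stab_def conv_linear e intro!: fv.subspace_add[OF sprod_subspace] fv.subspace_add[OF galg_subspace])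
      show "fscale k u \<in> comm_stab G" if "u \<in> comm_stab G" for k and u :: "'a \<Rightarrow> 'f"
        using that by (auto simp: comm_stab_def conv_linear fv.scale_right_diff_distrib[symmetric]
            intro!: fv.subspace_scale[OF sprod_subspace] fv.subspace_scale[OF galg_subspace])
    qed
    have "(delta c - delta \<one> :: 'a \<Rightarrow> 'f) \<in> comm_stab G"
      by (rule fv.subspace_diff[OF cs delta_in_comm_stab[OF char x(2)] delta_in_comm_stab[OF char N.one_closed]])
    moreover have "(delta c - delta \<one> :: 'a \<Rightarrow> 'f) \<in> aug_ideal G"
      unfolding aug_ideal_eq by (rule nidealI_one[OF subgroup_self N.mem_carrier[OF x(2)]])
    ultimately have "conv G (delta c - delta \<one>) (delta g) \<in> (stab_ideal G :: ('a \<Rightarrow> 'f) set)"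
      unfolding stab_ideal_def using x(3) by (intro sprodI) simp_all
    then show "x \<in> stab_ideal G" unfolding x(1) using x(2,3) by (simp add: conv_linear conv_delta)
  qed (simp add: stab_ideal_def sprod_subspace)
qed

end

section \<open>Finite abelian p-groups\<close>

text \<open>The lowest nonconstant term of the product shows how often the smallest exponent
  \<open>m\<close> occurs; that factor can then be cancelled.\<close>

lemma coeff_prod_one_minus_monom:
  assumes "m \<ge> 1" "\<forall>q\<in>#A. m \<le> q" "k \<le> m"
  shows "coeff (\<Prod>q\<in>#A. 1 - monom 1 q :: int poly) k = (if k = 0 then 1 else if k = m then - int (count A m) else 0)"
  using assms(2,3)
proof (induction A arbitrary: k)
  case (add q A)
  let ?P = "\<Prod>q\<in>#A. 1 - monom 1 q :: int poly"
  have e: "coeff ((1 - monom 1 q) * ?P) k = coeff ?P k - (if q \<le> k then coeff ?P (k - q) else 0)"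
    by (simp add: left_diff_distrib coeff_monom_mult)
  show ?case using add.prems add.IH[of k] add.IH[of 0] assms(1) by (auto simp: e)
qed auto

lemma mset_eq_of_prod_one_minus_monom:
  assumes "size A = size B" "0 \<notin># A" "0 \<notin># B"
    "(\<Prod>q\<in>#A. 1 - monom 1 q :: int poly) = (\<Prod>q\<in>#B. 1 - monom 1 q)"
  shows "A = B"
  using assms
proof (induction "size A" arbitrary: A B)
  case (Suc n)
  define m where "m = Min (set_mset (A + B))"
  have ne: "set_mset (A + B) \<noteq> {}" using Suc.hyps(2) by auto
  have mem: "m \<in># A + B" unfolding m_def using Min_in[OF _ ne] by simp
  have le: "\<forall>q\<in>#A. m \<le> q" "\<forall>q\<in>#B. m \<le> q" unfolding m_def by auto
  have m1: "m \<ge> 1" using mem Suc.prems(2,3) by (metis One_nat_def Suc_leI gr0I union_iff)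
  have "count A m = count B m"
    using coeff_prod_one_minus_monom[OF m1 le(1), of m] coeff_prod_one_minus_monom[OF m1 le(2), of m] Suc.prems(4) m1 by simp
  then have "m \<in># A" "m \<in># B" using mem by (metis count_inI not_in_iff union_iff)+
  then obtain A' B' where AB: "A = add_mset m A'" "B = add_mset m B'" by (metis multi_member_split)
  have "(1 - monom 1 m :: int poly) \<noteq> 0"
  proof
    assume "(1 - monom 1 m :: int poly) = 0"
    then have "coeff (1 - monom 1 m :: int poly) 0 = 0" by simp
    then show False using m1 by simp
  qed
  then have "(\<Prod>q\<in>#A'. 1 - monom 1 q :: int poly) = (\<Prod>q\<in>#B'. 1 - monom 1 q)"
    using Suc.prems(4) unfolding AB by simp
  then have "A' = B'" using Suc.hyps Suc.prems(1-3) unfolding AB by simp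
  then show ?case unfolding AB by simp
qed auto

text \<open>The linear coefficient gives the number of factors, after which each factor can be multiplied by
  \<open>1 - x\<close>.\<close>

lemma mset_eq_of_prod_geometric:
  assumes A: "\<forall>q\<in>#A. q \<ge> 2" and B: "\<forall>q\<in>#B. q \<ge> 2"
    and eq: "(\<Prod>q\<in>#A. \<Sum>i<q. monom 1 i :: int poly) = (\<Prod>q\<in>#B. \<Sum>i<q. monom 1 i)"
  shows "A = B"
proof (rule mset_eq_of_prod_one_minus_monom)
  let ?g = "\<lambda>q. \<Sum>i<q. monom 1 i :: int poly"
  have gc: "coeff (?g q) k = (if k < q then 1 else 0)" for q k by (simp add: coeff_sum)
  \<comment> \<open>Factors of length at least 2 have linear coefficient 1; a factor of length 1
    would be invisible.\<close>
  have low: "coeff (\<Prod>q\<in>#C. ?g q) 0 = 1 \<and> coeff (\<Prod>q\<in>#C. ?g q) 1 = int (size C)" if "\<forall>q\<in>#C. q \<ge> 2" for C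
    using that
  proof (induction C)
    case (add q C)
    have c0: "coeff (a * b) 0 = coeff a 0 * coeff b 0" and c1: "coeff (a * b) 1 = coeff a 0 * coeff b 1 + coeff a 1 * coeff b 0"
      for a b :: "int poly" by (simp_all add: coeff_mult)
    have g01: "coeff (?g q) 0 = 1" "coeff (?g q) 1 = 1" using add.prems by (simp_all add: gc)
    have IH: "coeff (\<Prod>q\<in>#C. ?g q) 0 = 1" "coeff (\<Prod>q\<in>#C. ?g q) 1 = int (size C)" using add by simp_all
    show ?case unfolding image_mset_add_mset prod_mset.add_mset c0 c1 g01 IH by simp
  qed auto
  show sz: "size A = size B" using low[OF A] low[OF B] eq by simp
  show "0 \<notin># A" "0 \<notin># B" using A B by auto
  have g: "(1 - monom 1 1) * ?g q = 1 - monom 1 q" for q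
  proof (induction q)
    case (Suc q)
    have "(1 - monom 1 1) * ?g (Suc q) = (1 - monom 1 1) * ?g q + (1 - monom 1 1) * monom 1 q"
      by (simp add: distrib_left)
    also have "(1 - monom 1 1) * monom 1 q = monom 1 q - (monom 1 (Suc q) :: int poly)"
      by (simp add: left_diff_distrib mult_monom)
    finally show ?case using Suc by simp
  qed (simp add: monom_0 one_pCons)
  have "(\<Prod>q\<in>#C. 1 - monom 1 q) = (1 - monom 1 1) ^ size C * (\<Prod>q\<in>#C. ?g q)" for C
  proof (induction C)
    case (add q C)
    show ?case
      unfolding image_mset_add_mset prod_mset.add_mset size_add_mset power_Suc add.IH g[of q, symmetric]
      by (simp only: mult_ac)
  qed simp
  then show "(\<Prod>q\<in>#A. 1 - monom 1 q :: int poly) = (\<Prod>q\<in>#B. 1 - monom 1 q)" using sz eq by simp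
qed

section \<open>Bases of finite abelian p-groups\<close>

locale abelian_p_group = p_group G p + comm_group G for G (structure) and p

context abelian_p_group begin

definition lincomb :: "'a set \<Rightarrow> ('a \<Rightarrow> int) \<Rightarrow> 'a" where
  "lincomb S k = finprod G (\<lambda>s. s [^] k s) S"

text \<open>Independence is that of torsion groups: a relation makes the powers trivial, not the
  exponents. Excluding the neutral element makes all orders at least 2.\<close>

definition basis :: "'a set \<Rightarrow> 'a set \<Rightarrow> bool" where
  "basis S B \<longleftrightarrow> S \<subseteq> B \<and> finite S \<and> \<one> \<notin> S \<and> (\<forall>b\<in>B. \<exists>k. b = lincomb S k) \<and>
    (\<forall>k. lincomb S k = \<one> \<longrightarrow> (\<forall>s\<in>S. s [^] k s = \<one>))"

lemma lincomb_insert: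
  assumes "finite S" "g \<notin> S" "insert g S \<subseteq> carrier G"
  shows "lincomb (insert g S) k = g [^] k g \<otimes> lincomb S k"
  unfolding lincomb_def using assms by (intro finprod_insert) auto

lemma lincomb_mem:
  assumes "subgroup B G" "finite S" "S \<subseteq> B"
  shows "lincomb S k \<in> B"
  using assms(2,3)
proof (induction S)
  case empty
  then show ?case using subgroup.one_closed[OF assms(1)] by (simp add: lincomb_def)
next
  case (insert g S)
  then have "lincomb (insert g S) k = g [^] k g \<otimes> lincomb S k"
    using subgroup.subset[OF assms(1)] by (intro lincomb_insert) auto
  then show ?case using insert subgroup.m_closed[OF assms(1)] subgroup_int_pow_closed[OF assms(1)] by simp
qed

text \<open>A cyclic subgroup whose order kills \<open>B\<close> has a complement: take K maximal
  with trivial intersection. If K and g generated less than \<open>B\<close>, there would be y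
  outside the generated subgroup T with y^p in K; adjoining y to K must then meet the powers of g
  nontrivially, and this puts y into T.\<close>

lemma ex_complement:
  assumes B: "subgroup B G" and g: "g \<in> B" "g \<noteq> \<one>" and max: "\<And>b. b \<in> B \<Longrightarrow> b [^] ord g = \<one>"
  shows "\<exists>K. subgroup K G \<and> K \<subseteq> B \<and> (\<forall>i::int. g [^] i \<in> K \<longrightarrow> g [^] i = \<one>) \<and> adjoin G K g = B"
proof -
  let ?P = "\<lambda>K. subgroup K G \<and> K \<subseteq> B \<and> (\<forall>i::int. g [^] i \<in> K \<longrightarrow> g [^] i = \<one>)"
  have BG: "B \<subseteq> carrier G" using subgroup.subset[OF B] .
  have gG: "g \<in> carrier G" using g BG by blast
  have "\<exists>K. ?P K \<and> (\<forall>K'. ?P K' \<and> K \<subseteq> K' \<longrightarrow> K' = K)"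
    by (rule ex_greatest_subset[of ?P "{\<one>}"]) (use triv_subgroup subgroup.one_closed[OF B] BG in auto)
  then obtain K where K: "subgroup K G" "K \<subseteq> B" "\<And>i::int. g [^] i \<in> K \<Longrightarrow> g [^] i = \<one>"
    and Kmax: "\<And>K'. subgroup K' G \<Longrightarrow> K' \<subseteq> B \<Longrightarrow> (\<And>i::int. g [^] i \<in> K' \<Longrightarrow> g [^] i = \<one>) \<Longrightarrow> K \<subseteq> K' \<Longrightarrow> K' = K"
    by (elim exE conjE) (rule that, assumption+, blast, metis)
  let ?T = "adjoin G K g"
  have KN: "K \<lhd> G" using subgroup_imp_normal K(1) .
  have KG: "K \<subseteq> carrier G" using K(2) BG by blast
  have T: "subgroup ?T G" by (rule adjoin_subgroup[OF KN gG])
  have TB: "?T \<subseteq> B" by (rule adjoin_least[OF B K(2) g(1)])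
  have KT: "K \<subseteq> ?T" and gT: "g \<in> ?T" using adjoin_incl[OF KG gG] subgroup.one_closed[OF K(1)] by auto
  have "B \<subseteq> ?T"
  proof (rule ccontr)
    assume "\<not> B \<subseteq> ?T"
    then obtain b where b: "b \<in> B" "b \<notin> ?T" by blast
    have bG: "b \<in> carrier G" using b BG by blast
    obtain n where "b [^] (p ^ n) = \<one>" using exponent bG by blast
    then have ex: "b [^] (p ^ n) \<in> ?T" using subgroup.one_closed[OF T] by simp
    \<comment> \<open>The last element outside \<open>?T\<close> on the way b, b^p, b^(p^2), ...:
      its p-th power lies in \<open>?T\<close>.\<close>
    define m where "m = (LEAST m. b [^] (p ^ m) \<in> ?T)"
    have m: "b [^] (p ^ m) \<in> ?T" unfolding m_def using ex by (rule LeastI)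
    have "m \<noteq> 0" using m b(2) bG by (intro notI) simp
    then obtain m' where m': "m = Suc m'" using not0_implies_Suc by blast
    define x where "x = b [^] (p ^ m')"
    have xT: "x \<notin> ?T" unfolding x_def using not_less_Least[of m' "\<lambda>m. b [^] (p ^ m) \<in> ?T"] m' unfolding m_def by auto
    have xB: "x \<in> B" unfolding x_def using subgroup_int_pow_closed[OF B b(1), of "int (p ^ m')"] by (metis int_pow_int)
    have xG: "x \<in> carrier G" using xB BG by blast
    have xp: "x [^] p \<in> ?T" using m bG unfolding x_def m' by (simp add: nat_pow_pow mult.commute)
    then obtain k i where ki: "x [^] p = k \<otimes> g [^] (i::int)" "k \<in> K" unfolding adjoin_def by blast
    have kG: "k \<in> carrier G" using ki KG by blast
    obtain e where e: "ord g = p ^ e" using dvd_orderD[OF ord_dvd_group_order[OF gG]] by blast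
    have "e \<noteq> 0" using e ord_eq_1[OF gG] g(2) by (intro notI) simp
    then obtain e' where e': "e = Suc e'" using not0_implies_Suc by blast
    \<comment> \<open>The order of g kills x, so raising x^p = k g^i to the power p^(e-1) puts a
      power of g into K. That power is trivial, whence p divides i.\<close>
    have "(x [^] p) [^] (p ^ e') = \<one>" using max[OF xB] xG unfolding e e' by (simp add: nat_pow_pow)
    moreover have "(g [^] i) [^] (p ^ e') = g [^] (i * int (p ^ e'))"
      using int_pow_pow[OF gG, of i "int (p ^ e')"] by (metis int_pow_int)
    ultimately have "k [^] (p ^ e') \<otimes> g [^] (i * int (p ^ e')) = \<one>"
      unfolding ki(1) using kG gG by (simp only: pow_mult_distrib[OF m_comm] int_pow_closed)
    then have gi: "g [^] (i * int (p ^ e')) = inv (k [^] (p ^ e'))"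
      using kG gG inv_equality[of "g [^] (i * int (p ^ e'))" "k [^] (p ^ e')"] m_comm by simp
    have "k [^] (p ^ e') \<in> K" using subgroup_int_pow_closed[OF K(1) ki(2), of "int (p ^ e')"] by (metis int_pow_int)
    then have "g [^] (i * int (p ^ e')) \<in> K" unfolding gi by (rule subgroup.m_inv_closed[OF K(1)])
    then have "g [^] (i * int (p ^ e')) = \<one>" by (rule K(3))
    then have "int (p ^ e) dvd i * int (p ^ e')" using int_pow_eq_id[OF gG] e by simp
    then have "int p dvd i" using prime_gt_0_nat[OF prime_p] unfolding e' by simp
    then obtain j where j: "i = int p * j" by blast
    \<comment> \<open>Dividing x by g^j removes the g-part of its p-th power and leaves k.\<close>
    define y where "y = x \<otimes> g [^] (- j)"
    have yB: "y \<in> B" unfolding y_def using xB subgroup_int_pow_closed[OF B g(1)] subgroup.m_closed[OF B] by blast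
    have yG: "y \<in> carrier G" using yB BG by blast
    have yp: "y [^] p = k"
    proof -
      have "y [^] p = x [^] p \<otimes> (g [^] (- j)) [^] p"
        unfolding y_def using xG gG by (simp add: pow_mult_distrib m_comm)
      also have "(g [^] (- j)) [^] p = g [^] (- i)"
        using int_pow_pow[OF gG, of "- j" "int p"] unfolding j by (simp add: int_pow_int mult.commute)
      finally show ?thesis unfolding ki(1) using kG gG by (simp add: m_assoc int_pow_neg)
    qed
    have yT: "y \<notin> ?T"
    proof
      assume "y \<in> ?T"
      then have "y \<otimes> g [^] j \<in> ?T" using subgroup.m_closed[OF T _ subgroup_int_pow_closed[OF T gT]] by blast
      then have "x \<in> ?T" unfolding y_def using xG gG by (simp add: m_assoc int_pow_neg)
      then show False using xT by blast
    qed
    have "K \<subseteq> adjoin G K y" "y \<in> adjoin G K y" using adjoin_incl[OF KG yG] subgroup.one_closed[OF K(1)] by auto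
    then have "adjoin G K y \<noteq> K" using yT KT by blast
    then obtain i' where i': "g [^] (i'::int) \<in> adjoin G K y" "g [^] i' \<noteq> \<one>"
      using Kmax[OF adjoin_subgroup[OF KN yG] adjoin_least[OF B K(2) yB]] \<open>K \<subseteq> adjoin G K y\<close> by blast
    then obtain k' t where kt: "g [^] i' = k' \<otimes> y [^] (t::int)" "k' \<in> K" unfolding adjoin_def by blast
    have k'G: "k' \<in> carrier G" using kt KG by blast
    \<comment> \<open>Otherwise y^t would be a power of k and the nontrivial power of g would lie in
      K.\<close>
    have "\<not> int p dvd t"
    proof
      assume "int p dvd t"
      then obtain u where u: "t = int p * u" by blast
      have "y [^] t = k [^] u" unfolding u using int_pow_pow[OF yG, of "int p" u] yp by (simp add: int_pow_int)
      then have "y [^] t \<in> K" using subgroup_int_pow_closed[OF K(1) ki(2)] by simp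
      then have "g [^] i' \<in> K" unfolding kt(1) using subgroup.m_closed[OF K(1) kt(2)] by blast
      then show False using K(3) i'(2) by blast
    qed
    moreover have "y [^] t \<in> ?T"
    proof -
      have "y [^] t = inv k' \<otimes> g [^] i'" unfolding kt(1) using k'G yG by simp
      then show ?thesis using subgroup.m_closed[OF T subgroup.m_inv_closed[OF T subsetD[OF KT kt(2)]] subgroup_int_pow_closed[OF T gT]]
        by simp
    qed
    moreover have "y [^] p \<in> ?T" using yp ki(2) KT by blast
    ultimately have "y \<in> ?T" using mem_of_coprime_pow[OF T yG _ _ prime_p] by blast
    then show False using yT by blast
  qed
  then show ?thesis using K TB by blast
qed

text \<open>Splits off an element of largest order. Orders are powers of p, so the largest one is a
  multiple of all others, as \<open>ex_complement\<close> requires.\<close>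

lemma ex_basis:
  assumes "subgroup B G"
  shows "\<exists>S. basis S B"
  using assms
proof (induction "card B" arbitrary: B rule: less_induct)
  case less
  have BG: "B \<subseteq> carrier G" using subgroup.subset[OF less.prems] .
  have B1: "\<one> \<in> B" using subgroup.one_closed[OF less.prems] .
  show ?case
  proof (cases "B = {\<one>}")
    case True
    then show ?thesis by (intro exI[of _ "{}"]) (auto simp: basis_def lincomb_def)
  next
    case False
    have finB: "finite B" using subgroup_finite[OF less.prems] .
    obtain g where g: "g \<in> B" "\<And>b. b \<in> B \<Longrightarrow> ord b \<le> ord g"
    proof -
      have "Max (ord ` B) \<in> ord ` B" using finB B1 by (intro Max_in) auto
      then show thesis using that finB by (metis (no_types, lifting) Max_ge finite_imageI imageE imageI)
    qed
    have op: "\<exists>f. ord b = p ^ f" if "b \<in> B" for b using dvd_orderD[OF ord_dvd_group_order] BG that by blast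
    have max: "b [^] ord g = \<one>" if b: "b \<in> B" for b
    proof -
      obtain e f where ef: "ord g = p ^ e" "ord b = p ^ f" using op g(1) b by metis
      have "f \<le> e" using g(2)[OF b] ef prime_gt_1_nat[OF prime_p] by simp
      then have "ord b dvd ord g" unfolding ef by (rule le_imp_power_dvd)
      then show ?thesis using pow_eq_id BG b by blast
    qed
    have g1: "g \<noteq> \<one>"
    proof
      assume "g = \<one>"
      then have "b = \<one>" if "b \<in> B" for b using max[OF that] subsetD[OF BG that] ord_eq_1[OF one_closed] by simp
      then show False using False B1 by blast
    qed
    obtain K where K: "subgroup K G" "K \<subseteq> B" "\<And>i::int. g [^] i \<in> K \<Longrightarrow> g [^] i = \<one>" "adjoin G K g = B"
      using ex_complement[OF less.prems g(1) g1 max] by blast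
    have gG: "g \<in> carrier G" using g BG by blast
    have gK: "g \<notin> K" using K(3)[of 1] g1 gG by (auto simp: int_pow_1)
    then have "card K < card B" using K(2) g(1) finB by (intro psubset_card_mono) auto
    then obtain S where S: "basis S K" using less.hyps K(1) by blast
    then have SK: "S \<subseteq> K" "finite S" "\<one> \<notin> S" and rep: "\<And>b. b \<in> K \<Longrightarrow> \<exists>k. b = lincomb S k"
      and ind: "\<And>k s. lincomb S k = \<one> \<Longrightarrow> s \<in> S \<Longrightarrow> s [^] k s = \<one>" unfolding basis_def by blast+
    have gS: "g \<notin> S" using gK SK by blast
    have SG: "insert g S \<subseteq> carrier G" using gG SK K(2) BG by blast
    note ins = lincomb_insert[OF SK(2) gS SG]
    have "basis (insert g S) B" unfolding basis_def
    proof (intro conjI ballI allI impI)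
      show "insert g S \<subseteq> B" using g(1) SK K(2) by blast
      show "finite (insert g S)" using SK by simp
      show "\<one> \<notin> insert g S" using SK g1 by simp
    next
      fix b assume "b \<in> B"
      then obtain c i where ci: "b = c \<otimes> g [^] (i::int)" "c \<in> K" using K(4) unfolding adjoin_def by blast
      obtain k where k: "c = lincomb S k" using rep ci(2) by blast
      have "lincomb S (k(g := i)) = lincomb S k" unfolding lincomb_def
        using gS SG by (intro finprod_cong') auto
      then have "b = lincomb (insert g S) (k(g := i))"
        unfolding ins ci(1) k using gG lincomb_mem[OF K(1) SK(2,1), of k] K(2) BG by (simp add: m_comm subset_iff)
      then show "\<exists>k. b = lincomb (insert g S) k" by blast
    next
      fix k s assume k: "lincomb (insert g S) k = \<one>" and s: "s \<in> insert g S"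
      have lK: "lincomb S k \<in> K" using lincomb_mem[OF K(1) SK(2,1)] .
      have lG: "lincomb S k \<in> carrier G" using lK K(2) BG by blast
      have "g [^] k g = inv (lincomb S k)" using k lG gG unfolding ins by (metis int_pow_closed inv_equality)
      then have "g [^] k g \<in> K" using subgroup.m_inv_closed[OF K(1) lK] by simp
      then have gk: "g [^] k g = \<one>" by (rule K(3))
      then have "lincomb S k = \<one>" using k lG unfolding ins by simp
      then show "s [^] k s = \<one>" using gk ind s by blast
    qed
    then show ?thesis by blast
  qed
qed

lemma lincomb_eq_one_iff:
  assumes S: "basis S (carrier G)"
  shows "lincomb S k = \<one> \<longleftrightarrow> (\<forall>s\<in>S. int (ord s) dvd k s)"
proof
  have SG: "S \<subseteq> carrier G" and fin: "finite S" using S unfolding basis_def by blast+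
  assume "lincomb S k = \<one>"
  then have "\<forall>s\<in>S. s [^] k s = \<one>" using S unfolding basis_def by blast
  then show "\<forall>s\<in>S. int (ord s) dvd k s" using int_pow_eq_id SG by blast
next
  have SG: "S \<subseteq> carrier G" using S unfolding basis_def by blast
  assume "\<forall>s\<in>S. int (ord s) dvd k s"
  then have "\<forall>s\<in>S. s [^] k s = \<one>" using int_pow_eq_id SG by blast
  then show "lincomb S k = \<one>" unfolding lincomb_def by (intro finprod_one_eqI) auto
qed

lemma lincomb_add:
  assumes "S \<subseteq> carrier G"
  shows "lincomb S (\<lambda>s. k s + l s) = lincomb S k \<otimes> lincomb S l"
proof -
  have "lincomb S (\<lambda>s. k s + l s) = finprod G (\<lambda>s. s [^] k s \<otimes> s [^] l s) S"
    unfolding lincomb_def using assms by (intro finprod_cong') (auto simp: int_pow_mult)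
  also have "\<dots> = lincomb S k \<otimes> lincomb S l"
    unfolding lincomb_def using assms by (intro finprod_multf) auto
  finally show ?thesis .
qed

lemma lincomb_eq_iff:
  assumes S: "basis S (carrier G)"
  shows "lincomb S k = lincomb S l \<longleftrightarrow> (\<forall>s\<in>S. int (ord s) dvd k s - l s)"
proof -
  have SG: "S \<subseteq> carrier G" and fin: "finite S" using S unfolding basis_def by blast+
  have cl: "lincomb S k \<in> carrier G" for k using lincomb_mem[OF subgroup_self fin SG] .
  have e: "lincomb S k = lincomb S (\<lambda>s. k s - l s) \<otimes> lincomb S l"
    using lincomb_add[OF SG, of "\<lambda>s. k s - l s" l] by simp
  have "lincomb S k = lincomb S l \<longleftrightarrow> lincomb S (\<lambda>s. k s - l s) = \<one>"
    using e r_cancel_one[OF cl[of l] cl[of "\<lambda>s. k s - l s"]] by simp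
  then show ?thesis using lincomb_eq_one_iff[OF S] by simp
qed

lemma ord_basis:
  assumes S: "basis S (carrier G)" and s: "s \<in> S"
  shows "ord s \<ge> 2"
proof -
  have sG: "s \<in> carrier G" "s \<noteq> \<one>" using S s unfolding basis_def by blast+
  have "ord s > 0" using ord_ge_1[OF finite_carrier sG(1)] by simp
  moreover have "ord s \<noteq> 1" using ord_eq_1[OF sG(1)] sG(2) by simp
  ultimately show ?thesis by linarith
qed

text \<open>Exponents reduced modulo the orders parametrize the group bijectively;
  \<open>PiE\<close> makes an exponent function determined by its values on
  \<open>S\<close>.\<close>

lemma prod_ord_basis:
  assumes S: "basis S (carrier G)"
  shows "(\<Prod>s\<in>S. ord s) = card (carrier G)"
proof -
  have SG: "S \<subseteq> carrier G" and fin: "finite S" using S unfolding basis_def by blast+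
  let ?K = "PiE S (\<lambda>s. {..<ord s})"
  have pos: "ord s > 0" if "s \<in> S" for s using ord_basis[OF S that] by simp
  have "bij_betw (\<lambda>k. lincomb S (\<lambda>s. int (k s))) ?K (carrier G)"
    unfolding bij_betw_def
  proof
    show "inj_on (\<lambda>k. lincomb S (\<lambda>s. int (k s))) ?K"
    proof (rule inj_onI)
      fix k l assume kl: "k \<in> ?K" "l \<in> ?K" "lincomb S (\<lambda>s. int (k s)) = lincomb S (\<lambda>s. int (l s))"
      have "k s = l s" if s: "s \<in> S" for s
      proof -
        have "int (ord s) dvd int (k s) - int (l s)" using lincomb_eq_iff[OF S, of "\<lambda>s. int (k s)" "\<lambda>s. int (l s)"] kl(3) s by simp
        moreover have "k s < ord s" "l s < ord s" using kl(1,2) s by (auto simp: PiE_iff)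
        ultimately have "int (k s) - int (l s) = 0" using dvd_imp_le_int[of "int (k s) - int (l s)" "int (ord s)"] by force
        then show ?thesis by simp
      qed
      then show "k = l" using kl(1,2) by (meson PiE_ext)
    qed
    show "(\<lambda>k. lincomb S (\<lambda>s. int (k s))) ` ?K = carrier G"
    proof
      show "(\<lambda>k. lincomb S (\<lambda>s. int (k s))) ` ?K \<subseteq> carrier G"
        using lincomb_mem[OF subgroup_self fin SG] by blast
      show "carrier G \<subseteq> (\<lambda>k. lincomb S (\<lambda>s. int (k s))) ` ?K"
      proof
        fix b assume "b \<in> carrier G"
        then obtain k where k: "b = lincomb S k" using S unfolding basis_def by blast
        define l where "l = restrict (\<lambda>s. nat (k s mod int (ord s))) S"
        have lK: "l \<in> ?K" unfolding l_def using pos by (auto simp: nat_less_iff)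
        have "lincomb S k = lincomb S (\<lambda>s. int (l s))"
          unfolding lincomb_eq_iff[OF S] l_def using pos by (auto simp: minus_mod_eq_mult_div)
        then show "b \<in> (\<lambda>k. lincomb S (\<lambda>s. int (k s))) ` ?K" using k lK by blast
      qed
    qed
  qed
  then have "card ?K = card (carrier G)" by (rule bij_betw_same_card)
  then show ?thesis using fin by (simp add: card_PiE)
qed

end

text \<open>Combinations are matched by equal exponents. In either group two combinations agree
  exactly if the exponents agree modulo the orders, and the orders correspond under
  \<open>\<sigma>\<close>; so the map is well defined and injective.\<close>

lemma abelian_p_group_iso:
  fixes A :: "('a, 'm) monoid_scheme" and B :: "('b, 'n) monoid_scheme"
  assumes A: "abelian_p_group A p" and B: "abelian_p_group B p"
    and S: "abelian_p_group.basis A S (carrier A)" and T: "abelian_p_group.basis B T (carrier B)"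
    and \<sigma>: "bij_betw \<sigma> S T" "\<And>s. s \<in> S \<Longrightarrow> group.ord B (\<sigma> s) = group.ord A s"
  shows "A \<cong> B"
proof -
  interpret A: abelian_p_group A p by fact
  interpret B: abelian_p_group B p by fact
  have SG: "S \<subseteq> carrier A" "finite S" and TG: "T \<subseteq> carrier B" "finite T"
    using S T unfolding A.basis_def B.basis_def by blast+
  define \<tau> where "\<tau> = inv_into S \<sigma>"
  have \<tau>: "\<tau> t \<in> S" "\<sigma> (\<tau> t) = t" if "t \<in> T" for t
    unfolding \<tau>_def using \<sigma>(1) that by (auto simp: bij_betw_def inv_into_into f_inv_into_f)
  have \<tau>\<sigma>: "\<tau> (\<sigma> s) = s" if "s \<in> S" for s
    unfolding \<tau>_def using \<sigma>(1) that by (auto simp: bij_betw_def)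
  have TS: "T = \<sigma> ` S" using \<sigma>(1) by (auto simp: bij_betw_def)
  define F where "F = A.lincomb S"
  define F' where "F' k = B.lincomb T (\<lambda>t. k (\<tau> t))" for k
  have F'eq: "F' k = F' l \<longleftrightarrow> F k = F l" for k l
    unfolding F_def F'_def A.lincomb_eq_iff[OF S] B.lincomb_eq_iff[OF T]
    using \<sigma>(2) \<tau>\<sigma> unfolding TS by simp
  have Fadd: "F (\<lambda>s. k s + l s) = F k \<otimes>\<^bsub>A\<^esub> F l" "F' (\<lambda>s. k s + l s) = F' k \<otimes>\<^bsub>B\<^esub> F' l" for k l
    unfolding F_def F'_def using A.lincomb_add[OF SG(1)] B.lincomb_add[OF TG(1)] by simp_all
  have Fs: "\<exists>k. a = F k" if "a \<in> carrier A" for a using S that unfolding A.basis_def F_def by blast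
  have F's: "\<exists>k. b = F' k" if b: "b \<in> carrier B" for b
  proof -
    obtain k where k: "b = B.lincomb T k" using T b unfolding B.basis_def by blast
    have "B.lincomb T (\<lambda>t. (k \<circ> \<sigma>) (\<tau> t)) = B.lincomb T k"
      unfolding B.lincomb_eq_iff[OF T] using \<tau>(2) by simp
    then show ?thesis unfolding F'_def k by metis
  qed
  have FG: "F k \<in> carrier A" "F' k \<in> carrier B" for k
    unfolding F_def F'_def using A.lincomb_mem[OF A.subgroup_self SG(2,1)] B.lincomb_mem[OF B.subgroup_self TG(2,1)] by auto
  define h where "h a = F' (SOME k. a = F k)" for a
  have h: "h (F k) = F' k" for k
  proof -
    have "F k = F (SOME l. F k = F l)" by (rule someI[of "\<lambda>l. F k = F l" k]) simp
    then show ?thesis unfolding h_def F'eq by simp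
  qed
  have "h \<in> iso A B"
  proof (rule isoI)
    show "h \<in> hom A B"
    proof (rule homI)
      show "h x \<in> carrier B" for x unfolding h_def using FG by blast
      fix x y assume "x \<in> carrier A" "y \<in> carrier A"
      then obtain k l where kl: "x = F k" "y = F l" using Fs by metis
      show "h (x \<otimes>\<^bsub>A\<^esub> y) = h x \<otimes>\<^bsub>B\<^esub> h y" unfolding kl Fadd(1)[symmetric] h Fadd(2) ..
    qed
    show "bij_betw h (carrier A) (carrier B)"
      unfolding bij_betw_def
    proof
      show "inj_on h (carrier A)"
      proof (rule inj_onI)
        fix x y assume "x \<in> carrier A" "y \<in> carrier A" and hxy: "h x = h y"
        then obtain k l where kl: "x = F k" "y = F l" using Fs by metis
        show "x = y" using hxy unfolding kl h F'eq .
      qed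
      show "h ` carrier A = carrier B"
      proof (intro equalityI subsetI)
        fix b assume "b \<in> h ` carrier A" then show "b \<in> carrier B" unfolding h_def using FG by blast
      next
        fix b assume "b \<in> carrier B"
        then obtain k where "b = F' k" using F's by blast
        then have "b = h (F k)" using h by simp
        then show "b \<in> h ` carrier A" using FG(1) by blast
      qed
    qed
  qed
  then show ?thesis by (rule is_isoI)
qed

lemma ex_bij_betw_of_image_mset_eq:
  assumes "finite S" "finite T" "image_mset f (mset_set S) = image_mset g (mset_set T)"
  shows "\<exists>\<sigma>. bij_betw \<sigma> S T \<and> (\<forall>s\<in>S. g (\<sigma> s) = f s)"
  using assms
proof (induction S arbitrary: T rule: finite_induct)
  case empty
  then have "T = {}" by (simp add: mset_set_empty_iff)
  then show ?case by (auto simp: bij_betw_def)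
next
  case (insert s S)
  then have "f s \<in># image_mset g (mset_set T)" by (metis add_mset_add_single finite_insert image_mset_add_mset mset_set.insert union_single_eq_member)
  then obtain t where t: "t \<in> T" "g t = f s" using insert.prems(1) by auto
  have "mset_set T = add_mset t (mset_set (T - {t}))" using t(1) insert.prems(1) by (simp add: mset_set.remove)
  then have "image_mset f (mset_set S) = image_mset g (mset_set (T - {t}))" using insert t(2) by simp
  then obtain \<sigma> where \<sigma>: "bij_betw \<sigma> S (T - {t})" "\<forall>s\<in>S. g (\<sigma> s) = f s"
    using insert.IH[of "T - {t}"] insert.prems(1) by auto
  have "bij_betw (\<sigma>(s := t)) (insert s S) (insert t (T - {t}))"
    using \<sigma>(1) insert.hyps(2) unfolding bij_betw_def by (auto simp: inj_on_def image_iff)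
  moreover have "insert t (T - {t}) = T" using t(1) by blast
  moreover have "\<forall>x\<in>insert s S. g ((\<sigma>(s := t)) x) = f x" using \<sigma>(2) t insert.hyps(2) by auto
  ultimately show ?case by metis
qed

section \<open>Powers of the ideal of an abelian normal subgroup\<close>

lemma (in finite_group) cpow_add:
  assumes "u \<in> galg G"
  shows "conv G (cpow G u m) (cpow G u n) = cpow G u (m + n)"
  by (induction m) (simp_all add: conv_one conv_assoc assms)

locale abelian_normal = p_group G p for G (structure) and p +
  fixes N S :: "'a set" and F :: "'f::field itself"
  assumes N: "N \<lhd> G" and NA: "abelian_p_group (G\<lparr>carrier := N\<rparr>) p"
    and S: "abelian_p_group.basis (G\<lparr>carrier := N\<rparr>) S N" and char: "CHAR('f) = p"
begin

sublocale N: normal N G by (rule N)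
sublocale NA: abelian_p_group "G\<lparr>carrier := N\<rparr>" p by (rule NA)

abbreviation aN :: "('a \<Rightarrow> 'f) set" where "aN \<equiv> fv.span (delta ` N)"

text \<open>The group algebra of \<open>N\<close> as a commutative monoid, so that
  \<open>finprod\<close> can form the monomials.\<close>

definition aNm :: "('a \<Rightarrow> 'f) monoid" where
  "aNm = \<lparr>carrier = aN, monoid.mult = conv G, one = delta \<one>\<rparr>"

lemma S_props: "S \<subseteq> N" "finite S" using S unfolding NA.basis_def by auto

lemma aN_in_galg: "aN \<subseteq> galg G"
  by (rule fv.span_minimal[OF _ galg_subspace]) auto

lemma delta_aN: "n \<in> N \<Longrightarrow> delta n \<in> aN" by (intro fv.span_base imageI)

lemma conv_aN:
  assumes "u \<in> aN" "v \<in> aN"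
  shows "conv G u v \<in> aN"
proof (rule conv_span_mem[OF fv.subspace_span assms])
  fix s t :: "'a \<Rightarrow> 'f" assume "s \<in> delta ` N" "t \<in> delta ` N"
  then obtain a b where "s = delta a" "t = delta b" "a \<in> N" "b \<in> N" by blast
  then show "conv G s t \<in> aN" using delta_aN[of "a \<otimes> b"] by (simp add: conv_delta)
qed

lemma conv_aN_commute:
  assumes u: "u \<in> aN" and v: "v \<in> aN"
  shows "conv G u v = conv G v u"
proof -
  have zero: "fv.subspace {0 :: 'a \<Rightarrow> 'f}" by (rule fv.subspace_single_0)
  have 1: "conv G (delta n) v = conv G v (delta n)" if n: "n \<in> N" and v: "v \<in> aN" for n v
  proof -
    have "aN \<subseteq> {m. conv G (delta n) m - conv G m (delta n) \<in> {0}}"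
    proof (rule fv.span_minimal[OF _ commutator_subspace[OF zero]], rule subsetI)
      fix m :: "'a \<Rightarrow> 'f" assume "m \<in> delta ` N"
      then obtain k where k: "m = delta k" "k \<in> N" by blast
      have "n \<otimes> k = k \<otimes> n" using NA.m_comm n k(2) by simp
      then show "m \<in> {m. conv G (delta n) m - conv G m (delta n) \<in> {0}}" using n k by (simp add: conv_delta)
    qed
    then show ?thesis using v by auto
  qed
  have "aN \<subseteq> {m. conv G v m - conv G m v \<in> {0}}"
    by (rule fv.span_minimal[OF _ commutator_subspace[OF zero]]) (use 1[OF _ v] in auto)
  then show ?thesis using u by auto
qed

sublocale aNm: comm_monoid aNm
proof (rule comm_monoidI)
  fix u v w assume uvw: "u \<in> carrier aNm" "v \<in> carrier aNm" "w \<in> carrier aNm"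
  then have g: "u \<in> galg G" "v \<in> galg G" "w \<in> galg G" using aN_in_galg unfolding aNm_def by auto
  show "u \<otimes>\<^bsub>aNm\<^esub> v \<otimes>\<^bsub>aNm\<^esub> w = u \<otimes>\<^bsub>aNm\<^esub> (v \<otimes>\<^bsub>aNm\<^esub> w)" using conv_assoc[OF g] by (simp add: aNm_def)
next
  fix u assume "u \<in> carrier aNm"
  then have "u \<in> galg G" using aN_in_galg unfolding aNm_def by auto
  then show "\<one>\<^bsub>aNm\<^esub> \<otimes>\<^bsub>aNm\<^esub> u = u" by (simp add: aNm_def conv_one)
qed (auto simp: aNm_def conv_aN conv_aN_commute delta_aN)

abbreviation cp :: "'a \<Rightarrow> nat \<Rightarrow> 'a \<Rightarrow> 'f" where "cp s i \<equiv> cpow G (delta s - delta \<one>) i"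

definition E :: "('a \<Rightarrow> nat) \<Rightarrow> 'a \<Rightarrow> 'f" where
  "E k = finprod aNm (\<lambda>s. cp s (k s)) S"

abbreviation deg :: "('a \<Rightarrow> nat) \<Rightarrow> nat" where "deg k \<equiv> \<Sum>s\<in>S. k s"

lemma diff_aN: "s \<in> N \<Longrightarrow> delta s - delta \<one> \<in> aN"
  by (intro fv.span_diff delta_aN) auto

lemma cp_aN: "s \<in> N \<Longrightarrow> cp s i \<in> aN"
  by (induction i) (auto intro: conv_aN delta_aN diff_aN)

lemma cp_funcset: "(\<lambda>s. cp s (k s)) \<in> S \<rightarrow> carrier aNm"
  using cp_aN S_props(1) by (auto simp: aNm_def)

lemma E_aN: "E k \<in> aN"
  using aNm.finprod_closed[OF cp_funcset, of k] unfolding E_def by (simp add: aNm_def)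

lemma E_galg [simp]: "E k \<in> galg G"
  using E_aN aN_in_galg by blast

lemma E_add: "E (\<lambda>s. k s + l s) = conv G (E k) (E l)"
proof -
  have "E (\<lambda>s. k s + l s) = finprod aNm (\<lambda>s. cp s (k s) \<otimes>\<^bsub>aNm\<^esub> cp s (l s)) S"
    unfolding E_def
  proof (rule aNm.finprod_cong')
    show "(\<lambda>s. cp s (k s) \<otimes>\<^bsub>aNm\<^esub> cp s (l s)) \<in> S \<rightarrow> carrier aNm"
      using cp_funcset[of k] cp_funcset[of l] by (auto intro!: aNm.m_closed)
    fix s assume "s \<in> S"
    then have "(delta s - delta \<one> :: 'a \<Rightarrow> 'f) \<in> galg G" using diff_aN S_props(1) aN_in_galg by blast
    then show "cp s (k s + l s) = cp s (k s) \<otimes>\<^bsub>aNm\<^esub> cp s (l s)" by (simp add: aNm_def cpow_add)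
  qed simp
  also have "\<dots> = conv G (E k) (E l)"
    using aNm.finprod_multf[OF cp_funcset cp_funcset, of k l] unfolding E_def by (simp add: aNm_def)
  finally show ?thesis .
qed

lemma E_zero: "E (\<lambda>s. 0) = delta \<one>"
  unfolding E_def using aNm.finprod_one_eqI[of S] by (simp add: aNm_def)

lemma E_single:
  assumes "s \<in> S"
  shows "E (\<lambda>x. if x = s then i else 0) = cp s i"
proof -
  have "E (\<lambda>x. if x = s then i else 0) = finprod aNm (\<lambda>x. if s = x then cp x i else \<one>\<^bsub>aNm\<^esub>) S"
    unfolding E_def using S_props(1) delta_aN[OF N.one_closed]
    by (intro aNm.finprod_cong') (auto simp: aNm_def subset_iff cp_aN)
  also have "\<dots> = cp s i"
    using cp_funcset[of "\<lambda>_. i"] by (intro aNm.finprod_singleton assms S_props(2)) auto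
  finally show ?thesis .
qed

lemma E_single_one: "s \<in> S \<Longrightarrow> E (\<lambda>x. if x = s then 1 else 0) = delta s - delta \<one>"
  using E_single[of s 1] conv_one(2)[of "delta s - delta \<one> :: 'a \<Rightarrow> 'f"] diff_aN[of s] S_props(1) aN_in_galg
  by (simp add: subset_iff)

lemma NA_ord: "n \<in> N \<Longrightarrow> NA.ord n = ord n"
  unfolding NA.ord_def ord_def by (simp add: nat_pow_def)

text \<open>The order of s is a power of the characteristic, so (s-1)^(ord s) = s^(ord s) - 1 =
  0.\<close>

lemma E_vanish:
  assumes s: "s \<in> S" and k: "ord s \<le> k s"
  shows "E k = 0"
proof -
  have sG: "s \<in> carrier G" using s S_props(1) by auto
  obtain e where e: "ord s = CHAR('f) ^ e" using dvd_orderD[OF ord_dvd_group_order[OF sG]] char by blast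
  have "cp s (ord s) = 0"
    using cpow_delta_diff[OF sG, of e, where 'f='f] prime_p char pow_ord_eq_1[OF sG] unfolding e[symmetric] by simp
  then have "E (\<lambda>x. if x = s then ord s else 0) = 0" using E_single[OF s] by simp
  moreover have "E k = conv G (E (\<lambda>x. if x = s then ord s else 0)) (E (\<lambda>x. if x = s then k s - ord s else k x))"
    unfolding E_add[symmetric] using k by (intro arg_cong[of _ _ E]) auto
  ultimately show ?thesis by simp
qed

lemma E_restrict: "E (restrict k S) = E k"
  unfolding E_def using cp_funcset by (intro aNm.finprod_cong') auto

text \<open>This is the n-th power of the augmentation ideal of the group algebra of
  \<open>N\<close>, described by monomials of degree at least n.\<close>

definition M :: "nat \<Rightarrow> ('a \<Rightarrow> 'f) set" where "M n = fv.span {E k | k. n \<le> deg k}"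

lemma M_subspace: "fv.subspace (M n)" unfolding M_def by simp

lemma E_in_M: "n \<le> deg k \<Longrightarrow> E k \<in> M n" unfolding M_def by (intro fv.span_base) blast

lemma M_mult: "u \<in> M a \<Longrightarrow> v \<in> M b \<Longrightarrow> conv G u v \<in> M (a + b)"
  unfolding M_def[of a] M_def[of b]
  by (erule conv_span_mem[OF M_subspace]) (auto simp: E_add[symmetric] sum.distrib intro!: E_in_M)

lemma M_in_galg: "M n \<subseteq> galg G"
  unfolding M_def by (rule fv.span_minimal[OF _ galg_subspace]) auto

text \<open>In a finite group inverses are positive powers, so closure under products
  suffices.\<close>

lemma basis_induct:
  assumes one: "P \<one>" and S: "\<And>s. s \<in> S \<Longrightarrow> P s"
    and mult: "\<And>x y. x \<in> N \<Longrightarrow> y \<in> N \<Longrightarrow> P x \<Longrightarrow> P y \<Longrightarrow> P (x \<otimes> y)" and n: "n \<in> N"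
  shows "P n"
proof -
  let ?T = "{x \<in> N. P x}"
  have pow: "x [^] (i::nat) \<in> ?T" if "x \<in> ?T" for x i
    by (induction i) (use that one mult in auto)
  have "subgroup ?T G"
  proof (rule subgroupI)
    show "?T \<subseteq> carrier G" by auto
    have "\<one> \<in> ?T" using one by simp
    then show "?T \<noteq> {}" by blast
    show "x \<otimes> y \<in> ?T" if "x \<in> ?T" "y \<in> ?T" for x y using that mult by auto
    fix x assume x: "x \<in> ?T"
    then have xG: "x \<in> carrier G" by auto
    have "Coset.order G > 0" using finite_carrier order_gt_0_iff_finite by blast
    then obtain m where m: "Coset.order G = Suc m" by (cases "Coset.order G") auto
    have "x [^] m \<otimes> x = \<one>" using pow_order_eq_1[OF xG] unfolding m by simp
    then have "inv x = x [^] m" using xG by (intro inv_equality) auto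
    then show "inv x \<in> ?T" using pow[OF x] by simp
  qed
  then have "subgroup ?T (G\<lparr>carrier := N\<rparr>)" using N.is_subgroup by (intro subgroup_incl) auto
  moreover obtain k where "n = NA.lincomb S k" using abelian_normal.S[OF abelian_normal_axioms] n unfolding NA.basis_def by blast
  ultimately show ?thesis using NA.lincomb_mem[of ?T S k] S_props S by auto
qed

lemma delta_in_M:
  assumes "n \<in> N"
  shows "delta n \<in> M 0" "delta n - delta \<one> \<in> M 1"
proof -
  have d0: "delta \<one> \<in> M 0" using E_in_M[of 0 "\<lambda>s. 0"] E_zero by simp
  have s1: "(delta s - delta \<one> :: 'a \<Rightarrow> 'f) \<in> M 1" if "s \<in> S" for s
    using E_in_M[of 1 "\<lambda>x. if x = s then 1 else 0"] E_single_one[OF that] that S_props(2) by simp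
  have s0: "(delta s - delta \<one> :: 'a \<Rightarrow> 'f) \<in> M 0" if "s \<in> S" for s
    using E_in_M[of 0 "\<lambda>x. if x = s then 1 else 0"] E_single_one[OF that] by simp
  have m0: "delta n \<in> M 0" if "n \<in> N" for n
  proof (rule basis_induct[OF _ _ _ that])
    show "delta s \<in> M 0" if "s \<in> S" for s
      using fv.subspace_add[OF M_subspace s0[OF that] d0] by simp
    show "delta (x \<otimes> y) \<in> M 0" if "x \<in> N" "y \<in> N" "delta x \<in> M 0" "delta y \<in> M 0" for x y
      using M_mult[OF that(3,4)] that(1,2) by (simp add: conv_delta)
  qed (rule d0)
  show "delta n \<in> M 0" using m0[OF assms] .
  show "delta n - delta \<one> \<in> M 1"
  proof (rule basis_induct[OF _ s1 _ assms])
    show "delta \<one> - delta \<one> \<in> M 1" using fv.subspace_0[OF M_subspace] by simp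
    show "delta (x \<otimes> y) - delta \<one> \<in> M 1"
      if xy: "x \<in> N" "y \<in> N" "delta x - delta \<one> \<in> M 1" "delta y - delta \<one> \<in> M 1" for x y
    proof -
      have "conv G (delta x - delta \<one>) (delta y) + (delta y - delta \<one>) \<in> M 1"
      proof (rule fv.subspace_add[OF M_subspace _ xy(4)])
        show "conv G (delta x - delta \<one>) (delta y) \<in> M 1" using M_mult[OF xy(3) m0[OF xy(2)]] by simp
      qed
      then show ?thesis using xy(1,2) by (simp add: conv_linear conv_delta)
    qed
  qed
qed

text \<open>Write I for \<open>M 1\<close> and J for the ideal it generates. As J is two-sided, a
  group algebra factor standing before J is absorbed, so the factors from I collect on the left.
  Conversely a monomial of degree at least n is built by adding one factor s - 1 at a time.\<close>

lemma stab_ideal_pow_eq: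
  assumes J: "stab_ideal G = (nideal N :: ('a \<Rightarrow> 'f) set)"
  shows "stab_ideal_pow G n = sprod G (M n) (galg G)"
proof
  have J1: "nideal N \<subseteq> sprod G (M 1) (galg G)"
    unfolding nideal_eq_span[OF N.is_subgroup]
  proof (rule fv.span_minimal[OF _ sprod_subspace], rule subsetI)
    fix x :: "'a \<Rightarrow> 'f" assume "x \<in> {delta (c \<otimes> g) - delta g |c g. c \<in> N \<and> g \<in> carrier G}"
    then obtain c g where x: "x = delta (c \<otimes> g) - delta g" "c \<in> N" "g \<in> carrier G" by blast
    have "conv G (delta c - delta \<one>) (delta g) \<in> sprod G (M 1) (galg G)"
      by (rule sprodI[OF delta_in_M(2)[OF x(2)] delta_in_galg[OF x(3)]])
    then show "x \<in> sprod G (M 1) (galg G)" unfolding x(1) using x(2,3) by (simp add: conv_linear conv_delta)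
  qed
  show "stab_ideal_pow G n \<subseteq> sprod G (M n) (galg G)"
  proof (induction n)
    case 0
    have "u \<in> sprod G (M 0) (galg G)" if "u \<in> galg G" for u :: "'a \<Rightarrow> 'f"
    proof -
      have "conv G (delta \<one>) u \<in> sprod G (M 0) (galg G)"
        by (rule sprodI[OF delta_in_M(1)[OF N.one_closed] that])
      then show ?thesis unfolding conv_one(1)[OF that] .
    qed
    then show ?case by auto
  next
    case (Suc n)
    have "sprod G (stab_ideal_pow G n) (stab_ideal G) \<subseteq> sprod G (M (Suc n)) (galg G)"
    proof (rule sprod_minimal[OF sprod_subspace])
      fix u v :: "'a \<Rightarrow> 'f" assume u: "u \<in> stab_ideal_pow G n" and v: "v \<in> stab_ideal G"
      have vJ: "v \<in> nideal N" using v J by simp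
      have vg: "v \<in> galg G" using vJ nideal_in_galg by blast
      have u': "u \<in> fv.span {conv G m a | m a. m \<in> M n \<and> a \<in> galg G}" using Suc u unfolding sprod_def by blast
      show "conv G u v \<in> sprod G (M (Suc n)) (galg G)"
      proof (rule conv_span_mem[OF sprod_subspace u' fv.span_base[of v "{v}"]])
        fix s t :: "'a \<Rightarrow> 'f" assume "s \<in> {conv G m a | m a. m \<in> M n \<and> a \<in> galg G}" "t \<in> {v}"
        then obtain m a where ma: "s = conv G m a" "m \<in> M n" "a \<in> galg G" "t = v" by blast
        have mg: "m \<in> galg G" using ma(2) M_in_galg by blast
        \<comment> \<open>The factor \<open>a\<close> is absorbed here; the new factor from
          \<open>M 1\<close> is then merged with \<open>m\<close>.\<close>
        have "conv G a v \<in> sprod G (M 1) (galg G)" using nideal_ideal(2)[OF N vJ ma(3)] J1 by blast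
        then have av: "conv G a v \<in> fv.span {conv G m' b | m' b. m' \<in> M 1 \<and> b \<in> galg G}" unfolding sprod_def .
        have "conv G m (conv G a v) \<in> sprod G (M (Suc n)) (galg G)"
        proof (rule conv_span_mem[OF sprod_subspace fv.span_base[of m "{m}"] av])
          fix s t :: "'a \<Rightarrow> 'f" assume "s \<in> {m}" "t \<in> {conv G m' b | m' b. m' \<in> M 1 \<and> b \<in> galg G}"
          then obtain m' b where m': "s = m" "t = conv G m' b" "m' \<in> M 1" "b \<in> galg G" by blast
          have "conv G s t = conv G (conv G m m') b"
            using conv_assoc[OF mg subsetD[OF M_in_galg m'(3)] m'(4)] m'(1,2) by simp
          moreover have "conv G m m' \<in> M (Suc n)" using M_mult[OF ma(2) m'(3)] by simp
          ultimately show "conv G s t \<in> sprod G (M (Suc n)) (galg G)" using sprodI[OF _ m'(4)] by simp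
        qed simp
        then show "conv G s t \<in> sprod G (M (Suc n)) (galg G)" unfolding ma(1,4) using conv_assoc[OF mg ma(3) vg] by simp
      qed simp
    qed
    then show ?case by simp
  qed
  have Jr: "conv G u v \<in> stab_ideal_pow G n" if "u \<in> stab_ideal_pow G n" "v \<in> galg G" for u v :: "'a \<Rightarrow> 'f" and n
  proof (cases n)
    case (Suc m)
    show ?thesis unfolding Suc stab_ideal_pow.simps
    proof (rule conv_span_mem[OF sprod_subspace that(1)[unfolded Suc stab_ideal_pow.simps sprod_def] fv.span_base[of v "{v}"]])
      fix a b :: "'a \<Rightarrow> 'f" assume "a \<in> {conv G u v |u v. u \<in> stab_ideal_pow G m \<and> v \<in> stab_ideal G}" "b \<in> {v}"
      then obtain w w' where w: "a = conv G w w'" "w \<in> stab_ideal_pow G m" "w' \<in> stab_ideal G" "b = v" by blast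
      have "conv G a b = conv G w (conv G w' v)"
        using conv_assoc[OF subsetD[OF stab_ideal_pow_in_galg w(2)] subsetD[OF stab_ideal_in_galg w(3)] that(2)] w(1,4) by simp
      moreover have "conv G w' v \<in> stab_ideal G" unfolding J by (rule nideal_ideal(1)[OF N _ that(2)]) (use w(3) J in simp)
      ultimately show "conv G a b \<in> sprod G (stab_ideal_pow G m) (stab_ideal G)" using sprodI[OF w(2)] by simp
    qed simp
  qed simp
  have EJ: "E k \<in> stab_ideal_pow G n" if "n \<le> deg k" for k n
    using that
  proof (induction n arbitrary: k)
    case (Suc n)
    then have "deg k \<noteq> 0" by simp
    then obtain s where s: "s \<in> S" "k s > 0" by (metis gr0I sum.neutral)
    \<comment> \<open>One factor s - 1 is split off at a place with positive exponent.\<close>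
    define l where "l = (\<lambda>x. if x = s then k s - 1 else k x)"
    have kl: "k = (\<lambda>x. l x + (if x = s then 1 else 0))" unfolding l_def using s by auto
    have "deg k = deg l + 1" by (subst kl) (simp add: sum.distrib s(1) S_props(2))
    then have "E l \<in> stab_ideal_pow G n" using Suc by simp
    moreover have "(delta s - delta \<one> :: 'a \<Rightarrow> 'f) \<in> stab_ideal G"
      unfolding J by (rule nidealI_one[OF N.is_subgroup]) (use s S_props in blast)
    ultimately have "conv G (E l) (delta s - delta \<one>) \<in> stab_ideal_pow G (Suc n)" by (simp add: sprodI)
    then show ?case by (subst kl) (simp only: E_add E_single_one[OF s(1)])
  qed simp
  have "M n \<subseteq> stab_ideal_pow G n"
    unfolding M_def by (rule fv.span_minimal[OF _ stab_ideal_pow_subspace]) (use EJ in auto)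
  then show "sprod G (M n) (galg G) \<subseteq> stab_ideal_pow G n"
    by (intro sprod_minimal[OF stab_ideal_pow_subspace] Jr) auto
qed

text \<open>Monomials with exponents below the orders, times a transversal of N, span each power of
  the ideal when their degrees are at least n. For n = 0 they span the whole algebra and are no more
  than its dimension, so they are independent, and so is every part of them.\<close>

lemma dim_stab_ideal_pow:
  assumes J: "stab_ideal G = (nideal N :: ('a \<Rightarrow> 'f) set)"
  shows "fv.dim (stab_ideal_pow G n :: ('a \<Rightarrow> 'f) set) =
    card {k \<in> PiE S (\<lambda>s. {..<ord s}). n \<le> deg k} * card (rcosets N)"
proof -
  define T where "T = (\<lambda>C. SOME t. t \<in> C) ` (rcosets N)"
  have rep: "(SOME t. t \<in> C) \<in> C" if "C \<in> rcosets N" for C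
    using N.rcosets_non_empty[OF that] by (metis ex_in_conv someI)
  have TG: "T \<subseteq> carrier G" unfolding T_def using rep N.rcosets_carrier[OF is_group] by blast
  have repc: "N #> (SOME t. t \<in> C) = C" if C: "C \<in> rcosets N" for C
  proof -
    obtain g where "g \<in> carrier G" "C = N #> g" using C unfolding RCOSETS_def by blast
    then show ?thesis using repr_independence[of _ N g] rep[OF C] N.is_subgroup by simp
  qed
  have "inj_on (\<lambda>C. SOME t. t \<in> C) (rcosets N)"
    by (rule inj_on_inverseI[where g = "\<lambda>t. N #> t"]) (rule repc)
  then have cT: "card T = card (rcosets N)" unfolding T_def by (rule card_image)
  have finT: "finite T" using TG finite_carrier finite_subset by blast
  have dec: "\<exists>n\<in>N. \<exists>t\<in>T. g = n \<otimes> t" if g: "g \<in> carrier G" for g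
  proof -
    have C: "N #> g \<in> rcosets N" using g N.subset by (rule rcosetsI[rotated])
    let ?t = "SOME t. t \<in> N #> g"
    have "g \<in> N #> ?t" using repc[OF C] rcos_self[OF g N.is_subgroup] by simp
    then obtain n where "n \<in> N" "g = n \<otimes> ?t" unfolding r_coset_def by blast
    then show ?thesis unfolding T_def using C by blast
  qed
  let ?K = "PiE S (\<lambda>s. {..<ord s})"
  let ?b = "\<lambda>(k, t). conv G (E k) (delta t) :: 'a \<Rightarrow> 'f"
  let ?I = "\<lambda>n. {k \<in> ?K. n \<le> deg k} \<times> T"
  have finK: "finite ?K" using S_props(2) by (intro finite_PiE) auto
  have span: "sprod G (M n) (galg G) = fv.span (?b ` ?I n)" for n
  proof
    show "fv.span (?b ` ?I n) \<subseteq> sprod G (M n) (galg G)"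
      by (rule fv.span_minimal[OF _ sprod_subspace]) (use TG in \<open>auto intro!: sprodI E_in_M\<close>)
    have M': "M n \<subseteq> fv.span {E k | k. k \<in> ?K \<and> n \<le> deg k}"
      unfolding M_def
    proof (rule fv.span_minimal[OF _ fv.subspace_span], rule subsetI)
      fix x assume "x \<in> {E k |k. n \<le> deg k}"
      then obtain k where k: "x = E k" "n \<le> deg k" by blast
      show "x \<in> fv.span {E k | k. k \<in> ?K \<and> n \<le> deg k}"
      \<comment> \<open>A monomial with some exponent reaching \<open>ord s\<close> is zero; any
        other one already has reduced exponents.\<close>
      proof (cases "\<exists>s\<in>S. ord s \<le> k s")
        case True
        then show ?thesis using E_vanish k(1) by (auto simp: fv.span_zero)
      next
        case False
        then have "restrict k S \<in> ?K" by auto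
        moreover have "deg (restrict k S) = deg k" by simp
        ultimately have "E (restrict k S) \<in> {E k | k. k \<in> ?K \<and> n \<le> deg k}"
          using k(2) by (intro CollectI exI[of _ "restrict k S"] conjI refl) simp_all
        then show ?thesis unfolding k(1) E_restrict by (rule fv.span_base)
      qed
    qed
    show "sprod G (M n) (galg G) \<subseteq> fv.span (?b ` ?I n)"
    proof (rule sprod_minimal[OF fv.subspace_span])
      fix u v :: "'a \<Rightarrow> 'f" assume u: "u \<in> M n" and v: "v \<in> galg G"
      show "conv G u v \<in> fv.span (?b ` ?I n)"
      proof (rule conv_span_mem[OF fv.subspace_span fv.span_base[of u "{u}"] v[unfolded galg_eq_span]])
        fix s t :: "'a \<Rightarrow> 'f" assume st: "s \<in> {u}" "t \<in> delta ` carrier G"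
        then obtain g where g: "t = delta g" "g \<in> carrier G" by blast
        obtain c y where cy: "c \<in> N" "y \<in> T" "g = c \<otimes> y" using dec[OF g(2)] by blast
        have yG: "y \<in> carrier G" using cy(2) TG by blast
        have ug: "u \<in> galg G" using u M_in_galg by blast
        have "conv G s t = conv G (conv G u (delta c)) (delta y)"
          using conv_assoc[OF ug, of "delta c" "delta y"] st(1) g(1) cy yG by (simp add: conv_delta)
        moreover have "conv G u (delta c) \<in> fv.span {E k | k. k \<in> ?K \<and> n \<le> deg k}"
          using M_mult[OF u delta_in_M(1)[OF cy(1)]] M' by auto
        then have "conv G (conv G u (delta c)) (delta y) \<in> fv.span (?b ` ?I n)"
        proof (rule conv_span_mem[OF fv.subspace_span _ fv.span_base[of "delta y" "{delta y}"]])
          fix s t :: "'a \<Rightarrow> 'f" assume "s \<in> {E k | k. k \<in> ?K \<and> n \<le> deg k}" "t \<in> {delta y}"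
          then obtain k where "s = E k" "k \<in> ?K" "n \<le> deg k" "t = delta y" by blast
          then show "conv G s t \<in> fv.span (?b ` ?I n)" using cy(2) by (intro fv.span_base) (auto intro!: image_eqI[of _ _ "(k, y)"])
        qed simp
        ultimately show "conv G s t \<in> fv.span (?b ` ?I n)" by simp
      qed simp
    qed
  qed
  have I0: "?I 0 = ?K \<times> T" by simp
  have whole: "fv.span (?b ` (?K \<times> T)) = galg G"
    using span[of 0] stab_ideal_pow_eq[OF J, of 0] by simp
  have finI: "finite (?K \<times> T)" using finK finT by simp
  have "card (?K \<times> T) = card (carrier G)"
  proof -
    have "card ?K = (\<Prod>s\<in>S. ord s)" using S_props(2) by (simp add: card_PiE)
    also have "\<dots> = (\<Prod>s\<in>S. NA.ord s)" using NA_ord S_props(1) by (intro prod.cong) auto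
    also have "\<dots> = card N" using NA.prod_ord_basis[of S] S by simp
    finally show ?thesis using lagrange[OF N.is_subgroup] cT by (simp add: card_cartesian_product Coset.order_def mult.commute)
  qed
  then have cd: "card (?K \<times> T) = fv.dim (fv.span (?b ` (?K \<times> T)))"
    unfolding whole dim_galg .
  have ind: "fv.independent (?b ` (?K \<times> T))"
    using fv.independent_of_card_le_dim[of "?b ` (?K \<times> T)"] finI card_image_le[OF finI, of ?b] cd by simp
  have "card (?b ` (?K \<times> T)) = card (?K \<times> T)" using fv.dim_span_eq_card_independent[OF ind] cd by simp
  then have inj: "inj_on ?b (?K \<times> T)" using finI by (rule eq_card_imp_inj_on[rotated])
  have sub: "?I n \<subseteq> ?K \<times> T" by blast
  have "fv.dim (stab_ideal_pow G n :: ('a \<Rightarrow> 'f) set) = card (?b ` ?I n)"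
    unfolding stab_ideal_pow_eq[OF J] span
    using fv.independent_mono[OF ind image_mono[OF sub]] by (rule fv.dim_span_eq_card_independent)
  also have "\<dots> = card (?I n)" using inj_on_subset[OF inj sub] by (rule card_image)
  finally show ?thesis using cT by (simp add: card_cartesian_product)
qed

end

section \<open>Counting exponents, and conclusion\<close>

lemma prod_monom_one: "finite S \<Longrightarrow> (\<Prod>s\<in>S. monom 1 (k s) :: int poly) = monom 1 (\<Sum>s\<in>S. k s)"
  by (induction S rule: finite_induct) (simp_all add: mult_monom)

text \<open>The coefficient at n counts the exponent functions with sum n, which is the difference
  of the counts for sums at least n and at least n + 1.\<close>

lemma prod_geometric_eq_of_counts:
  fixes q :: "'a \<Rightarrow> nat" and r :: "'b \<Rightarrow> nat"
  assumes fin: "finite S" "finite T"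
    and eq: "\<And>n. card {k \<in> PiE S (\<lambda>s. {..<q s}). n \<le> (\<Sum>s\<in>S. k s)} = card {k \<in> PiE T (\<lambda>s. {..<r s}). n \<le> (\<Sum>s\<in>T. k s)}"
  shows "(\<Prod>s\<in>S. \<Sum>i<q s. monom 1 i :: int poly) = (\<Prod>s\<in>T. \<Sum>i<r s. monom 1 i)"
proof (rule poly_eqI)
  fix n
  have cf: "coeff (\<Prod>s\<in>A. \<Sum>i<f s. monom 1 i :: int poly) n =
      int (card {k \<in> PiE A (\<lambda>s. {..<f s}). n \<le> (\<Sum>s\<in>A. k s)}) - int (card {k \<in> PiE A (\<lambda>s. {..<f s}). Suc n \<le> (\<Sum>s\<in>A. k s)})"
    if A: "finite A" for A :: "'c set" and f
  proof -
    let ?K = "PiE A (\<lambda>s. {..<f s})"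
    have finK: "finite ?K" using A by (intro finite_PiE) auto
    have "(\<Prod>s\<in>A. \<Sum>i<f s. monom 1 i :: int poly) = (\<Sum>k\<in>?K. \<Prod>s\<in>A. monom 1 (k s))"
      using A by (intro prod_sum_PiE) auto
    also have "\<dots> = (\<Sum>k\<in>?K. monom 1 (\<Sum>s\<in>A. k s))" using prod_monom_one[OF A] by simp
    finally have "coeff (\<Prod>s\<in>A. \<Sum>i<f s. monom 1 i :: int poly) n = (\<Sum>k\<in>?K. if (\<Sum>s\<in>A. k s) = n then 1 else 0)"
      by (simp add: coeff_sum)
    also have "\<dots> = int (card {k \<in> ?K. (\<Sum>s\<in>A. k s) = n})" using finK by (simp add: sum.If_cases Int_def)
    also have "card {k \<in> ?K. n \<le> (\<Sum>s\<in>A. k s)} = card {k \<in> ?K. (\<Sum>s\<in>A. k s) = n} + card {k \<in> ?K. Suc n \<le> (\<Sum>s\<in>A. k s)}"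
    proof -
      define d where "d k = (\<Sum>s\<in>A. k s)" for k :: "'c \<Rightarrow> nat"
      have "{k \<in> ?K. n \<le> d k} = {k \<in> ?K. d k = n} \<union> {k \<in> ?K. Suc n \<le> d k}" by auto
      moreover have "{k \<in> ?K. d k = n} \<inter> {k \<in> ?K. Suc n \<le> d k} = {}" by auto
      ultimately show ?thesis unfolding d_def[symmetric] using finK by (simp add: card_Un_disjoint)
    qed
    then have "int (card {k \<in> ?K. (\<Sum>s\<in>A. k s) = n}) =
      int (card {k \<in> ?K. n \<le> (\<Sum>s\<in>A. k s)}) - int (card {k \<in> ?K. Suc n \<le> (\<Sum>s\<in>A. k s)})" by simp
    finally show ?thesis .
  qed
  show "coeff (\<Prod>s\<in>S. \<Sum>i<q s. monom 1 i :: int poly) n = coeff (\<Prod>s\<in>T. \<Sum>i<r s. monom 1 i) n"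
    unfolding cf[OF fin(1)] cf[OF fin(2)] eq ..
qed

lemma (in p_group) abelian_normal_section_centralizer:
  assumes ab: "\<And>x y. x \<in> section_centralizer G \<Longrightarrow> y \<in> section_centralizer G \<Longrightarrow> y \<otimes> x = x \<otimes> y"
    and char: "CHAR('f::field) = p"
  shows "\<exists>S. abelian_normal TYPE('f) G p (section_centralizer G) S"
proof -
  let ?N = "section_centralizer G"
  have NS: "subgroup ?N G" using normal_imp_subgroup section_centralizer_normal(1) by blast
  interpret N: p_group "G\<lparr>carrier := ?N\<rparr>" p using subgroup_p_group[OF NS] .
  have "comm_group (G\<lparr>carrier := ?N\<rparr>)" by (rule N.group_comm_groupI) (use ab in simp)
  then have A: "abelian_p_group (G\<lparr>carrier := ?N\<rparr>) p"
    using N.p_group_axioms by (simp add: abelian_p_group_def)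
  interpret A: abelian_p_group "G\<lparr>carrier := ?N\<rparr>" p by (rule A)
  obtain S where "A.basis S ?N" using A.ex_basis[OF N.subgroup_self] by auto
  then show ?thesis using section_centralizer_normal(1) A char p_group_axioms
    by (auto simp: abelian_normal_def abelian_normal_axioms_def)
qed

theorem proposition8:
  fixes p :: nat
    and G :: "('g, 'm) monoid_scheme"
    and H :: "('h, 'n) monoid_scheme"
    and N :: "'g set"
  assumes "Factorial_Ring.prime p"
    and "CHAR('f::field) = p"
    and "finite_p_group p G"
    and "two_generated G"
    and "N = section_centralizer G"
    and "comm_group (G\<lparr>carrier := N\<rparr>)"
    and "card (rcosets\<^bsub>G\<^esub> N) = p"
    and "finite_p_group p H"
    and "algebra_isomorphic (group_algebra G :: ('f, 'g \<Rightarrow> 'f) module)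
           (group_algebra H :: ('f, 'h \<Rightarrow> 'f) module)"
  shows "H\<lparr>carrier := section_centralizer H\<rparr> \<cong> G\<lparr>carrier := N\<rparr>"
proof -
  interpret G: p_group G p using p_groupI assms(1,3) .
  interpret H: p_group H p using p_groupI assms(1,8) .
  let ?N = "section_centralizer G" and ?M = "section_centralizer H"
  let ?D = "commutator_subgroup G" and ?E = "commutator_subgroup H"
  have NS: "subgroup ?N G" and MS: "subgroup ?M H"
    using normal_imp_subgroup G.section_centralizer_normal(1) H.section_centralizer_normal(1) by blast+
  obtain \<phi> :: "('g \<Rightarrow> 'f) \<Rightarrow> 'h \<Rightarrow> 'f" where "galg_iso G H \<phi>"
    using galg_iso_of_algebra_isomorphic[OF G.p_group_axioms H.p_group_axioms assms(2,9)] by blast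
  then interpret \<phi>: galg_iso G H \<phi> .
  have p0: "p > 0" using prime_gt_0_nat[OF assms(1)] .
  have cardGH: "card (carrier G) = card (carrier H)" by (rule \<phi>.card_eq)
  have rcN: "card (rcosets\<^bsub>G\<^esub> ?N) = p" using assms(5,7) by simp
  have JG: "stab_ideal G = (G.nideal ?N :: ('g \<Rightarrow> 'f) set)" and JH: "stab_ideal H = (H.nideal ?M :: ('h \<Rightarrow> 'f) set)"
    using G.stab_ideal_eq[OF assms(2)] H.stab_ideal_eq[OF assms(2)] .
  \<comment> \<open>The codimension of \<open>stab_ideal\<close> is the index of the section
    centralizer.\<close>
  have rcM: "card (rcosets\<^bsub>H\<^esub> ?M) = p"
    using G.dim_nideal[of ?N, where 'f='f] H.dim_nideal[of ?M, where 'f='f] \<phi>.dim_stab_ideal cardGH rcN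
    unfolding JG JH by linarith
  have idx: "card (carrier G) = p * card ?N" "card (carrier H) = p * card ?M"
    using G.lagrange[OF NS] H.lagrange[OF MS] rcN rcM by (simp_all add: Coset.order_def)
  have abG: "y \<otimes>\<^bsub>G\<^esub> x = x \<otimes>\<^bsub>G\<^esub> y" if "x \<in> ?N" "y \<in> ?N" for x y
    using comm_groupE(4)[OF assms(6), of y x] that assms(5) by simp
  have "card (rcosets\<^bsub>G\<^esub> ?D) = card (rcosets\<^bsub>H\<^esub> ?E)"
    using G.dim_nideal[of ?D, where 'f='f] H.dim_nideal[of ?E, where 'f='f] \<phi>.dim_comm_ideal cardGH
    unfolding G.comm_ideal_eq H.comm_ideal_eq by linarith
  moreover have "card (rcosets\<^bsub>G\<^esub> ?D) * card ?D = card (carrier G)" "card (rcosets\<^bsub>H\<^esub> ?E) * card ?E = card (carrier H)"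
    using G.lagrange[OF G.derived_is_subgroup] H.lagrange[OF H.derived_is_subgroup] by (simp_all add: Coset.order_def)
  moreover have "card (carrier G) > 0" using G.finite_carrier G.one_closed by (metis card_gt_0_iff empty_iff)
  ultimately have cardD: "card ?D = card ?E" using cardGH by (metis mult_cancel1 mult_is_0 neq0_conv)
  \<comment> \<open>The codimension of \<open>lie_span\<close> is the number of conjugacy
    classes.\<close>
  have "card ((\<lambda>g. (\<lambda>h. inv\<^bsub>G\<^esub> h \<otimes>\<^bsub>G\<^esub> g \<otimes>\<^bsub>G\<^esub> h) ` carrier G) ` carrier G) =
    card ((\<lambda>g. (\<lambda>h. inv\<^bsub>H\<^esub> h \<otimes>\<^bsub>H\<^esub> g \<otimes>\<^bsub>H\<^esub> h) ` carrier H) ` carrier H)"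
    using fiber_diffs_iff(2)[OF G.finite_carrier, of "\<lambda>g. (\<lambda>h. inv\<^bsub>G\<^esub> h \<otimes>\<^bsub>G\<^esub> g \<otimes>\<^bsub>G\<^esub> h) ` carrier G", where 'f='f]
      fiber_diffs_iff(2)[OF H.finite_carrier, of "\<lambda>g. (\<lambda>h. inv\<^bsub>H\<^esub> h \<otimes>\<^bsub>H\<^esub> g \<otimes>\<^bsub>H\<^esub> h) ` carrier H", where 'f='f]
      \<phi>.dim_lie_span cardGH unfolding G.lie_span_eq H.lie_span_eq by linarith
  then have cp: "commuting_pairs G = commuting_pairs H"
    unfolding G.commuting_pairs_eq H.commuting_pairs_eq using cardGH by simp
  have abH: "y \<otimes>\<^bsub>H\<^esub> x = x \<otimes>\<^bsub>H\<^esub> y" if "x \<in> ?M" "y \<in> ?M" for x y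
    using section_centralizer_abelian_transfer[OF G.p_group_axioms H.p_group_axioms assms(2)
      \<phi>.dependent_homs_transfer[OF assms(4)] idx abG cardGH cardD cp] that by blast
  obtain S where "abelian_normal TYPE('f) G p ?N S"
    using G.abelian_normal_section_centralizer[OF abG assms(2)] by blast
  then interpret AG: abelian_normal G p ?N S "TYPE('f)" .
  obtain T where "abelian_normal TYPE('f) H p ?M T"
    using H.abelian_normal_section_centralizer[OF abH assms(2)] by blast
  then interpret AH: abelian_normal H p ?M T "TYPE('f)" .
  have "card {k \<in> PiE S (\<lambda>s. {..<G.ord s}). n \<le> (\<Sum>s\<in>S. k s)} = card {k \<in> PiE T (\<lambda>s. {..<H.ord s}). n \<le> (\<Sum>s\<in>T. k s)}" for n
    using AG.dim_stab_ideal_pow[OF JG, of n] AH.dim_stab_ideal_pow[OF JH, of n] \<phi>.dim_stab_ideal_pow[of n] rcN rcM p0 by simp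
  then have prod: "(\<Prod>s\<in>S. \<Sum>i<G.ord s. monom 1 i :: int poly) = (\<Prod>s\<in>T. \<Sum>i<H.ord s. monom 1 i)"
    by (rule prod_geometric_eq_of_counts[OF AG.S_props(2) AH.S_props(2)])
  have oS: "G.ord s \<ge> 2" if "s \<in> S" for s
    using AG.NA.ord_basis[of S s] AG.S AG.NA_ord[of s] AG.S_props(1) that by auto
  have oT: "H.ord s \<ge> 2" if "s \<in> T" for s
    using AH.NA.ord_basis[of T s] AH.S AH.NA_ord[of s] AH.S_props(1) that by auto
  have "image_mset G.ord (mset_set S) = image_mset H.ord (mset_set T)"
  proof (rule mset_eq_of_prod_geometric)
    show "\<forall>q\<in>#image_mset G.ord (mset_set S). 2 \<le> q" using oS AG.S_props(2) by simp
    show "\<forall>q\<in>#image_mset H.ord (mset_set T). 2 \<le> q" using oT AH.S_props(2) by simp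
    show "(\<Prod>q\<in>#image_mset G.ord (mset_set S). \<Sum>i<q. monom 1 i :: int poly) =
      (\<Prod>q\<in>#image_mset H.ord (mset_set T). \<Sum>i<q. monom 1 i)"
      using prod by (simp add: prod_unfold_prod_mset image_mset.compositionality comp_def)
  qed
  \<comment> \<open>The bijection runs from \<open>T\<close> to \<open>S\<close> because the
    required isomorphism starts in H.\<close>
  then obtain \<sigma> where \<sigma>: "bij_betw \<sigma> T S" "\<forall>t\<in>T. G.ord (\<sigma> t) = H.ord t"
    using ex_bij_betw_of_image_mset_eq[OF AH.S_props(2) AG.S_props(2), of H.ord G.ord] by metis
  have "H\<lparr>carrier := ?M\<rparr> \<cong> G\<lparr>carrier := ?N\<rparr>"
  proof (rule abelian_p_group_iso[OF AH.NA AG.NA _ _ \<sigma>(1)])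
    show "AH.NA.basis T (carrier (H\<lparr>carrier := ?M\<rparr>))" "AG.NA.basis S (carrier (G\<lparr>carrier := ?N\<rparr>))"
      using AH.S AG.S by simp_all
    fix t assume t: "t \<in> T"
    have "\<sigma> t \<in> ?N" "t \<in> ?M" using \<sigma>(1) t AG.S_props(1) AH.S_props(1) by (auto simp: bij_betw_def)
    then show "group.ord (G\<lparr>carrier := ?N\<rparr>) (\<sigma> t) = group.ord (H\<lparr>carrier := ?M\<rparr>) t"
      using AG.NA_ord AH.NA_ord \<sigma>(2) t by simp
  qed
  then show ?thesis using assms(5) by simp
qed

end
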